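(* Let $R$ be a regular commutative ring and let $E$ be an $R$-module. If $\operatorname{Ext}_{R}^{1}(R/J,E) = 0$ for every ideal $J$ of $R$ generated by an $R$-regular sequence, then $E$ is an injective $R$-module.
   Context: A regular commutative ring is a commutative Noetherian ring $R$ such that $R_P$ is a regular local ring for every prime ideal $P$ of $R$. A sequence $x_1,\ldots,x_g$ in $R$ is $R$-regular if $x_i$ is a nonzerodivisor on $R/(x_1,\ldots,x_{i-1})$ for each $i$ and $(x_1,\ldots,x_g) \neq R$. *)

theory Defs
  imports "HOL-Algebra.Module" "HOL-Algebra.Ring_Divisibility" "HOL-Library.Extended_Nat"
begin

section \<open>Modules and homomorphisms\<close>

text \<open>
  Records of type \<^typ>\<open>('a, 'b) module\<close> inherit the fields \<^const>\<open>monoid.mult\<close> and \<^const>\<open>one\<close> from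
  rings. They play no role in the locale \<^locale>\<open>module\<close>, so they are left undefined below.
\<close>

definition ring_as_module :: "('a, 'r) ring_scheme \<Rightarrow> ('a, 'a) module" where
  "ring_as_module R =
    \<lparr>carrier = carrier R, monoid.mult = undefined, one = undefined,
     ring.zero = \<zero>\<^bsub>R\<^esub>, add = add R, smult = monoid.mult R\<rparr>"

definition quotient_module :: "('a, 'b, 'm) module_scheme \<Rightarrow> 'b set \<Rightarrow> ('a, 'b set) module" where
  "quotient_module M N =
    \<lparr>carrier = a_rcosets\<^bsub>M\<^esub> N, monoid.mult = undefined, one = undefined,
     ring.zero = N, add = set_add M,
     smult = (\<lambda>r X. \<Union>x\<in>X. N +>\<^bsub>M\<^esub> (r \<odot>\<^bsub>M\<^esub> x))\<rparr>"

text \<open>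
  Homomorphisms are extensional (undefined outside the carrier), so that equality of
  homomorphisms is equality of functions.
\<close>

definition module_hom ::
  "('a, 'r) ring_scheme \<Rightarrow> ('a, 'b, 'm) module_scheme \<Rightarrow> ('a, 'c, 'n) module_scheme \<Rightarrow> ('b \<Rightarrow> 'c) set"
  where
  "module_hom R M N =
    {f \<in> carrier M \<rightarrow>\<^sub>E carrier N.
      (\<forall>x\<in>carrier M. \<forall>y\<in>carrier M. f (x \<oplus>\<^bsub>M\<^esub> y) = f x \<oplus>\<^bsub>N\<^esub> f y) \<and>
      (\<forall>r\<in>carrier R. \<forall>x\<in>carrier M. f (r \<odot>\<^bsub>M\<^esub> x) = r \<odot>\<^bsub>N\<^esub> f x)}"

definition hom_module ::
  "('a, 'r) ring_scheme \<Rightarrow> ('a, 'b, 'm) module_scheme \<Rightarrow> ('a, 'c, 'n) module_scheme \<Rightarrow>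
    ('a, 'b \<Rightarrow> 'c) module"
  where
  "hom_module R M N =
    \<lparr>carrier = module_hom R M N, monoid.mult = undefined, one = undefined,
     ring.zero = (\<lambda>x\<in>carrier M. \<zero>\<^bsub>N\<^esub>),
     add = (\<lambda>f g. \<lambda>x\<in>carrier M. f x \<oplus>\<^bsub>N\<^esub> g x),
     smult = (\<lambda>r f. \<lambda>x\<in>carrier M. r \<odot>\<^bsub>N\<^esub> f x)\<rparr>"

text \<open>
  HOL cannot quantify over types inside a formula, so the types of the elements of the test
  modules \<open>A\<close> and \<open>B\<close> are parameters. A theorem that is polymorphic in \<open>'b\<close> and \<open>'c\<close> asserts
  the lifting property for test modules over arbitrary types.
\<close>

definition injective_module ::
  "'b itself \<Rightarrow> 'c itself \<Rightarrow> ('a, 'r) ring_scheme \<Rightarrow> ('a, 'e, 'm) module_scheme \<Rightarrow> bool"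
  where
  "injective_module (_ :: 'b itself) (_ :: 'c itself) R E \<longleftrightarrow>
    module R E \<and>
    (\<forall>(A :: ('a, 'b) module) (B :: ('a, 'c) module) i f.
      module R A \<and> module R B \<and>
      i \<in> module_hom R A B \<and> inj_on i (carrier A) \<and> f \<in> module_hom R A E \<longrightarrow>
      (\<exists>g\<in>module_hom R B E. \<forall>x\<in>carrier A. g (i x) = f x))"


section \<open>The first Ext module\<close>

text \<open>
  The free module on a set \<open>A\<close>: finitely supported functions from \<open>A\<close> to \<open>R\<close>, extended by zero.
\<close>

definition free_module :: "('a, 'r) ring_scheme \<Rightarrow> 'b set \<Rightarrow> ('a, 'b \<Rightarrow> 'a) module" where
  "free_module R A =
    \<lparr>carrier = {f. f \<in> A \<rightarrow> carrier R \<and> (\<forall>x. x \<notin> A \<longrightarrow> f x = \<zero>\<^bsub>R\<^esub>) \<and> finite {x. f x \<noteq> \<zero>\<^bsub>R\<^esub>}},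
     monoid.mult = undefined, one = undefined,
     ring.zero = (\<lambda>_. \<zero>\<^bsub>R\<^esub>),
     add = (\<lambda>f g x. f x \<oplus>\<^bsub>R\<^esub> g x),
     smult = (\<lambda>r f x. r \<otimes>\<^bsub>R\<^esub> f x)\<rparr>"

text \<open>
  Every module \<open>M\<close> is the image of the free module on its underlying set, under the map that
  sends the basis vector of \<open>x\<close> to \<open>x\<close>. Covering the kernel in the same way, and iterating,
  gives the canonical free resolution of \<open>M\<close>
  \<open>\<dots> \<rightarrow> F\<^sub>2 \<rightarrow> F\<^sub>1 \<rightarrow> F\<^sub>0 \<rightarrow> M \<rightarrow> 0\<close>,
  where \<open>F\<^sub>n\<close> is the free cover of the \<open>n\<close>-th syzygy module. Each syzygy is a submodule of the
  preceding free module, so the cover map of the \<open>n\<close>-th syzygy is also the differential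
  from \<open>F\<^sub>n\<close> to \<open>F\<^sub>n\<^sub>-\<^sub>1\<close>.
\<close>

definition free_cover ::
  "('a, 'r) ring_scheme \<Rightarrow> ('a, 'b, 'm) module_scheme \<Rightarrow> ('a, 'b \<Rightarrow> 'a) module"
  where
  "free_cover R M = free_module R (carrier M)"

definition cover_map ::
  "('a, 'r) ring_scheme \<Rightarrow> ('a, 'b, 'm) module_scheme \<Rightarrow> ('b \<Rightarrow> 'a) \<Rightarrow> 'b"
  where
  "cover_map R M =
    (\<lambda>f\<in>carrier (free_cover R M). \<Oplus>\<^bsub>M\<^esub>x\<in>{x. f x \<noteq> \<zero>\<^bsub>R\<^esub>}. f x \<odot>\<^bsub>M\<^esub> x)"

definition syzygy ::
  "('a, 'r) ring_scheme \<Rightarrow> ('a, 'b, 'm) module_scheme \<Rightarrow> ('a, 'b \<Rightarrow> 'a) module"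
  where
  "syzygy R M =
    (free_cover R M)\<lparr>carrier := a_kernel (free_cover R M) M (cover_map R M)\<rparr>"

text \<open>
  The cohomology at \<open>Hom(F\<^sub>1, E)\<close> of the complex \<open>Hom(F\<^sub>0, E) \<rightarrow> Hom(F\<^sub>1, E) \<rightarrow> Hom(F\<^sub>2, E)\<close>.
\<close>

definition Ext1_cocycles ::
  "('a, 'r) ring_scheme \<Rightarrow> ('a, 'b, 'm) module_scheme \<Rightarrow> ('a, 'e, 'n) module_scheme \<Rightarrow>
    ((('b \<Rightarrow> 'a) \<Rightarrow> 'a) \<Rightarrow> 'e) set"
  where
  "Ext1_cocycles R M E =
    (let F1 = free_cover R (syzygy R M);
         F2 = free_cover R (syzygy R (syzygy R M));
         d2 = cover_map R (syzygy R (syzygy R M))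
     in {\<phi> \<in> module_hom R F1 E. compose (carrier F2) \<phi> d2 = \<zero>\<^bsub>hom_module R F2 E\<^esub>})"

definition Ext1_coboundaries ::
  "('a, 'r) ring_scheme \<Rightarrow> ('a, 'b, 'm) module_scheme \<Rightarrow> ('a, 'e, 'n) module_scheme \<Rightarrow>
    ((('b \<Rightarrow> 'a) \<Rightarrow> 'a) \<Rightarrow> 'e) set"
  where
  "Ext1_coboundaries R M E =
    (let F0 = free_cover R M;
         F1 = free_cover R (syzygy R M);
         d1 = cover_map R (syzygy R M)
     in (\<lambda>\<psi>. compose (carrier F1) \<psi> d1) ` module_hom R F0 E)"

definition Ext1 ::
  "('a, 'r) ring_scheme \<Rightarrow> ('a, 'b, 'm) module_scheme \<Rightarrow> ('a, 'e, 'n) module_scheme \<Rightarrow>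
    ('a, ((('b \<Rightarrow> 'a) \<Rightarrow> 'a) \<Rightarrow> 'e) set) module"
  where
  "Ext1 R M E =
    quotient_module
      ((hom_module R (free_cover R (syzygy R M)) E)\<lparr>carrier := Ext1_cocycles R M E\<rparr>)
      (Ext1_coboundaries R M E)"


section \<open>Regular sequences\<close>

definition nonzerodivisor_on ::
  "('a, 'r) ring_scheme \<Rightarrow> ('a, 'b, 'm) module_scheme \<Rightarrow> 'a \<Rightarrow> bool"
  where
  "nonzerodivisor_on R M x \<longleftrightarrow>
    x \<in> carrier R \<and> (\<forall>y\<in>carrier M. x \<odot>\<^bsub>M\<^esub> y = \<zero>\<^bsub>M\<^esub> \<longrightarrow> y = \<zero>\<^bsub>M\<^esub>)"

definition regular_sequence :: "('a, 'r) ring_scheme \<Rightarrow> 'a list \<Rightarrow> bool" where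
  "regular_sequence R xs \<longleftrightarrow>
    set xs \<subseteq> carrier R \<and>
    (\<forall>i<length xs.
      nonzerodivisor_on R
        (quotient_module (ring_as_module R) (Idl\<^bsub>R\<^esub> (set (take i xs)))) (xs ! i)) \<and>
    Idl\<^bsub>R\<^esub> (set xs) \<noteq> carrier R"


section \<open>Regular rings\<close>

definition frac_rel :: "('a, 'r) ring_scheme \<Rightarrow> 'a set \<Rightarrow> (('a \<times> 'a) \<times> ('a \<times> 'a)) set" where
  "frac_rel R S =
    {((a, s), (b, t)). a \<in> carrier R \<and> s \<in> S \<and> b \<in> carrier R \<and> t \<in> S \<and>
      (\<exists>u\<in>S. u \<otimes>\<^bsub>R\<^esub> (a \<otimes>\<^bsub>R\<^esub> t \<ominus>\<^bsub>R\<^esub> b \<otimes>\<^bsub>R\<^esub> s) = \<zero>\<^bsub>R\<^esub>)}"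

definition localization :: "('a, 'r) ring_scheme \<Rightarrow> 'a set \<Rightarrow> ('a \<times> 'a) set ring" where
  "localization R S =
    \<lparr>carrier = (carrier R \<times> S) // frac_rel R S,
     monoid.mult = (\<lambda>X Y. \<Union>(a, s)\<in>X. \<Union>(b, t)\<in>Y. frac_rel R S `` {(a \<otimes>\<^bsub>R\<^esub> b, s \<otimes>\<^bsub>R\<^esub> t)}),
     one = frac_rel R S `` {(\<one>\<^bsub>R\<^esub>, \<one>\<^bsub>R\<^esub>)},
     ring.zero = frac_rel R S `` {(\<zero>\<^bsub>R\<^esub>, \<one>\<^bsub>R\<^esub>)},
     add = (\<lambda>X Y. \<Union>(a, s)\<in>X. \<Union>(b, t)\<in>Y.
              frac_rel R S `` {(a \<otimes>\<^bsub>R\<^esub> t \<oplus>\<^bsub>R\<^esub> b \<otimes>\<^bsub>R\<^esub> s, s \<otimes>\<^bsub>R\<^esub> t)})\<rparr>"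

definition krull_dim :: "('a, 'r) ring_scheme \<Rightarrow> enat" where
  "krull_dim R =
    (SUP n\<in>{n. \<exists>P :: nat \<Rightarrow> 'a set.
        (\<forall>i\<le>n. primeideal (P i) R) \<and> (\<forall>i<n. P i \<subset> P (Suc i))}. enat n)"

definition min_generators :: "('a, 'r) ring_scheme \<Rightarrow> 'a set \<Rightarrow> nat" where
  "min_generators R I =
    (LEAST n. \<exists>X\<subseteq>carrier R. finite X \<and> card X = n \<and> I = Idl\<^bsub>R\<^esub> X)"

definition regular_local_ring :: "('a, 'r) ring_scheme \<Rightarrow> bool" where
  "regular_local_ring R \<longleftrightarrow>
    cring R \<and> noetherian_ring R \<and> (\<exists>!m. maximalideal m R) \<and>
    (\<forall>m. maximalideal m R \<longrightarrow> krull_dim R = enat (min_generators R m))"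

definition regular_ring :: "('a, 'r) ring_scheme \<Rightarrow> bool" where
  "regular_ring R \<longleftrightarrow>
    cring R \<and> noetherian_ring R \<and>
    (\<forall>P. primeideal P R \<longrightarrow> regular_local_ring (localization R (carrier R - P)))"

end

theory Submission
  imports Defs
begin

text \<open>
  By Baer's criterion and Noetherian induction it suffices to extend a map \<open>f : P \<rightarrow> E\<close> to \<open>R\<close> for a
  prime \<open>P\<close>, provided that maps from all strictly larger ideals extend. A regular sequence that
  generates \<open>P\<close> locally at \<open>P\<close> generates an ideal \<open>J \<subseteq> P\<close> with \<open>sP \<subseteq> J\<close> for some \<open>s \<notin> P\<close>. As
  \<open>Ext\<^sup>1(R/J, E) = 0\<close>, one may subtract a multiple of an element of \<open>E\<close> to get \<open>f = 0\<close> on \<open>J\<close>. Then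
  \<open>s f(P) = 0\<close>, so \<open>p + rs \<mapsto> f(p)\<close> is well defined on \<open>P + Rs\<close>, and it extends to \<open>R\<close>.

  The regular sequence is chosen inductively by prime avoidance. The elements \<open>x\<^sub>1, \<dots>, x\<^sub>k\<close> with
  \<open>k < dim R\<^sub>P\<close> are part of a minimal system of generators of \<open>PR\<^sub>P\<close>, and \<open>P\<close> lies in no associated
  prime \<open>Q\<close> of \<open>(x\<^sub>1, \<dots>, x\<^sub>k)\<close>: the sequence would be maximal in \<open>R\<^sub>Q\<close>, so
  \<open>k = depth R\<^sub>Q = dim R\<^sub>Q \<ge> dim R\<^sub>P\<close>.
\<close>

section \<open>Ideals\<close>

text \<open>The hypothesis on Ext concerns sequences that are regular on R itself. Generators of
  PR_P lifted to R form a sequence that is regular only near P, so each new element has to avoid all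
  associated primes of the preceding ideal, also those outside P. This can fail only at an
  associated prime Q \<supseteq> P, and excluding such Q uses the regularity of R_Q, not just of
  R_P.

  Local algebra is carried out inside R. An ideal of R_Q/A_Q is represented by an ideal N
  \<supseteq> A of R with \<open>sat Q N = N\<close>, and quotients by A are replaced by statements
  relative to A. All local rings then live in one type, and an induction along a sequence merely
  changes A. The localization of the definition is entered only to extract n local generators of a
  prime and a chain of primes with n strict inclusions below it.

  Primes suffice in the induction because a homomorphism on I can be extended in two stages,
  controlled by I : a and by I + Ra.\<close>

lemma (in ring) ideal_subset_carrier: "ideal I R \<Longrightarrow> I \<subseteq> carrier R"
  by (simp add: additive_subgroup.a_subset ideal.axioms(1))

lemma (in ring) ideal_zero_mem: "ideal I R \<Longrightarrow> \<zero> \<in> I"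
  by (simp add: additive_subgroup.zero_closed ideal.axioms(1))

lemma (in ring) ideal_add_mem: "\<lbrakk>ideal I R; a \<in> I; b \<in> I\<rbrakk> \<Longrightarrow> a \<oplus> b \<in> I"
  by (simp add: additive_subgroup.a_closed ideal.axioms(1))

lemma (in ring) ideal_mult_mem: "\<lbrakk>ideal I R; a \<in> I; r \<in> carrier R\<rbrakk> \<Longrightarrow> r \<otimes> a \<in> I"
  by (simp add: ideal.I_l_closed)

lemma (in ring) ideal_minus_mem:
  assumes "ideal I R" "a \<in> I" "b \<in> I" shows "a \<ominus> b \<in> I"
  using assms unfolding a_minus_def
  by (simp add: additive_subgroup.a_inv_closed ideal.axioms(1) ideal_add_mem)

lemma (in ring) ideal_add_cancel:
  assumes "ideal I R" "a \<in> carrier R" "b \<in> I" "a \<oplus> b \<in> I" shows "a \<in> I"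
proof -
  have "b \<in> carrier R" using assms ideal_subset_carrier by blast
  then have "a = (a \<oplus> b) \<ominus> b" using assms(2) by algebra
  then show ?thesis using assms ideal_minus_mem by metis
qed

lemma (in cring) ideal_introI:
  assumes "I \<subseteq> carrier R" "\<zero> \<in> I"
    and add: "\<And>a b. \<lbrakk>a \<in> I; b \<in> I\<rbrakk> \<Longrightarrow> a \<oplus> b \<in> I"
    and mult: "\<And>r a. \<lbrakk>r \<in> carrier R; a \<in> I\<rbrakk> \<Longrightarrow> r \<otimes> a \<in> I"
  shows "ideal I R"
proof (rule idealI)
  show "ring R" by (rule ring_axioms)
  show "subgroup I (add_monoid R)"
  proof (rule add.subgroupI)
    show "\<ominus> a \<in> I" if "a \<in> I" for a
    proof -
      have "a \<in> carrier R" using that assms(1) by blast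
      then have "(\<ominus> \<one>) \<otimes> a = \<ominus> a" by algebra
      then show ?thesis using mult[of "\<ominus> \<one>" a] that by simp
    qed
  qed (use assms in \<open>auto\<close>)
  show "r \<otimes> a \<in> I" if "a \<in> I" "r \<in> carrier R" for a r using mult that by simp
  then show "a \<otimes> r \<in> I" if "a \<in> I" "r \<in> carrier R" for a r
    using that assms(1) m_comm by (metis subsetD)
qed

lemma primeideal_mem_cases:
  assumes "primeideal P R" "a \<in> carrier R" "b \<in> carrier R" "a \<otimes>\<^bsub>R\<^esub> b \<in> P"
  shows "a \<in> P \<or> b \<in> P"
  using primeideal.I_prime[OF assms(1-3)] assms(4) by blast

lemma primeideal_one_notin:
  assumes "primeideal P R" shows "\<one>\<^bsub>R\<^esub> \<notin> P"
  using assms by (metis ideal.one_imp_carrier primeideal.I_notcarr primeideal.axioms(1))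

section \<open>Colon ideals, the ideals A + Rx, and contractions from a localization\<close>

context cring
begin

definition colon :: "'a set \<Rightarrow> 'a \<Rightarrow> 'a set" where
  "colon A a = {r \<in> carrier R. r \<otimes> a \<in> A}"

text \<open>The ideal A + Rx, written as a congruence modulo A so that a member comes with one
  coefficient r. \<open>foldl adjoin A xs\<close> adds the entries one at a time, in step with the
  recursive notion of a regular sequence.\<close>

definition adjoin :: "'a set \<Rightarrow> 'a \<Rightarrow> 'a set" where
  "adjoin A x = {u \<in> carrier R. \<exists>r\<in>carrier R. u \<ominus> r \<otimes> x \<in> A}"

text \<open>The contraction to \<open>R\<close> of the extension of \<open>A\<close> to the localization at the prime \<open>Q\<close>.\<close>

definition sat :: "'a set \<Rightarrow> 'a set \<Rightarrow> 'a set" where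
  "sat Q A = {u \<in> carrier R. \<exists>s\<in>carrier R - Q. s \<otimes> u \<in> A}"

lemma colon_mem_iff: "r \<in> colon A a \<longleftrightarrow> r \<in> carrier R \<and> r \<otimes> a \<in> A"
  by (simp add: colon_def)

lemma satI: "\<lbrakk>u \<in> carrier R; s \<in> carrier R; s \<notin> Q; s \<otimes> u \<in> A\<rbrakk> \<Longrightarrow> u \<in> sat Q A"
  by (auto simp: sat_def)

lemma satE:
  assumes "u \<in> sat Q A"
  obtains s where "u \<in> carrier R" "s \<in> carrier R" "s \<notin> Q" "s \<otimes> u \<in> A"
  using assms by (auto simp: sat_def)

lemma adjoinI: "\<lbrakk>u \<in> carrier R; r \<in> carrier R; u \<ominus> r \<otimes> x \<in> A\<rbrakk> \<Longrightarrow> u \<in> adjoin A x"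
  by (auto simp: adjoin_def)

lemma adjoinE:
  assumes "u \<in> adjoin A x"
  obtains r where "u \<in> carrier R" "r \<in> carrier R" "u \<ominus> r \<otimes> x \<in> A"
  using assms by (auto simp: adjoin_def)

lemma ideal_colon:
  assumes "ideal A R" "a \<in> carrier R" shows "ideal (colon A a) R"
proof (rule ideal_introI)
  show "u \<oplus> v \<in> colon A a" if "u \<in> colon A a" "v \<in> colon A a" for u v
    using that assms by (auto simp: colon_def l_distr ideal_add_mem)
  show "r \<otimes> u \<in> colon A a" if "r \<in> carrier R" "u \<in> colon A a" for r u
    using that assms by (auto simp: colon_def m_assoc ideal_mult_mem)
qed (use assms in \<open>auto simp: colon_def ideal_zero_mem\<close>)

lemma colon_superset: assumes "ideal A R" "a \<in> carrier R" shows "A \<subseteq> colon A a"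
proof
  fix u assume u: "u \<in> A"
  then have "u \<in> carrier R" using assms(1) ideal_subset_carrier by blast
  then show "u \<in> colon A a"
    using assms u ideal_mult_mem[of A u a] by (simp add: colon_def m_comm)
qed

lemma adjoin_superset: assumes "ideal A R" "x \<in> carrier R" shows "A \<subseteq> adjoin A x"
proof
  fix u assume u: "u \<in> A"
  then have uc: "u \<in> carrier R" using assms(1) ideal_subset_carrier by blast
  then have "u \<ominus> \<zero> \<otimes> x = u" using assms by algebra
  then show "u \<in> adjoin A x" using u uc by (intro adjoinI[of u \<zero>]) auto
qed

lemma adjoin_self: assumes "ideal A R" "x \<in> carrier R" shows "x \<in> adjoin A x"
proof -
  have "x \<ominus> \<one> \<otimes> x = \<zero>" using assms by algebra
  then show ?thesis using assms adjoinI[of x \<one> x A] ideal_zero_mem[OF assms(1)] by (metis one_closed)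
qed

lemma ideal_adjoin:
  assumes A: "ideal A R" and x: "x \<in> carrier R" shows "ideal (adjoin A x) R"
proof (rule ideal_introI)
  show "u \<oplus> v \<in> adjoin A x" if u: "u \<in> adjoin A x" and v: "v \<in> adjoin A x" for u v
  proof -
    obtain r where r: "u \<in> carrier R" "r \<in> carrier R" "u \<ominus> r \<otimes> x \<in> A" using u by (rule adjoinE)
    obtain t where t: "v \<in> carrier R" "t \<in> carrier R" "v \<ominus> t \<otimes> x \<in> A" using v by (rule adjoinE)
    have "(u \<oplus> v) \<ominus> (r \<oplus> t) \<otimes> x = (u \<ominus> r \<otimes> x) \<oplus> (v \<ominus> t \<otimes> x)" using r(1,2) t(1,2) x by algebra
    then show ?thesis using r t ideal_add_mem[OF A] by (intro adjoinI[of _ "r \<oplus> t"]) auto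
  qed
  show "c \<otimes> u \<in> adjoin A x" if c: "c \<in> carrier R" and u: "u \<in> adjoin A x" for c u
  proof -
    obtain r where r: "u \<in> carrier R" "r \<in> carrier R" "u \<ominus> r \<otimes> x \<in> A" using u by (rule adjoinE)
    have "c \<otimes> u \<ominus> (c \<otimes> r) \<otimes> x = c \<otimes> (u \<ominus> r \<otimes> x)" using r(1,2) c x by algebra
    then show ?thesis using r c ideal_mult_mem[OF A] by (intro adjoinI[of _ "c \<otimes> r"]) auto
  qed
  show "adjoin A x \<subseteq> carrier R" by (auto simp: adjoin_def)
  show "\<zero> \<in> adjoin A x" using adjoin_superset[OF A x] ideal_zero_mem[OF A] by blast
qed

lemma adjoin_minimal:
  assumes "ideal N R" "A \<subseteq> N" "x \<in> N" shows "adjoin A x \<subseteq> N"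
proof
  fix u assume "u \<in> adjoin A x"
  then obtain r where r: "u \<in> carrier R" "r \<in> carrier R" "u \<ominus> r \<otimes> x \<in> A" by (rule adjoinE)
  have x: "x \<in> carrier R" using assms ideal_subset_carrier by blast
  have "u = (u \<ominus> r \<otimes> x) \<oplus> r \<otimes> x" using r(1,2) x by algebra
  then show "u \<in> N" using assms r ideal_add_mem ideal_mult_mem by (metis subsetD)
qed

lemma adjoin_mono: "A \<subseteq> B \<Longrightarrow> adjoin A x \<subseteq> adjoin B x"
  by (auto simp: adjoin_def)

lemma sat_mono: "A \<subseteq> B \<Longrightarrow> sat Q A \<subseteq> sat Q B"
  by (auto simp: sat_def)

lemma sat_mono_prime: "P \<subseteq> Q \<Longrightarrow> sat Q A \<subseteq> sat P A"
  by (auto simp: sat_def)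

lemma sat_superset: assumes "primeideal Q R" "ideal A R" shows "A \<subseteq> sat Q A"
proof
  fix u assume "u \<in> A"
  moreover then have "u \<in> carrier R" using assms ideal_subset_carrier by blast
  ultimately show "u \<in> sat Q A"
    using primeideal_one_notin[OF assms(1)] by (intro satI[of u \<one>]) auto
qed

lemma prime_mult_notin:
  "\<lbrakk>primeideal Q R; s \<in> carrier R; s \<notin> Q; t \<in> carrier R; t \<notin> Q\<rbrakk> \<Longrightarrow> s \<otimes> t \<notin> Q"
  by (auto dest: primeideal_mem_cases)

lemma ideal_sat: assumes Q: "primeideal Q R" and A: "ideal A R" shows "ideal (sat Q A) R"
proof (rule ideal_introI)
  show "u \<oplus> v \<in> sat Q A" if u: "u \<in> sat Q A" and v: "v \<in> sat Q A" for u v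
  proof -
    obtain s where s: "u \<in> carrier R" "s \<in> carrier R" "s \<notin> Q" "s \<otimes> u \<in> A" using u by (rule satE)
    obtain t where t: "v \<in> carrier R" "t \<in> carrier R" "t \<notin> Q" "t \<otimes> v \<in> A" using v by (rule satE)
    have "(s \<otimes> t) \<otimes> (u \<oplus> v) = t \<otimes> (s \<otimes> u) \<oplus> s \<otimes> (t \<otimes> v)" using s(1,2) t(1,2) by algebra
    then show ?thesis using s t ideal_add_mem[OF A] ideal_mult_mem[OF A] prime_mult_notin[OF Q]
      by (intro satI[of _ "s \<otimes> t"]) auto
  qed
  show "c \<otimes> u \<in> sat Q A" if c: "c \<in> carrier R" and u: "u \<in> sat Q A" for c u
  proof -
    obtain s where s: "u \<in> carrier R" "s \<in> carrier R" "s \<notin> Q" "s \<otimes> u \<in> A" using u by (rule satE)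
    have "s \<otimes> (c \<otimes> u) = c \<otimes> (s \<otimes> u)" using s(1,2) c by algebra
    then show ?thesis using s c ideal_mult_mem[OF A] by (intro satI[of _ s]) auto
  qed
  show "sat Q A \<subseteq> carrier R" by (auto simp: sat_def)
  show "\<zero> \<in> sat Q A" using sat_superset[OF assms] ideal_zero_mem[OF A] by blast
qed

lemma sat_sat: assumes Q: "primeideal Q R" and A: "ideal A R" shows "sat Q (sat Q A) = sat Q A"
proof
  show "sat Q (sat Q A) \<subseteq> sat Q A"
  proof
    fix u assume "u \<in> sat Q (sat Q A)"
    then obtain s where s: "u \<in> carrier R" "s \<in> carrier R" "s \<notin> Q" "s \<otimes> u \<in> sat Q A" by (rule satE)
    from s(4) obtain t where t: "t \<in> carrier R" "t \<notin> Q" "t \<otimes> (s \<otimes> u) \<in> A" by (auto elim: satE)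
    then have "(t \<otimes> s) \<otimes> u \<in> A" using s by (simp add: m_assoc)
    then show "u \<in> sat Q A" using s t prime_mult_notin[OF Q] by (intro satI[of _ "t \<otimes> s"]) auto
  qed
  show "sat Q A \<subseteq> sat Q (sat Q A)" by (rule sat_superset[OF Q ideal_sat[OF Q A]])
qed

lemma sat_minimal:
  assumes "primeideal Q R" "ideal N R" "sat Q N = N" "A \<subseteq> N" shows "sat Q A \<subseteq> N"
  using sat_mono[OF assms(4)] assms(3) by blast

lemma sat_prime:
  assumes Q: "primeideal Q R" and P: "primeideal P R" and "P \<subseteq> Q" shows "sat Q P = P"
proof
  show "sat Q P \<subseteq> P"
    using primeideal_mem_cases[OF P] assms(3) by (auto elim!: satE)
  show "P \<subseteq> sat Q P" using sat_superset Q P primeideal.axioms(1) by blast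
qed

lemma sat_subset_prime:
  assumes Q: "primeideal Q R" and P: "primeideal P R" and "P \<subseteq> Q" "A \<subseteq> P" shows "sat Q A \<subseteq> P"
  using sat_mono[OF assms(4), of Q] sat_prime[OF assms(1-3)] by simp

lemma sat_cancel:
  assumes "sat Q N = N" "u \<in> carrier R" "s \<in> carrier R" "s \<notin> Q" "s \<otimes> u \<in> N" shows "u \<in> N"
  using assms satI by blast

lemma ideal_foldl_adjoin:
  "\<lbrakk>ideal A R; set xs \<subseteq> carrier R\<rbrakk> \<Longrightarrow> ideal (foldl adjoin A xs) R"
  by (induction xs arbitrary: A) (auto simp: ideal_adjoin)

lemma foldl_adjoin_superset:
  "\<lbrakk>ideal A R; set xs \<subseteq> carrier R\<rbrakk> \<Longrightarrow> A \<union> set xs \<subseteq> foldl adjoin A xs"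
proof (induction xs arbitrary: A)
  case (Cons x xs)
  then show ?case
    using Cons.IH[of "adjoin A x"] ideal_adjoin[of A x] adjoin_superset[of A x] adjoin_self[of A x]
    by auto
qed simp

lemma foldl_adjoin_minimal:
  "\<lbrakk>ideal N R; A \<subseteq> N; set xs \<subseteq> N\<rbrakk> \<Longrightarrow> foldl adjoin A xs \<subseteq> N"
  by (induction xs arbitrary: A) (auto simp: adjoin_minimal)

lemma foldl_adjoin_eq_genideal:
  assumes "set xs \<subseteq> carrier R" shows "foldl adjoin {\<zero>} xs = Idl (set xs)"
proof
  show "foldl adjoin {\<zero>} xs \<subseteq> Idl (set xs)"
    using assms genideal_ideal[OF assms] genideal_self[OF assms]
    by (intro foldl_adjoin_minimal) (auto simp: ideal_zero_mem)
  show "Idl (set xs) \<subseteq> foldl adjoin {\<zero>} xs"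
    using foldl_adjoin_superset[OF zeroideal assms] ideal_foldl_adjoin[OF zeroideal assms]
    by (intro genideal_minimal) auto
qed

end

section \<open>Noetherian rings\<close>

locale noetherian_cring = cring R + noetherian_ring R for R (structure)
begin

text \<open>By the induction step, every counterexample lies strictly inside another one. Iterating
  a choice \<open>nx\<close> of a larger one gives a strictly ascending chain; the chain condition
  makes its union a member of it, which is absurd.\<close>

lemma ideal_induct [consumes 1, case_names step]:
  assumes "ideal A R"
    and step: "\<And>I. \<lbrakk>ideal I R; \<And>J. \<lbrakk>ideal J R; I \<subset> J\<rbrakk> \<Longrightarrow> \<Phi> J\<rbrakk> \<Longrightarrow> \<Phi> I"
  shows "\<Phi> A"
proof (rule ccontr)
  assume "\<not> \<Phi> A"
  define B where "B = {I. ideal I R \<and> \<not> \<Phi> I}"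
  have ex: "\<exists>J\<in>B. I \<subset> J" if "I \<in> B" for I using step[of I] that unfolding B_def by auto
  define nx where "nx I = (SOME J. J \<in> B \<and> I \<subset> J)" for I
  have nx: "nx I \<in> B \<and> I \<subset> nx I" if "I \<in> B" for I
    unfolding nx_def using someI_ex[of "\<lambda>J. J \<in> B \<and> I \<subset> J"] ex[OF that] by blast
  define c where "c n = (nx ^^ n) A" for n
  have cB: "c n \<in> B" for n
  proof (induction n)
    case 0
    show ?case using \<open>\<not> \<Phi> A\<close> assms(1) by (simp add: c_def B_def)
  next
    case (Suc n)
    then show ?case using nx[of "c n"] by (simp add: c_def)
  qed
  have cs: "c n \<subset> c (Suc n)" for n using nx[OF cB[of n]] by (simp add: c_def)
  have mono: "c m \<subseteq> c n" if "m \<le> n" for m n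
    using lift_Suc_mono_le[of c m n] cs that by (simp add: less_imp_le)
  have "subset.chain {I. ideal I R} (range c)"
    unfolding subset_chain_def
  proof (intro conjI ballI)
    show "range c \<subseteq> {I. ideal I R}" using cB by (auto simp: B_def)
    fix X Y assume "X \<in> range c" "Y \<in> range c"
    then obtain m n where "X = c m" "Y = c n" by blast
    then show "X \<subseteq> Y \<or> Y \<subseteq> X" using mono[of m n] mono[of n m] by (metis nat_le_linear)
  qed
  then have "\<Union>(range c) \<in> range c" by (intro ideal_chain_is_trivial) auto
  then obtain n where "\<Union>(range c) = c n" by auto
  then have "c (Suc n) \<subseteq> c n" by auto
  then show False using cs[of n] by auto
qed

lemma ideal_maximal_exists:
  assumes "ideal A R" "\<Phi> A"
  obtains N where "ideal N R" "A \<subseteq> N" "\<Phi> N" "\<And>J. \<lbrakk>ideal J R; N \<subset> J\<rbrakk> \<Longrightarrow> \<not> \<Phi> J"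
proof -
  have "\<Phi> A \<longrightarrow> (\<exists>N. ideal N R \<and> A \<subseteq> N \<and> \<Phi> N \<and> (\<forall>J. ideal J R \<longrightarrow> N \<subset> J \<longrightarrow> \<not> \<Phi> J))"
    using assms(1)
  proof (induction rule: ideal_induct)
    case (step I)
    show ?case
    proof
      assume I: "\<Phi> I"
      show "\<exists>N. ideal N R \<and> I \<subseteq> N \<and> \<Phi> N \<and> (\<forall>J. ideal J R \<longrightarrow> N \<subset> J \<longrightarrow> \<not> \<Phi> J)"
      proof (cases "\<exists>J. ideal J R \<and> I \<subset> J \<and> \<Phi> J")
        case True
        then obtain J where J: "ideal J R" "I \<subset> J" "\<Phi> J" by blast
        from step(2)[OF J(1,2)] J(3) show ?thesis using J(2) by (meson psubsetE subset_trans)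
      next
        case False
        then show ?thesis using I step(1) by blast
      qed
    qed
  qed
  then show ?thesis using assms(2) that by blast
qed

text \<open>
  Induction along \<open>0 \<rightarrow> R/(I:a) \<rightarrow> R/I \<rightarrow> R/(I+Ra) \<rightarrow> 0\<close>, as in the construction of prime filtrations.
\<close>

lemma ideal_prime_induct [consumes 1, case_names carrier prime colon]:
  assumes "ideal A R"
    and carr: "\<Phi> (carrier R)"
    and prime: "\<And>P. \<lbrakk>primeideal P R; \<And>J. \<lbrakk>ideal J R; P \<subset> J\<rbrakk> \<Longrightarrow> \<Phi> J\<rbrakk> \<Longrightarrow> \<Phi> P"
    and colon: "\<And>I a. \<lbrakk>ideal I R; a \<in> carrier R; \<Phi> (colon I a); \<Phi> (adjoin I a)\<rbrakk> \<Longrightarrow> \<Phi> I"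
  shows "\<Phi> A"
  using assms(1)
proof (induction rule: ideal_induct)
  case (step I)
  consider "I = carrier R" | "primeideal I R"
    | a b where "a \<in> carrier R" "b \<in> carrier R" "a \<notin> I" "b \<notin> I" "a \<otimes> b \<in> I"
    using step(1) primeidealI[OF step(1) cring_axioms] by blast
  then show ?case
  proof cases
    case 3
    \<comment> \<open>A failure of primality makes both ideals strictly larger than I: b enters the
      colon ideal and a enters I + Ra.\<close>
    have "b \<in> colon I a" using 3 m_comm by (simp add: colon_mem_iff)
    then have "I \<subset> colon I a" "I \<subset> adjoin I a"
      using 3 colon_superset[OF step(1) 3(1)] adjoin_superset[OF step(1) 3(1)]
        adjoin_self[OF step(1) 3(1)] by auto
    then show ?thesis
      using colon[OF step(1) 3(1)] step(2) ideal_colon[OF step(1) 3(1)] ideal_adjoin[OF step(1) 3(1)]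
      by blast
  qed (use carr prime step(2) in auto)
qed

end

section \<open>Prime avoidance and chains of primes\<close>

context cring
begin

lemma mem_of_prime_power:
  assumes "primeideal P R" "x \<in> carrier R" "x [^] (n::nat) \<in> P" shows "x \<in> P"
  using assms(3)
proof (induction n)
  case 0
  then show ?case using primeideal_one_notin[OF assms(1)] by simp
next
  case (Suc n)
  then show ?case using primeideal_mem_cases[OF assms(1), of "x [^] n" x] assms(2) by auto
qed

text \<open>A product of elements of the ideals, each chosen outside the prime p, stays outside p.
  Carrying K along as an additional factor keeps the product in K.\<close>

lemma inter_ideals_not_subset_prime:
  assumes p: "primeideal p R" and "finite G" and "\<And>I. I \<in> G \<Longrightarrow> ideal I R \<and> \<not> I \<subseteq> p"
    and K: "ideal K R" "\<not> K \<subseteq> p"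
  shows "\<exists>z\<in>K. z \<notin> p \<and> (\<forall>I\<in>G. z \<in> I)"
  using assms(2,3)
proof (induction G rule: finite_induct)
  case empty
  then show ?case using K(2) by blast
next
  case (insert I G)
  then obtain z where z: "z \<in> K" "z \<notin> p" "\<forall>I\<in>G. z \<in> I" by auto
  have I: "ideal I R" and "\<not> I \<subseteq> p" using insert.prems by auto
  then obtain w where w: "w \<in> I" "w \<notin> p" by blast
  have c: "z \<in> carrier R" "w \<in> carrier R" using z(1) w(1) I K(1) ideal_subset_carrier by blast+
  have "w \<otimes> z \<in> J" if "ideal J R" "z \<in> J" for J using that c ideal_mult_mem by blast
  moreover have "w \<otimes> z \<in> I" using w c ideal_mult_mem[OF I, of w z] by (simp add: m_comm)
  moreover have "w \<otimes> z \<notin> p" using prime_mult_notin[OF p] c z w by blast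
  ultimately show ?case using z K(1) insert.prems by (intro bexI[of _ "w \<otimes> z"]) auto
qed

text \<open>The usual prime avoidance, for the coset x + K instead of K. The coset form is what
  later allows a generator to be modified by an element of Q^2 without losing its class modulo
  Q^2.\<close>

lemma coset_prime_avoidance:
  assumes "finite F" and "\<And>p. p \<in> F \<Longrightarrow> primeideal p R \<and> \<not> K \<subseteq> p"
    and K: "ideal K R" and x: "x \<in> carrier R"
  shows "\<exists>k\<in>K. \<forall>p\<in>F. x \<oplus> k \<notin> p"
  using assms(1,2)
proof (induction F rule: finite_psubset_induct)
  case (psubset F)
  show ?case
  proof (cases "F = {}")
    case True
    then show ?thesis using ideal_zero_mem[OF K] by blast
  next
    case False
    then obtain q where q: "q \<in> F" and qmin: "\<And>p. \<lbrakk>p \<in> F; p \<subseteq> q\<rbrakk> \<Longrightarrow> p = q"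
      using finite_has_minimal[OF psubset.hyps(1)] by metis
    have qp: "primeideal q R" and Kq: "\<not> K \<subseteq> q" using psubset.prems q by auto
    obtain k where k: "k \<in> K" "\<forall>p\<in>F - {q}. x \<oplus> k \<notin> p"
      using psubset.IH[of "F - {q}"] psubset.prems q by auto
    have kc: "k \<in> carrier R" using k K ideal_subset_carrier by blast
    show ?thesis
    proof (cases "x \<oplus> k \<in> q")
      case False
      then show ?thesis using k by blast
    next
      case True
      \<comment> \<open>No other member of F lies in q, by minimality, so some z \<in> K lies in all
        of them but not in q. Adding z repairs the failure at q and changes nothing at the other
        primes.\<close>
      obtain z where z: "z \<in> K" "z \<notin> q" "\<forall>p\<in>F - {q}. z \<in> p"
        using inter_ideals_not_subset_prime[OF qp finite_Diff[OF psubset.hyps(1)] _ K Kq] psubset.prems qmin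
        by (metis DiffD1 DiffD2 insertI1 primeideal.axioms(1))
      have zc: "z \<in> carrier R" using z K ideal_subset_carrier by blast
      have "x \<oplus> (k \<oplus> z) \<notin> p" if p: "p \<in> F" for p
      proof
        assume a: "x \<oplus> (k \<oplus> z) \<in> p"
        have pi: "ideal p R" using psubset.prems p primeideal.axioms(1) by blast
        have eq: "x \<oplus> (k \<oplus> z) = (x \<oplus> k) \<oplus> z" "x \<oplus> (k \<oplus> z) = z \<oplus> (x \<oplus> k)"
          using x kc zc by algebra+
        show False
        proof (cases "p = q")
          case True
          then show ?thesis
            using ideal_add_cancel[OF pi zc, of "x \<oplus> k"] a eq(2) \<open>x \<oplus> k \<in> q\<close> z(2) by auto
        next
          case False
          then show ?thesis
            using ideal_add_cancel[OF pi, of "x \<oplus> k" z] a eq(1) x kc z(3) k(2) p by auto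
        qed
      qed
      then show ?thesis using ideal_add_mem[OF K k(1) z(1)] by blast
    qed
  qed
qed

definition ass :: "'a set \<Rightarrow> 'a set set" where
  "ass A = {p. primeideal p R \<and> (\<exists>u\<in>carrier R. p = colon A u)}"

lemma colon_eq_carrier: "\<lbrakk>ideal A R; u \<in> A\<rbrakk> \<Longrightarrow> colon A u = carrier R"
  by (auto simp: colon_def ideal_mult_mem)

lemma primeideal_neq_carrier: "primeideal P R \<Longrightarrow> P \<noteq> carrier R"
  using primeideal.I_notcarr by blast

lemma colon_mult_superset:
  assumes "ideal A R" "v \<in> carrier R" "b \<in> carrier R" shows "colon A v \<subseteq> colon A (b \<otimes> v)"
proof
  fix r assume "r \<in> colon A v"
  then have r: "r \<in> carrier R" "r \<otimes> v \<in> A" by (auto simp: colon_def)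
  have "r \<otimes> (b \<otimes> v) = b \<otimes> (r \<otimes> v)" using r(1) assms(2,3) by algebra
  then show "r \<in> colon A (b \<otimes> v)" using r assms ideal_mult_mem by (simp add: colon_def)
qed

lemma sat_eq_carrier:
  assumes "ideal C R" "sat Q C = C" "s \<in> C" "s \<notin> Q" shows "C = carrier R"
proof -
  have sc: "s \<in> carrier R" using assms ideal_subset_carrier by blast
  have "u \<in> C" if "u \<in> carrier R" for u
    using sat_cancel[OF assms(2) that sc assms(4)] ideal_mult_mem[OF assms(1,3) that]
    by (simp add: m_comm sc that)
  then show ?thesis using assms(1) ideal_subset_carrier by blast
qed

lemma sat_colon:
  assumes "primeideal Q R" "ideal C R" "sat Q C = C" "a \<in> carrier R"
  shows "sat Q (colon C a) = colon C a"
proof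
  show "sat Q (colon C a) \<subseteq> colon C a"
  proof
    fix u assume "u \<in> sat Q (colon C a)"
    then obtain s where s: "u \<in> carrier R" "s \<in> carrier R" "s \<notin> Q" "s \<otimes> u \<in> colon C a" by (rule satE)
    then have "s \<otimes> (u \<otimes> a) \<in> C" using assms(4) by (simp add: colon_def m_assoc)
    then show "u \<in> colon C a"
      using sat_cancel[OF assms(3), of "u \<otimes> a" s] s assms(4) by (simp add: colon_def)
  qed
  show "colon C a \<subseteq> sat Q (colon C a)" using assms ideal_colon sat_superset by blast
qed

text \<open>A chain of primes with n strict inclusions that starts at a prime over A and ends at Q:
  for a prime Q this means dim R_Q/A_Q \<ge> n. Keeping only a lower bound avoids suprema, and the
  recursion peels off the top of the chain.\<close>

primrec height_ge :: "'a set \<Rightarrow> nat \<Rightarrow> 'a set \<Rightarrow> bool" where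
  "height_ge A 0 Q \<longleftrightarrow> A \<subseteq> Q"
| "height_ge A (Suc n) Q \<longleftrightarrow> (\<exists>P. primeideal P R \<and> P \<subset> Q \<and> height_ge A n P)"

lemma height_ge_subset: "height_ge A n Q \<Longrightarrow> A \<subseteq> Q"
  by (induction n arbitrary: Q) auto

lemma height_ge_mono: "\<lbrakk>height_ge A n Q; Q \<subseteq> Q'\<rbrakk> \<Longrightarrow> height_ge A n Q'"
  by (cases n) (simp, metis height_ge.simps(2) psubset_subset_trans)

end

section \<open>Associated primes and minimal primes\<close>

context noetherian_cring
begin

text \<open>R/P has only P as associated prime, and the exact sequence behind
  \<open>ideal_prime_induct\<close> gives Ass(R/I) \<subseteq> Ass(R/(I : a)) \<union> Ass(R/(I +
  Ra)).\<close>

lemma finite_ass: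
  assumes "ideal A R" shows "finite (ass A)"
  using assms
proof (induction rule: ideal_prime_induct)
  case carrier
  have "ass (carrier R) = {}"
    using colon_eq_carrier[OF oneideal] primeideal_neq_carrier by (auto simp: ass_def)
  then show ?case by simp
next
  case (prime P)
  have Pi: "ideal P R" using prime primeideal.axioms(1) by blast
  have "ass P \<subseteq> {P}"
  proof
    fix p assume "p \<in> ass P"
    then obtain u where u: "u \<in> carrier R" "p = colon P u" "primeideal p R" by (auto simp: ass_def)
    then have "u \<notin> P" using colon_eq_carrier[OF Pi] primeideal_neq_carrier by blast
    then have "colon P u = P"
      using primeideal_mem_cases[OF prime(1) _ u(1)] colon_superset[OF Pi u(1)]
      by (auto simp: colon_def)
    then show "p \<in> {P}" using u by simp
  qed
  then show ?case using finite_subset by blast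
next
  case (colon I a)
  have "ass I \<subseteq> ass (colon I a) \<union> ass (adjoin I a)"
  proof
    fix p assume "p \<in> ass I"
    then obtain v where v: "v \<in> carrier R" "p = colon I v" "primeideal p R" by (auto simp: ass_def)
    show "p \<in> ass (colon I a) \<union> ass (adjoin I a)"
    \<comment> \<open>Let p be the annihilator of v modulo I. Either some multiple rv with r outside
      p falls into the submodule generated by a, say rv = ta modulo I; since p is prime, rv still
      has annihilator p, so p = (I : a) : t. Or no such multiple exists, and v has the same
      annihilator modulo I + Ra.\<close>
    proof (cases "\<exists>r\<in>carrier R - p. r \<otimes> v \<in> adjoin I a")
      case True
      then obtain r where r: "r \<in> carrier R" "r \<notin> p" "r \<otimes> v \<in> adjoin I a" by blast
      from r(3) obtain t where t: "t \<in> carrier R" "(r \<otimes> v) \<ominus> t \<otimes> a \<in> I" by (rule adjoinE)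
      have "x \<in> p \<longleftrightarrow> x \<in> colon (colon I a) t" if x: "x \<in> carrier R" for x
      proof -
        have d: "x \<otimes> (r \<otimes> v \<ominus> t \<otimes> a) \<in> I" using ideal_mult_mem[OF colon(1) t(2) x] .
        have e1: "x \<otimes> r \<otimes> v = x \<otimes> (r \<otimes> v \<ominus> t \<otimes> a) \<oplus> x \<otimes> t \<otimes> a"
          and e2: "x \<otimes> t \<otimes> a = x \<otimes> r \<otimes> v \<ominus> x \<otimes> (r \<otimes> v \<ominus> t \<otimes> a)"
          using x r(1) v(1) t(1) colon(2) by algebra+
        have "x \<in> p \<longleftrightarrow> x \<otimes> r \<in> p"
          using primeideal_mem_cases[OF v(3) x r(1)] r(2) x
            ideal_mult_mem[OF primeideal.axioms(1)[OF v(3)], of x r] r(1) by (auto simp: m_comm)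
        also have "\<dots> \<longleftrightarrow> x \<otimes> r \<otimes> v \<in> I" using v(2) x r(1) by (simp add: colon_mem_iff)
        also have "\<dots> \<longleftrightarrow> x \<otimes> t \<otimes> a \<in> I"
          using ideal_add_mem[OF colon(1) d, of "x \<otimes> t \<otimes> a"]
            ideal_minus_mem[OF colon(1) _ d, of "x \<otimes> r \<otimes> v"] e1 e2 by metis
        also have "\<dots> \<longleftrightarrow> x \<in> colon (colon I a) t" using x t(1) by (simp add: colon_mem_iff)
        finally show ?thesis .
      qed
      moreover have "p \<subseteq> carrier R" using v(3) primeideal.axioms(1) ideal_subset_carrier by blast
      ultimately have "p = colon (colon I a) t" by (auto simp: colon_mem_iff)
      then show ?thesis using v(3) t(1) by (auto simp: ass_def)
    next
      case False
      have "p = colon (adjoin I a) v"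
        using False adjoin_superset[OF colon(1,2)] unfolding v(2) by (auto simp: colon_mem_iff)
      then show ?thesis using v by (auto simp: ass_def)
    qed
  qed
  then show ?case using colon finite_subset by blast
qed

text \<open>Among the proper ideals A : v, one that is maximal above A : u is prime: if ab lies in
  it and b does not, then A : bv is another such ideal, it contains A : v, and it contains
  a.\<close>

lemma zero_divisor_in_ass:
  assumes A: "ideal A R" and "x \<in> carrier R" "u \<in> carrier R" "u \<notin> A" "x \<otimes> u \<in> A"
  shows "\<exists>p\<in>ass A. x \<in> p"
proof -
  define \<Phi> where "\<Phi> J \<longleftrightarrow> (\<exists>v\<in>carrier R - A. J = colon A v)" for J
  have "\<Phi> (colon A u)" using assms by (auto simp: \<Phi>_def)
  then obtain N where N: "ideal N R" "colon A u \<subseteq> N" "\<Phi> N"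
    and max: "\<And>J. \<lbrakk>ideal J R; N \<subset> J\<rbrakk> \<Longrightarrow> \<not> \<Phi> J"
    using ideal_maximal_exists[OF ideal_colon[OF A assms(3)], of \<Phi>] by blast
  obtain v where v: "v \<in> carrier R" "v \<notin> A" "N = colon A v" using N(3) by (auto simp: \<Phi>_def)
  have "primeideal N R"
  proof (rule primeidealI[OF N(1) cring_axioms])
    show "carrier R \<noteq> N" using v by (metis colon_mem_iff l_one one_closed)
    fix a b assume ab: "a \<in> carrier R" "b \<in> carrier R" "a \<otimes> b \<in> N"
    show "a \<in> N \<or> b \<in> N"
    proof (rule ccontr)
      assume "\<not> (a \<in> N \<or> b \<in> N)"
      then have n: "a \<notin> N" "b \<otimes> v \<notin> A" using ab v by (auto simp: colon_mem_iff)
      have "a \<in> colon A (b \<otimes> v)" using ab v by (simp add: colon_mem_iff m_assoc)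
      then have "N \<subset> colon A (b \<otimes> v)" using n(1) colon_mult_superset[OF A v(1) ab(2)] v(3) by blast
      moreover have "\<Phi> (colon A (b \<otimes> v))" using n(2) ab v by (auto simp: \<Phi>_def)
      moreover have "ideal (colon A (b \<otimes> v)) R" using ideal_colon[OF A] ab v by simp
      ultimately show False using max by metis
    qed
  qed
  moreover have "x \<in> N" using assms N(2) by (auto simp: colon_mem_iff)
  ultimately show ?thesis using v by (auto simp: ass_def)
qed

text \<open>This stands in for the finiteness of the set of minimal primes. A prime over I contains
  I + Ra if it contains a, and I : a otherwise, so the finite sets for these two ideals can be
  united.\<close>

lemma finite_primes_below:
  assumes "ideal A R"
  shows "\<exists>F. finite F \<and> (\<forall>p\<in>F. primeideal p R \<and> A \<subseteq> p) \<and>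
    (\<forall>p. primeideal p R \<longrightarrow> A \<subseteq> p \<longrightarrow> (\<exists>q\<in>F. q \<subseteq> p))"
  using assms
proof (induction rule: ideal_prime_induct)
  case carrier
  have "\<not> carrier R \<subseteq> p" if "primeideal p R" for p
    using that primeideal_one_notin by blast
  then show ?case by (intro exI[of _ "{}"]) simp
next
  case (prime P)
  then show ?case by (intro exI[of _ "{P}"]) auto
next
  case (colon I a)
  obtain F where F: "finite F" "\<And>p. p \<in> F \<Longrightarrow> primeideal p R \<and> colon I a \<subseteq> p"
    "\<And>p. \<lbrakk>primeideal p R; colon I a \<subseteq> p\<rbrakk> \<Longrightarrow> \<exists>q\<in>F. q \<subseteq> p" using colon(3) by blast
  obtain G where G: "finite G" "\<And>p. p \<in> G \<Longrightarrow> primeideal p R \<and> adjoin I a \<subseteq> p"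
    "\<And>p. \<lbrakk>primeideal p R; adjoin I a \<subseteq> p\<rbrakk> \<Longrightarrow> \<exists>q\<in>G. q \<subseteq> p" using colon(4) by blast
  have "\<exists>q\<in>F \<union> G. q \<subseteq> p" if p: "primeideal p R" "I \<subseteq> p" for p
  proof (cases "a \<in> p")
    case True
    then have "adjoin I a \<subseteq> p" using adjoin_minimal[OF primeideal.axioms(1)[OF p(1)] p(2)] by simp
    then show ?thesis using G(3)[OF p(1)] by blast
  next
    case False
    then have "colon I a \<subseteq> p"
      using p primeideal_mem_cases[OF p(1) _ colon(2)] by (auto simp: colon_mem_iff)
    then show ?thesis using F(3)[OF p(1)] by blast
  qed
  then show ?case
  proof (intro exI[of _ "F \<union> G"] conjI ballI allI impI)
    show "finite (F \<union> G)" using F(1) G(1) by simp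
    show "primeideal p R" "I \<subseteq> p" if "p \<in> F \<union> G" for p
      using that F(2)[of p] G(2)[of p] colon_superset[OF colon(1,2)] adjoin_superset[OF colon(1,2)] by auto
  qed
qed

section \<open>Nakayama's lemma and Krull's height theorem\<close>

text \<open>\<open>R\<^sub>Q/A\<^sub>Q\<close> is Artinian if its only prime is the maximal one.\<close>

lemma sat_descending_chain:
  assumes "ideal A R" and Q: "primeideal Q R"
    and "\<And>p. \<lbrakk>primeideal p R; A \<subseteq> p; p \<subseteq> Q\<rbrakk> \<Longrightarrow> p = Q"
    and "\<And>n. ideal (C n) R" "\<And>n. A \<subseteq> C n" "\<And>n. sat Q (C n) = C n" "\<And>n. C (Suc n) \<subseteq> C n"
  shows "\<exists>N. \<forall>n\<ge>N. C n = C N"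
  using assms(1,3-)
proof (induction arbitrary: C rule: ideal_prime_induct)
  case carrier
  have "C n = carrier R" for n
    using ideal_subset_carrier[OF carrier(2)[of n]] carrier(3)[of n] by (rule equalityI)
  then show ?case by auto
next
  case (prime P)
  have anti: "C n \<subseteq> C N" if "N \<le> n" for n N 
    using lift_Suc_antimono_le[of C N n] prime.prems(5) that by simp
  show ?case
  \<comment> \<open>Over P = Q the only saturated ideals are Q and R: a saturated ideal that meets
    the complement of Q is the whole ring.\<close>
  proof (cases "\<exists>N. C N \<subseteq> Q")
    case True
    then obtain N where N: "C N \<subseteq> Q" by blast
    then have "P = Q" using prime.prems(1)[of P] prime.hyps prime.prems(3)[of N] by auto
    then have "C n = Q" if "n \<ge> N" for n using anti[OF that] N prime.prems(3)[of n] by auto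
    then show ?thesis by (intro exI[of _ N]) auto
  next
    case False
    have "C n = carrier R" for n
    proof -
      obtain s where "s \<in> C n" "s \<notin> Q" using False by blast
      then show ?thesis using sat_eq_carrier[OF prime.prems(2,4)] by simp
    qed
    then show ?thesis by auto
  qed
next
  case (colon I a)
  have anti: "C n \<subseteq> C N" if "N \<le> n" for n N 
    using lift_Suc_antimono_le[of C N n] colon.prems(5) that by simp
  have stab: "\<exists>N. \<forall>n\<ge>N. colon (C n) a = colon (C N) a"
  proof (rule colon.IH(1))
    show "ideal (colon (C n) a) R" for n using ideal_colon[OF colon.prems(2) colon.hyps(2)] .
    show "colon I a \<subseteq> colon (C n) a" for n using colon.prems(3)[of n] by (auto simp: colon_mem_iff)
    show "sat Q (colon (C n) a) = colon (C n) a" for n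
      using sat_colon[OF Q colon.prems(2,4) colon.hyps(2)] .
    show "colon (C (Suc n)) a \<subseteq> colon (C n) a" for n
      using colon.prems(5)[of n] by (auto simp: colon_mem_iff)
    show "p = Q" if "primeideal p R" "colon I a \<subseteq> p" "p \<subseteq> Q" for p
      using colon.prems(1)[OF that(1) _ that(3)] that(2) colon_superset[OF colon.hyps] by simp
  qed
  note ad = ideal_adjoin[OF colon.prems(2) colon.hyps(2)]
  obtain N1 where N1: "\<And>n. n \<ge> N1 \<Longrightarrow> colon (C n) a = colon (C N1) a"
    using stab by blast
  have "\<exists>N. \<forall>n\<ge>N. sat Q (adjoin (C n) a) = sat Q (adjoin (C N) a)"
  proof (rule colon.IH(2))
    show "ideal (sat Q (adjoin (C n) a)) R" for n
      by (rule ideal_sat[OF Q ad])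
    show "adjoin I a \<subseteq> sat Q (adjoin (C n) a)" for n
      using adjoin_mono[OF colon.prems(3)[of n], of a] sat_superset[OF Q ad] by (rule order_trans)
    show "sat Q (sat Q (adjoin (C n) a)) = sat Q (adjoin (C n) a)" for n
      by (rule sat_sat[OF Q ad])
    show "sat Q (adjoin (C (Suc n)) a) \<subseteq> sat Q (adjoin (C n) a)" for n
      by (intro sat_mono adjoin_mono colon.prems(5))
    show "p = Q" if "primeideal p R" "adjoin I a \<subseteq> p" "p \<subseteq> Q" for p
      using colon.prems(1)[OF that(1) _ that(3)] that(2) adjoin_superset[OF colon.hyps] by simp
  qed
  then obtain N2 where N2: "\<And>n. n \<ge> N2 \<Longrightarrow> sat Q (adjoin (C n) a) = sat Q (adjoin (C N2) a)" by blast
  define N where "N = max N1 N2"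
  \<comment> \<open>The chain is controlled by its traces on I : a and I + Ra. For c in C N, some sc
    equals d + ra with d in C n. Then ra lies in C N, so r lies in C N : a = C n : a, hence sc lies
    in C n, and saturation removes s.\<close>
  have "C N \<subseteq> C n" if n: "n \<ge> N" for n
  proof
    fix c assume c: "c \<in> C N"
    have "c \<in> sat Q (adjoin (C N) a)"
      using c sat_superset[OF Q ad] adjoin_superset[OF colon.prems(2) colon.hyps(2)] by blast
    also have "\<dots> = sat Q (adjoin (C n) a)" using N2[of n] N2[of N] n by (simp add: N_def)
    finally obtain s where s: "c \<in> carrier R" "s \<in> carrier R" "s \<notin> Q" "s \<otimes> c \<in> adjoin (C n) a"
      by (rule satE)
    from s(4) obtain r where r: "r \<in> carrier R" "s \<otimes> c \<ominus> r \<otimes> a \<in> C n" by (rule adjoinE)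
    have "r \<otimes> a = s \<otimes> c \<ominus> (s \<otimes> c \<ominus> r \<otimes> a)"
      and e: "s \<otimes> c = (s \<otimes> c \<ominus> r \<otimes> a) \<oplus> r \<otimes> a" using s(1,2) r(1) colon.hyps by algebra+
    then have "r \<otimes> a \<in> C N"
      using ideal_minus_mem[OF colon.prems(2)] ideal_mult_mem[OF colon.prems(2) c s(2)] r(2) anti[OF n]
      by (metis subsetD)
    then have "r \<in> colon (C N) a" using r by (simp add: colon_mem_iff)
    also have "\<dots> = colon (C n) a" using N1[of n] N1[of N] n by (simp add: N_def)
    finally have "s \<otimes> c \<in> C n" using e r(2) ideal_add_mem[OF colon.prems(2)]
      by (metis colon_mem_iff)
    then show "c \<in> C n" using sat_cancel[OF colon.prems(4)] s by blast
  qed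
  then show ?case using anti by (intro exI[of _ N]) blast
qed

text \<open>The last hypothesis expresses \<open>M\<^sub>Q \<subseteq> A\<^sub>Q + QM\<^sub>Q\<close>.\<close>

lemma nakayama:
  assumes Q: "primeideal Q R" and A: "ideal A R" and M: "M \<subseteq> carrier R"
    and H: "\<And>N. \<lbrakk>ideal N R; sat Q N = N; A \<subseteq> N; \<And>q m. \<lbrakk>q \<in> Q; m \<in> M\<rbrakk> \<Longrightarrow> q \<otimes> m \<in> N\<rbrakk> \<Longrightarrow> M \<subseteq> N"
  shows "M \<subseteq> sat Q A"
proof (rule ccontr)
  assume nM: "\<not> M \<subseteq> sat Q A"
  \<comment> \<open>A saturated N that is maximal among those not containing M replaces the usual
    induction on generators of M. By the hypothesis some qm is missing from N; adding it forces M,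
    and hence m, into the saturation.\<close>
  define \<Phi> where "\<Phi> N \<longleftrightarrow> sat Q N = N \<and> \<not> M \<subseteq> N" for N
  have "\<Phi> (sat Q A)" using nM sat_sat[OF Q A] by (simp add: \<Phi>_def)
  then obtain N where N: "ideal N R" "sat Q A \<subseteq> N" "\<Phi> N"
    and max: "\<And>J. \<lbrakk>ideal J R; N \<subset> J\<rbrakk> \<Longrightarrow> \<not> \<Phi> J"
    using ideal_maximal_exists[OF ideal_sat[OF Q A], of \<Phi>] by blast
  have Qc: "Q \<subseteq> carrier R" using Q primeideal.axioms(1) ideal_subset_carrier by blast
  have sN: "sat Q N = N" using N(3) by (simp add: \<Phi>_def)
  have "A \<subseteq> N" using N(2) sat_superset[OF Q A] by blast
  then obtain q m where qm: "q \<in> Q" "m \<in> M" "q \<otimes> m \<notin> N"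
    using H[OF N(1) sN] N(3) by (auto simp: \<Phi>_def)
  have c: "q \<in> carrier R" "m \<in> carrier R" using qm Qc M by auto
  define N' where "N' = sat Q (adjoin N (q \<otimes> m))"
  have ad: "ideal (adjoin N (q \<otimes> m)) R" using N c ideal_adjoin by simp
  have N': "ideal N' R" "sat Q N' = N'" unfolding N'_def using ideal_sat[OF Q ad] sat_sat[OF Q ad] by auto
  have "adjoin N (q \<otimes> m) \<subseteq> N'" unfolding N'_def by (rule sat_superset[OF Q ad])
  then have "N \<subset> N'"
    using adjoin_superset[OF N(1), of "q \<otimes> m"] adjoin_self[OF N(1), of "q \<otimes> m"] c qm(3) by auto
  then have "m \<in> N'" using max[OF N'(1)] N'(2) qm(2) by (auto simp: \<Phi>_def)
  then obtain s where s: "s \<in> carrier R" "s \<notin> Q" "s \<otimes> m \<in> adjoin N (q \<otimes> m)"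
    unfolding N'_def by (auto elim: satE)
  from s(3) obtain r where r: "r \<in> carrier R" "s \<otimes> m \<ominus> r \<otimes> (q \<otimes> m) \<in> N" by (rule adjoinE)
  have "s \<otimes> m \<ominus> r \<otimes> (q \<otimes> m) = (s \<ominus> r \<otimes> q) \<otimes> m" using s(1) r(1) c by algebra
  then have mem: "(s \<ominus> r \<otimes> q) \<otimes> m \<in> N" using r by simp
  \<comment> \<open>This element is a unit of R_Q, since s is outside Q and q is inside.\<close>
  have "s \<ominus> r \<otimes> q \<notin> Q"
  proof
    assume "s \<ominus> r \<otimes> q \<in> Q"
    moreover have "s = (s \<ominus> r \<otimes> q) \<oplus> r \<otimes> q" using s(1) r(1) c by algebra
    ultimately show False
      using s(2) qm(1) r(1) ideal_add_mem ideal_mult_mem primeideal.axioms(1)[OF Q] by metis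
  qed
  then have "m \<in> N" using sat_cancel[OF sN c(2) _ _ mem] s r c by simp
  then show False using qm(3) c ideal_mult_mem[OF N(1)] by blast
qed

text \<open>In the domain R/P', a prime Q with another nonzero prime strictly below it is not
  minimal over y; this form lets a chain of primes be rerouted through y. If it failed, R_Q/(P' +
  Ry)_Q would be Artinian, so the symbolic powers of P/P' would become stationary modulo y. Nakayama
  at Q removes y, and Nakayama at P then puts one of these powers into P', so that P \<subseteq>
  P'.\<close>

lemma krull_principal_ideal_theorem:
  assumes P': "primeideal P' R" and P: "primeideal P R" and Q: "primeideal Q R"
    and "P' \<subset> P" "P \<subset> Q" and y: "y \<in> Q"
  shows "\<exists>p. primeideal p R \<and> P' \<subseteq> p \<and> y \<in> p \<and> p \<subset> Q"
proof (rule ccontr)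
  assume contra: "\<not> ?thesis"
  have P'i: "ideal P' R" and Pi: "ideal P R" and Qi: "ideal Q R"
    using P' P Q primeideal.axioms(1) by auto
  have yc: "y \<in> carrier R" using y Qi ideal_subset_carrier by blast
  have Pc: "P \<subseteq> carrier R" using Pi ideal_subset_carrier by blast
  have yP: "y \<notin> P" using contra P \<open>P' \<subset> P\<close> \<open>P \<subset> Q\<close> by blast
  text \<open>The symbolic powers of \<open>P/P'\<close>.\<close>
  define G where "G S = P' \<union> {q \<otimes> m |q m. q \<in> P \<and> m \<in> S}" for S
  define S where "S n = ((\<lambda>S. sat P (Idl (G S))) ^^ n) (carrier R)" for n
  have S0: "S 0 = carrier R" and SS: "S (Suc n) = sat P (Idl (G (S n)))" for n
    by (auto simp: S_def)
  have Gc: "G T \<subseteq> carrier R" if "T \<subseteq> carrier R" for T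
    using that Pc P'i ideal_subset_carrier unfolding G_def by auto
  have Si: "ideal (S n) R \<and> sat P (S n) = S n" for n
  proof (induction n)
    case 0
    then show ?case using oneideal sat_superset[OF P oneideal] by (auto simp: S0 sat_def)
  next
    case (Suc n)
    then have "ideal (Idl (G (S n))) R" using genideal_ideal Gc ideal_subset_carrier by blast
    then show ?case unfolding SS using ideal_sat[OF P] sat_sat[OF P] by blast
  qed
  have Sc: "S n \<subseteq> carrier R" for n using Si ideal_subset_carrier by blast
  have Idl: "ideal (Idl (G (S n))) R" for n using genideal_ideal Gc Sc by blast
  have SG: "G (S n) \<subseteq> S (Suc n)" for n
    unfolding SS using genideal_self[OF Gc[OF Sc]] sat_superset[OF P Idl] by blast
  have Sdec: "S (Suc n) \<subseteq> S n" for n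
  proof (induction n)
    case 0
    then show ?case using Sc by (simp add: S0)
  next
    case (Suc n)
    then have "G (S (Suc n)) \<subseteq> Idl (G (S n))"
      using genideal_self[OF Gc[OF Sc[of n]]] unfolding G_def by blast
    then have "Idl (G (S (Suc n))) \<subseteq> Idl (G (S n))" using Idl genideal_minimal by blast
    then show ?case unfolding SS[of "Suc n"] SS[of n] by (rule sat_mono)
  qed
  have P'S: "P' \<subseteq> S n" for n
    using SG[of "n - 1"] P'i ideal_subset_carrier S0 by (cases n) (auto simp: G_def)
  have adI: "ideal (adjoin (S n) y) R" for n using ideal_adjoin Si yc by blast
  have "\<exists>N. \<forall>n\<ge>N. sat Q (adjoin (S n) y) = sat Q (adjoin (S N) y)"
  proof (rule sat_descending_chain[OF ideal_adjoin[OF P'i yc] Q])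
    show "p = Q" if "primeideal p R" "adjoin P' y \<subseteq> p" "p \<subseteq> Q" for p
      using contra that adjoin_superset[OF P'i yc] adjoin_self[OF P'i yc] by blast
    show "ideal (sat Q (adjoin (S n) y)) R" "sat Q (sat Q (adjoin (S n) y)) = sat Q (adjoin (S n) y)" for n
      using ideal_sat[OF Q adI] sat_sat[OF Q adI] by auto
    show "adjoin P' y \<subseteq> sat Q (adjoin (S n) y)" for n
      using adjoin_mono[OF P'S] sat_superset[OF Q adI] by blast
    show "sat Q (adjoin (S (Suc n)) y) \<subseteq> sat Q (adjoin (S n) y)" for n
      by (intro sat_mono adjoin_mono Sdec)
  qed
  then obtain n where n: "sat Q (adjoin (S (Suc n)) y) = sat Q (adjoin (S n) y)"
    by (metis le_Suc_eq order_refl)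
  \<comment> \<open>Stationarity gives sz = d + yr with d in \<open>S (Suc n)\<close>. As
    \<open>S n\<close> is saturated at P and y is outside P, the coefficient r lies in
    \<open>S n\<close> again. Hence \<open>S n\<close> equals \<open>S (Suc n)\<close> plus y times
    \<open>S n\<close> locally at Q, and y \<in> Q makes Nakayama applicable.\<close>
  have "S n \<subseteq> sat Q (S (Suc n))"
  proof (rule nakayama[OF Q _ Sc])
    show "ideal (S (Suc n)) R" using Si by blast
    fix N assume N: "ideal N R" "sat Q N = N" "S (Suc n) \<subseteq> N" and QN: "\<And>q m. \<lbrakk>q \<in> Q; m \<in> S n\<rbrakk> \<Longrightarrow> q \<otimes> m \<in> N"
    show "S n \<subseteq> N"
    proof
      fix z assume z: "z \<in> S n"
      then have "z \<in> sat Q (adjoin (S (Suc n)) y)"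
        unfolding n using adjoin_superset[of "S n" y] Si yc sat_superset[OF Q adI] by blast
      then obtain s where s: "z \<in> carrier R" "s \<in> carrier R" "s \<notin> Q" "s \<otimes> z \<in> adjoin (S (Suc n)) y"
        by (rule satE)
      from s(4) obtain r where r: "r \<in> carrier R" "s \<otimes> z \<ominus> r \<otimes> y \<in> S (Suc n)" by (rule adjoinE)
      have "y \<otimes> r = s \<otimes> z \<ominus> (s \<otimes> z \<ominus> r \<otimes> y)"
        and e: "s \<otimes> z = (s \<otimes> z \<ominus> r \<otimes> y) \<oplus> y \<otimes> r" using s(1,2) r(1) yc by algebra+
      then have "y \<otimes> r \<in> S n"
        using ideal_minus_mem Si ideal_mult_mem z s(2) r(2) Sdec by (metis subsetD)
      then have "r \<in> S n" using sat_cancel Si yP yc r(1) by blast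
      then have "s \<otimes> z \<in> N" using QN[OF y] N(3) r(2) ideal_add_mem[OF N(1)] e by (metis subsetD)
      then show "z \<in> N" using sat_cancel[OF N(2)] s by blast
    qed
  qed
  then have SSn: "S n \<subseteq> S (Suc n)"
    using sat_mono_prime[of P Q "S (Suc n)"] \<open>P \<subset> Q\<close> Si by blast
  \<comment> \<open>Now \<open>S n\<close> = \<open>S (Suc n)\<close> is generated, locally at P, by
    P' and P times itself.\<close>
  have "S n \<subseteq> sat P P'"
  proof (rule nakayama[OF P P'i Sc])
    fix N assume N: "ideal N R" "sat P N = N" "P' \<subseteq> N" and PN: "\<And>q m. \<lbrakk>q \<in> P; m \<in> S n\<rbrakk> \<Longrightarrow> q \<otimes> m \<in> N"
    have "G (S n) \<subseteq> N" unfolding G_def using N(3) PN by blast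
    then have "Idl (G (S n)) \<subseteq> N" using N(1) genideal_minimal by blast
    then show "S n \<subseteq> N" using SSn sat_minimal[OF P N(1,2)] unfolding SS by blast
  qed
  then have SP': "S n \<subseteq> P'" using sat_prime[OF P P'] \<open>P' \<subset> P\<close> by blast
  \<comment> \<open>The n-th power of p lies in \<open>S n\<close>, hence in the prime P'.\<close>
  have "p \<in> P'" if p: "p \<in> P" for p
  proof -
    have pc: "p \<in> carrier R" using p Pc by blast
    have "p [^] k \<in> S k" for k :: nat
    proof (induction k)
      case (Suc k)
      then have "p \<otimes> p [^] k \<in> G (S k)" unfolding G_def using p by blast
      then show ?case using SG pc by (auto simp: nat_pow_Suc m_comm)
    qed (simp add: S0)
    then show ?thesis using mem_of_prime_power[OF P' pc] SP' by blast
  qed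
  then show False using \<open>P' \<subset> P\<close> by blast
qed

text \<open>Passing to the quotient by y lowers the dimension by at most one. The prime directly
  below Q is exchanged for one that contains y, without shortening the chain beneath it; the
  induction then continues below that prime. The bottom inclusion is the one that may be
  lost.\<close>

lemma height_ge_adjoin:
  assumes "ideal A R" "primeideal Q R" "height_ge A (Suc n) Q" "y \<in> Q"
  shows "height_ge (adjoin A y) n Q"
  using assms(2-)
proof (induction n arbitrary: Q)
  case 0
  then show ?case
    using height_ge_subset[OF 0(2)] adjoin_minimal[OF primeideal.axioms(1)[OF 0(1)]] by simp
next
  case (Suc n)
  then obtain P where P: "primeideal P R" "P \<subset> Q" "height_ge A (Suc n) P" by auto
  have "\<exists>p. primeideal p R \<and> p \<subset> Q \<and> height_ge A (Suc n) p \<and> y \<in> p"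
  proof (cases "y \<in> P")
    case False
    obtain P' where P': "primeideal P' R" "P' \<subset> P" "height_ge A n P'" using P(3) by auto
    obtain p where p: "primeideal p R" "P' \<subseteq> p" "y \<in> p" "p \<subset> Q"
      using krull_principal_ideal_theorem[OF P'(1) P(1) Suc.prems(1) P'(2) P(2) Suc.prems(3)] by blast
    then have "P' \<subset> p" using False P'(2) by blast
    then show ?thesis using p P' by auto
  qed (use P in blast)
  then show ?case using Suc.IH by auto
qed

text \<open>Krull's height theorem at Q, relative to A so that generators can be moved into A one by
  one. When none is left, Q lies in the saturation of A, so no prime over A lies strictly below
  Q.\<close>

lemma height_le_generators:
  assumes "primeideal Q R" "ideal A R" "set ys \<subseteq> Q" "Q \<subseteq> sat Q (foldl adjoin A ys)" "height_ge A n Q"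
  shows "n \<le> length ys"
  using assms(2-)
proof (induction ys arbitrary: A n)
  case Nil
  show ?case
  proof (cases n)
    case (Suc m)
    then obtain P where P: "primeideal P R" "P \<subset> Q" "A \<subseteq> P"
      using Nil.prems(4) height_ge_subset by (metis height_ge.simps(2))
    then show ?thesis using sat_subset_prime[OF assms(1) P(1), of A] Nil.prems(3) by auto
  qed simp
next
  case (Cons y ys)
  have yc: "y \<in> carrier R"
    using Cons.prems(2) ideal_subset_carrier[OF primeideal.axioms(1)[OF assms(1)]] by auto
  show ?case
  proof (cases n)
    case (Suc m)
    then have "height_ge (adjoin A y) m Q"
      using height_ge_adjoin[OF Cons.prems(1) assms(1)] Cons.prems by auto
    then show ?thesis using Cons.IH[OF ideal_adjoin[OF Cons.prems(1) yc]] Cons.prems Suc by auto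
  qed simp
qed

end

section \<open>Regular sequences in regular rings\<close>

context cring
begin

definition nonzerodivisor_at :: "'a set \<Rightarrow> 'a set \<Rightarrow> 'a \<Rightarrow> bool" where
  "nonzerodivisor_at Q A x \<longleftrightarrow> (\<forall>u\<in>carrier R. x \<otimes> u \<in> sat Q A \<longrightarrow> u \<in> sat Q A)"

text \<open>Regular sequences on \<open>R/A\<close> and, in the variant at \<open>Q\<close>, on \<open>R\<^sub>Q/A\<^sub>Q\<close>.\<close>

primrec reg_seq :: "'a set \<Rightarrow> 'a list \<Rightarrow> bool" where
  "reg_seq A [] \<longleftrightarrow> True"
| "reg_seq A (x # xs) \<longleftrightarrow> x \<in> carrier R \<and> (\<forall>u\<in>carrier R. x \<otimes> u \<in> A \<longrightarrow> u \<in> A) \<and> reg_seq (adjoin A x) xs"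

primrec reg_seq_at :: "'a set \<Rightarrow> 'a set \<Rightarrow> 'a list \<Rightarrow> bool" where
  "reg_seq_at Q A [] \<longleftrightarrow> True"
| "reg_seq_at Q A (x # xs) \<longleftrightarrow> x \<in> Q \<and> nonzerodivisor_at Q A x \<and> reg_seq_at Q (adjoin A x) xs"

text \<open>The residue field of R_Q embeds in R_Q/A_Q, with u as a socle element.\<close>

definition depth_zero_at :: "'a set \<Rightarrow> 'a set \<Rightarrow> bool" where
  "depth_zero_at Q A \<longleftrightarrow> (\<exists>u\<in>carrier R. u \<notin> sat Q A \<and> (\<forall>q\<in>Q. q \<otimes> u \<in> sat Q A))"

text \<open>\<open>R\<^sub>Q/A\<^sub>Q\<close> is regular of dimension \<open>n\<close>.\<close>

definition regular_at :: "'a set \<Rightarrow> nat \<Rightarrow> 'a set \<Rightarrow> bool" where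
  "regular_at A n Q \<longleftrightarrow> height_ge A n Q \<and>
    (\<exists>ys. length ys = n \<and> set ys \<subseteq> Q \<and> Q \<subseteq> sat Q (foldl adjoin A ys))"

lemma primeideal_subset_carrier: "primeideal P R \<Longrightarrow> P \<subseteq> carrier R"
  by (rule ideal_subset_carrier[OF primeideal.axioms(1)])

lemma adjoin_commute_subset:
  assumes A: "ideal A R" and x: "x \<in> carrier R" and y: "y \<in> carrier R"
  shows "adjoin (adjoin A x) y \<subseteq> adjoin (adjoin A y) x"
proof (rule adjoin_minimal)
  note Ay = ideal_adjoin[OF A y]
  show "ideal (adjoin (adjoin A y) x) R" by (rule ideal_adjoin[OF Ay x])
  show "adjoin A x \<subseteq> adjoin (adjoin A y) x" by (rule adjoin_mono[OF adjoin_superset[OF A y]])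
  show "y \<in> adjoin (adjoin A y) x" using adjoin_self[OF A y] adjoin_superset[OF Ay x] by (rule rev_subsetD)
qed

lemma adjoin_commute:
  "\<lbrakk>ideal A R; x \<in> carrier R; y \<in> carrier R\<rbrakk> \<Longrightarrow> adjoin (adjoin A x) y = adjoin (adjoin A y) x"
  by (intro equalityI adjoin_commute_subset)

lemma adjoin_foldl_adjoin:
  "\<lbrakk>ideal A R; z \<in> carrier R; set xs \<subseteq> carrier R\<rbrakk> \<Longrightarrow>
    adjoin (foldl adjoin A xs) z = foldl adjoin (adjoin A z) xs"
proof (induction xs arbitrary: A)
  case (Cons x xs)
  then show ?case using Cons.IH[of "adjoin A x"] by (simp add: ideal_adjoin adjoin_commute[of A x z])
qed simp

lemma reg_seq_append:
  "reg_seq A (xs @ ys) \<longleftrightarrow> reg_seq A xs \<and> reg_seq (foldl adjoin A xs) ys"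
  by (induction xs arbitrary: A) auto

lemma reg_seq_at_append:
  "reg_seq_at Q A (xs @ ys) \<longleftrightarrow> reg_seq_at Q A xs \<and> reg_seq_at Q (foldl adjoin A xs) ys"
  by (induction xs arbitrary: A) auto

lemma reg_seq_at_subset: "reg_seq_at Q A xs \<Longrightarrow> set xs \<subseteq> Q"
  by (induction xs arbitrary: A) auto

lemma reg_seq_at_nth:
  assumes "reg_seq_at Q A xs" "i < length xs"
  shows "reg_seq_at Q A (take i xs)" "nonzerodivisor_at Q (foldl adjoin A (take i xs)) (xs ! i)" "xs ! i \<in> Q"
proof -
  have "reg_seq_at Q A (take i xs @ xs ! i # drop (Suc i) xs)" using assms by (simp add: id_take_nth_drop[symmetric])
  then show "reg_seq_at Q A (take i xs)" "nonzerodivisor_at Q (foldl adjoin A (take i xs)) (xs ! i)" "xs ! i \<in> Q"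
    unfolding reg_seq_at_append by auto
qed

lemma reg_seq_imp_reg_seq_at:
  assumes Q: "primeideal Q R" and "ideal A R" "reg_seq A xs" "set xs \<subseteq> Q"
  shows "reg_seq_at Q A xs"
  using assms(2-)
proof (induction xs arbitrary: A)
  case (Cons x xs)
  have x: "x \<in> carrier R" and nzd: "\<And>u. \<lbrakk>u \<in> carrier R; x \<otimes> u \<in> A\<rbrakk> \<Longrightarrow> u \<in> A" using Cons.prems(2) by auto
  have "u \<in> sat Q A" if u: "u \<in> carrier R" "x \<otimes> u \<in> sat Q A" for u
  proof -
    obtain s where s: "s \<in> carrier R" "s \<notin> Q" "s \<otimes> (x \<otimes> u) \<in> A" using u(2) by (auto elim: satE)
    have "x \<otimes> (s \<otimes> u) = s \<otimes> (x \<otimes> u)" using x s(1) u(1) by algebra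
    then have "s \<otimes> u \<in> A" using nzd s u by simp
    then show ?thesis using satI u s by blast
  qed
  then show ?case using Cons ideal_adjoin[OF Cons.prems(1) x] by (simp add: nonzerodivisor_at_def)
qed simp

lemma nonzerodivisor_imp_not_depth_zero:
  "\<lbrakk>nonzerodivisor_at Q A x; x \<in> Q\<rbrakk> \<Longrightarrow> \<not> depth_zero_at Q A"
  unfolding depth_zero_at_def nonzerodivisor_at_def by auto

text \<open>The introduction rule matching \<open>mem_sat_adjoinE\<close>. Here the congruence is
  allowed modulo \<open>sat Q A\<close>, because cancelling a nonzerodivisor at Q yields only
  that.\<close>

lemma mem_sat_adjoin:
  assumes Q: "primeideal Q R" and A: "ideal A R" and c: "x \<in> carrier R" "v \<in> carrier R" "r \<in> carrier R"
    and s: "s \<in> carrier R" "s \<notin> Q" and m: "s \<otimes> v \<ominus> r \<otimes> x \<in> sat Q A"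
  shows "v \<in> sat Q (adjoin A x)"
proof -
  note Ax = ideal_adjoin[OF A c(1)]
  note Sx = ideal_sat[OF Q Ax]
  have "s \<otimes> v \<in> adjoin (sat Q A) x" using m c s by (intro adjoinI[of _ r]) auto
  also have "\<dots> \<subseteq> sat Q (adjoin A x)"
    using sat_mono[OF adjoin_superset[OF A c(1)]] adjoin_self[OF A c(1)] sat_superset[OF Q Ax]
    by (intro adjoin_minimal[OF Sx]) auto
  finally show ?thesis using sat_cancel[OF sat_sat[OF Q Ax] c(2) s] by simp
qed

lemma mem_sat_adjoinE:
  assumes "v \<in> sat Q (adjoin A x)"
  obtains s r where "s \<in> carrier R" "s \<notin> Q" "r \<in> carrier R" "s \<otimes> v \<ominus> r \<otimes> x \<in> A"
  using assms by (auto elim!: satE adjoinE)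

text \<open>One half of the permutability of regular sequences. Up to denominators, xu = vz modulo A
  puts zv into A + Rx, hence v = wx modulo A, and cancelling x gives u = wz.\<close>

lemma nonzerodivisor_at_adjoin:
  assumes Q: "primeideal Q R" and A: "ideal A R" and xz: "x \<in> carrier R" "z \<in> carrier R"
    and x: "nonzerodivisor_at Q A x" and z: "nonzerodivisor_at Q (adjoin A x) z"
  shows "nonzerodivisor_at Q (adjoin A z) x"
  unfolding nonzerodivisor_at_def
proof (intro ballI impI)
  fix u assume u: "u \<in> carrier R" "x \<otimes> u \<in> sat Q (adjoin A z)"
  from u(2) obtain s v where s: "s \<in> carrier R" "s \<notin> Q" "v \<in> carrier R" "s \<otimes> (x \<otimes> u) \<ominus> v \<otimes> z \<in> A"
    by (rule mem_sat_adjoinE)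
  define d where "d = s \<otimes> (x \<otimes> u) \<ominus> v \<otimes> z"
  have d: "d \<in> A" "d \<in> carrier R" using s xz u by (auto simp: d_def)
  have "z \<otimes> v = s \<otimes> u \<otimes> x \<ominus> d" unfolding d_def using s(1,3) xz u(1) by algebra
  moreover have "\<dots> \<in> adjoin A x"
    using ideal_minus_mem[OF ideal_adjoin[OF A xz(1)]] ideal_mult_mem[OF ideal_adjoin[OF A xz(1)]]
      adjoin_self[OF A xz(1)] adjoin_superset[OF A xz(1)] d(1) s(1) u(1) by (meson m_closed subsetD)
  ultimately have "z \<otimes> v \<in> sat Q (adjoin A x)"
    using sat_superset[OF Q ideal_adjoin[OF A xz(1)]] by auto
  then have "v \<in> sat Q (adjoin A x)" using z s(3) by (simp add: nonzerodivisor_at_def)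
  then obtain t w where t: "t \<in> carrier R" "t \<notin> Q" "w \<in> carrier R" "t \<otimes> v \<ominus> w \<otimes> x \<in> A"
    by (rule mem_sat_adjoinE)
  have "x \<otimes> ((t \<otimes> s) \<otimes> u \<ominus> w \<otimes> z)
      = t \<otimes> (s \<otimes> (x \<otimes> u) \<ominus> v \<otimes> z) \<oplus> z \<otimes> (t \<otimes> v \<ominus> w \<otimes> x)"
    using s(1,3) t(1,3) xz u(1) by algebra
  moreover have "\<dots> \<in> A"
    using ideal_add_mem[OF A] ideal_mult_mem[OF A] s t xz by blast
  ultimately have "x \<otimes> ((t \<otimes> s) \<otimes> u \<ominus> w \<otimes> z) \<in> sat Q A" using sat_superset[OF Q A] by auto
  then have "(t \<otimes> s) \<otimes> u \<ominus> w \<otimes> z \<in> sat Q A"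
    using x s(1) t(1,3) u(1) xz by (simp add: nonzerodivisor_at_def)
  then show "u \<in> sat Q (adjoin A z)"
    using mem_sat_adjoin[OF Q A xz(2) u(1) t(3), of "t \<otimes> s"] prime_mult_notin[OF Q t(1,2) s(1,2)] s t
    by simp
qed

text \<open>z is moved from behind the sequence to its front, past one entry at a time by
  \<open>nonzerodivisor_at_adjoin\<close>.\<close>

lemma reg_seq_at_adjoin:
  assumes Q: "primeideal Q R" and z: "z \<in> carrier R"
  shows "\<lbrakk>ideal A R; reg_seq_at Q A xs; \<And>i. i \<le> length xs \<Longrightarrow> nonzerodivisor_at Q (foldl adjoin A (take i xs)) z\<rbrakk>
    \<Longrightarrow> reg_seq_at Q (adjoin A z) xs"
proof (induction xs arbitrary: A)
  case (Cons x xs)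
  have x: "x \<in> Q" "x \<in> carrier R" using Cons.prems(2) primeideal_subset_carrier[OF Q] by auto
  have "nonzerodivisor_at Q (adjoin A x) z" using Cons.prems(3)[of 1] by simp
  then have "nonzerodivisor_at Q (adjoin A z) x"
    using nonzerodivisor_at_adjoin[OF Q Cons.prems(1) x(2) z] Cons.prems(2) by simp
  moreover have "reg_seq_at Q (adjoin (adjoin A x) z) xs"
    using Cons.IH[OF ideal_adjoin[OF Cons.prems(1) x(2)]] Cons.prems(2) Cons.prems(3)[of "Suc i" for i]
    by simp
  ultimately show ?case using x adjoin_commute[OF Cons.prems(1) x(2) z] by simp
qed simp

text \<open>Division by x turns a socle element u modulo A + Rx into one modulo A + Rz: zu = vx
  defines v. If v were wz, then z(u - wx) would vanish and u would be zero. If qu = wx, then x(qv) =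
  qzu = xwz, so qv = wz. Conceptually, both socles are Ext^1 of the residue field with values in
  R_Q/A_Q.\<close>

lemma depth_zero_at_swap:
  assumes Q: "primeideal Q R" and A: "ideal A R" and xz: "x \<in> Q" "z \<in> Q"
    and x: "nonzerodivisor_at Q A x" and z: "nonzerodivisor_at Q A z"
    and depth: "depth_zero_at Q (adjoin A x)"
  shows "depth_zero_at Q (adjoin A z)"
proof -
  have c: "x \<in> carrier R" "z \<in> carrier R" using xz primeideal_subset_carrier[OF Q] by auto
  note AS = subsetD[OF sat_superset[OF Q A]]
  obtain u where u: "u \<in> carrier R" "u \<notin> sat Q (adjoin A x)"
    and Qu: "\<And>q. q \<in> Q \<Longrightarrow> q \<otimes> u \<in> sat Q (adjoin A x)"
    using depth by (auto simp: depth_zero_at_def)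
  obtain s v where s: "s \<in> carrier R" "s \<notin> Q" "v \<in> carrier R" "s \<otimes> (z \<otimes> u) \<ominus> v \<otimes> x \<in> A"
    using Qu[OF xz(2)] by (rule mem_sat_adjoinE)
  have "v \<notin> sat Q (adjoin A z)"
  proof
    assume "v \<in> sat Q (adjoin A z)"
    then obtain t w where t: "t \<in> carrier R" "t \<notin> Q" "w \<in> carrier R" "t \<otimes> v \<ominus> w \<otimes> z \<in> A"
      by (rule mem_sat_adjoinE)
    have "z \<otimes> ((t \<otimes> s) \<otimes> u \<ominus> w \<otimes> x)
        = t \<otimes> (s \<otimes> (z \<otimes> u) \<ominus> v \<otimes> x) \<oplus> x \<otimes> (t \<otimes> v \<ominus> w \<otimes> z)"
      using s(1,3) t(1,3) c u(1) by algebra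
    moreover have "\<dots> \<in> A" using ideal_add_mem[OF A] ideal_mult_mem[OF A] s t c by blast
    ultimately have "z \<otimes> ((t \<otimes> s) \<otimes> u \<ominus> w \<otimes> x) \<in> sat Q A" using AS by auto
    then have "(t \<otimes> s) \<otimes> u \<ominus> w \<otimes> x \<in> sat Q A"
      using z s(1) t(1,3) u(1) c by (simp add: nonzerodivisor_at_def)
    then show False
      using mem_sat_adjoin[OF Q A c(1) u(1) t(3), of "t \<otimes> s"] prime_mult_notin[OF Q t(1,2) s(1,2)] s t u(2)
      by simp
  qed
  moreover have "q \<otimes> v \<in> sat Q (adjoin A z)" if q: "q \<in> Q" for q
  proof -
    have qc: "q \<in> carrier R" using q primeideal_subset_carrier[OF Q] by blast
    obtain t w where t: "t \<in> carrier R" "t \<notin> Q" "w \<in> carrier R" "t \<otimes> (q \<otimes> u) \<ominus> w \<otimes> x \<in> A"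
      using Qu[OF q] by (rule mem_sat_adjoinE)
    have "x \<otimes> (t \<otimes> (q \<otimes> v) \<ominus> (s \<otimes> w) \<otimes> z)
        = (s \<otimes> z) \<otimes> (t \<otimes> (q \<otimes> u) \<ominus> w \<otimes> x) \<ominus> (t \<otimes> q) \<otimes> (s \<otimes> (z \<otimes> u) \<ominus> v \<otimes> x)"
      using s(1,3) t(1,3) c u(1) qc by algebra
    moreover have "\<dots> \<in> A"
      using ideal_minus_mem[OF A] ideal_mult_mem[OF A] s t c qc by (meson m_closed)
    ultimately have "x \<otimes> (t \<otimes> (q \<otimes> v) \<ominus> (s \<otimes> w) \<otimes> z) \<in> sat Q A" using AS by auto
    then have "t \<otimes> (q \<otimes> v) \<ominus> (s \<otimes> w) \<otimes> z \<in> sat Q A"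
      using x s(1,3) t(1,3) qc c by (simp add: nonzerodivisor_at_def)
    then show ?thesis
      using mem_sat_adjoin[OF Q A c(2) _ _ t(1,2), of "q \<otimes> v" "s \<otimes> w"] s(1,3) t(3) qc by blast
  qed
  ultimately show ?thesis using s(3) by (auto simp: depth_zero_at_def)
qed

end

section \<open>Depth, regular local rings and the choice of the regular sequence\<close>

context noetherian_cring
begin

text \<open>An associated prime A' : u of A' = \<open>sat Q A\<close> that contained Q would make u
  a socle element. So Q lies in none of the finitely many associated primes in question, and prime
  avoidance in the coset 0 + Q serves all the ideals at once.\<close>

lemma nonzerodivisor_at_exists:
  assumes Q: "primeideal Q R" and "finite I" and I: "\<And>A. A \<in> I \<Longrightarrow> ideal A R \<and> \<not> depth_zero_at Q A"
  shows "\<exists>z\<in>Q. \<forall>A\<in>I. nonzerodivisor_at Q A z"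
proof -
  define F where "F = (\<Union>A\<in>I. ass (sat Q A))"
  have S: "ideal (sat Q A) R" if "A \<in> I" for A using ideal_sat[OF Q] I[OF that] by simp
  have "finite F" using S finite_ass \<open>finite I\<close> by (auto simp: F_def)
  moreover have "primeideal p R \<and> \<not> Q \<subseteq> p" if "p \<in> F" for p
  proof -
    obtain A where A: "A \<in> I" "p \<in> ass (sat Q A)" using \<open>p \<in> F\<close> by (auto simp: F_def)
    then obtain u where u: "primeideal p R" "u \<in> carrier R" "p = colon (sat Q A) u" by (auto simp: ass_def)
    then have "u \<notin> sat Q A" using colon_eq_carrier[OF S[OF A(1)]] primeideal_neq_carrier by blast
    then have "\<not> Q \<subseteq> p"
      using I[OF A(1)] u(2,3) unfolding depth_zero_at_def by (metis colon_mem_iff subsetD)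
    then show ?thesis using u(1) by simp
  qed
  ultimately obtain k where k: "k \<in> Q" "\<And>p. p \<in> F \<Longrightarrow> \<zero> \<oplus> k \<notin> p"
    using coset_prime_avoidance[OF _ _ primeideal.axioms(1)[OF Q] zero_closed] by metis
  have kc: "k \<in> carrier R" using k(1) primeideal_subset_carrier[OF Q] by blast
  have "nonzerodivisor_at Q A k" if A: "A \<in> I" for A
    unfolding nonzerodivisor_at_def
  proof (intro ballI impI, rule ccontr)
    fix u assume "u \<in> carrier R" "k \<otimes> u \<in> sat Q A" "u \<notin> sat Q A"
    then obtain p where "p \<in> ass (sat Q A)" "k \<in> p" using zero_divisor_in_ass[OF S[OF A] kc] by blast
    then show False using k(2)[of p] kc A by (auto simp: F_def)
  qed
  then show ?thesis using k(1) by blast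
qed

text \<open>
  All maximal regular sequences in \<open>Q\<close> on \<open>R\<^sub>Q/A\<^sub>Q\<close> have the same length: a common nonzerodivisor \<open>z\<close>
  replaces the last element of each of two sequences and can then be moved to the front.
\<close>

lemma depth_zero_at_exchange:
  assumes Q: "primeideal Q R"
  shows "\<lbrakk>ideal A R; reg_seq_at Q A xs; reg_seq_at Q A ys; length xs = n; length ys = n;
    depth_zero_at Q (foldl adjoin A xs)\<rbrakk> \<Longrightarrow> depth_zero_at Q (foldl adjoin A ys)"
proof (induction n arbitrary: A xs ys)
  case (Suc n)
  obtain xs' x where xs: "xs = xs' @ [x]" "length xs' = n" using Suc.prems(4) by (metis length_Suc_conv_rev)
  obtain ys' y where ys: "ys = ys' @ [y]" "length ys' = n" using Suc.prems(5) by (metis length_Suc_conv_rev)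
  have Qc: "Q \<subseteq> carrier R" using primeideal_subset_carrier[OF Q] .
  have sub: "set xs \<subseteq> carrier R" "set ys \<subseteq> carrier R"
    using reg_seq_at_subset[OF Suc.prems(2)] reg_seq_at_subset[OF Suc.prems(3)] Qc by auto
  have nd: "ideal (foldl adjoin A (take i l)) R \<and> \<not> depth_zero_at Q (foldl adjoin A (take i l))"
    if "reg_seq_at Q A l" "i < length l" "set l \<subseteq> carrier R" for l i
    using reg_seq_at_nth[OF that(1,2)] nonzerodivisor_imp_not_depth_zero
      ideal_foldl_adjoin[OF Suc.prems(1), of "take i l"] set_take_subset[of i l] that(3) by blast
  \<comment> \<open>The sequences have length n + 1, so these are exactly their proper initial
    segments. Each is followed by a further regular element, hence has positive depth.\<close>
  define I where "I = (\<lambda>i. foldl adjoin A (take i xs)) ` {..n} \<union> (\<lambda>i. foldl adjoin A (take i ys)) ` {..n}"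
  have "\<exists>z\<in>Q. \<forall>A\<in>I. nonzerodivisor_at Q A z"
  proof (rule nonzerodivisor_at_exists[OF Q])
    show "finite I" by (simp add: I_def)
    show "ideal B R \<and> \<not> depth_zero_at Q B" if "B \<in> I" for B
      using that nd[OF Suc.prems(2) _ sub(1)] nd[OF Suc.prems(3) _ sub(2)] Suc.prems(4,5)
      by (auto simp: I_def)
  qed
  then obtain z where z: "z \<in> Q" "\<And>B. B \<in> I \<Longrightarrow> nonzerodivisor_at Q B z" by blast
  have zc: "z \<in> carrier R" using z(1) Qc by blast
  have zx: "nonzerodivisor_at Q (foldl adjoin A (take i xs')) z" if "i \<le> n" for i
    using z(2)[of "foldl adjoin A (take i xs)"] that xs by (auto simp: I_def)
  have zy: "nonzerodivisor_at Q (foldl adjoin A (take i ys')) z" if "i \<le> n" for i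
    using z(2)[of "foldl adjoin A (take i ys)"] that ys by (auto simp: I_def)
  have rx: "reg_seq_at Q A xs'" "nonzerodivisor_at Q (foldl adjoin A xs') x" "x \<in> Q"
    and ry: "reg_seq_at Q A ys'" "nonzerodivisor_at Q (foldl adjoin A ys') y" "y \<in> Q"
    using Suc.prems(2,3) unfolding xs(1) ys(1) reg_seq_at_append by auto
  have sub': "set xs' \<subseteq> carrier R" "set ys' \<subseteq> carrier R" using sub xs ys by auto
  have "depth_zero_at Q (adjoin (foldl adjoin A xs') z)"
    using depth_zero_at_swap[OF Q ideal_foldl_adjoin[OF Suc.prems(1) sub'(1)] rx(3) z(1) rx(2)]
      zx[of n] Suc.prems(6) xs by simp
  then have dx: "depth_zero_at Q (foldl adjoin (adjoin A z) xs')"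
    by (simp add: adjoin_foldl_adjoin[OF Suc.prems(1) zc sub'(1)])
  have "depth_zero_at Q (foldl adjoin (adjoin A z) ys')"
  proof (rule Suc.IH[OF ideal_adjoin[OF Suc.prems(1) zc] _ _ xs(2) ys(2) dx])
    show "reg_seq_at Q (adjoin A z) xs'"
      using reg_seq_at_adjoin[OF Q zc Suc.prems(1) rx(1)] zx xs(2) by blast
    show "reg_seq_at Q (adjoin A z) ys'"
      using reg_seq_at_adjoin[OF Q zc Suc.prems(1) ry(1)] zy ys(2) by blast
  qed
  then have "depth_zero_at Q (adjoin (foldl adjoin A ys') z)"
    by (simp add: adjoin_foldl_adjoin[OF Suc.prems(1) zc sub'(2)])
  then show ?case
    using depth_zero_at_swap[OF Q ideal_foldl_adjoin[OF Suc.prems(1) sub'(2)] z(1) ry(3) _ ry(2)]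
      zy[of n] ys by simp
qed simp

text \<open>The first of the local generators of Q is changed by some k \<in> Q^2, which is
  \<open>Idl D\<close>. A prime containing Q^2 contains Q, so k can be chosen to make x avoid F.
  Modulo Q^2 nothing changes, so by Nakayama x and the remaining ys still generate Q locally, while
  the height drops by at most one.\<close>

lemma regular_at_adjoin:
  assumes Q: "primeideal Q R" and A: "ideal A R" and reg: "regular_at A (Suc n) Q"
    and "finite F" and F: "\<And>q. q \<in> F \<Longrightarrow> primeideal q R \<and> \<not> Q \<subseteq> q"
  shows "\<exists>x\<in>Q. (\<forall>q\<in>F. x \<notin> q) \<and> regular_at (adjoin A x) n Q"
proof -
  have Qi: "ideal Q R" and Qc: "Q \<subseteq> carrier R"
    using Q primeideal.axioms(1) primeideal_subset_carrier by auto
  obtain y ys where ys: "length ys = n" "y \<in> Q" "set ys \<subseteq> Q" "Q \<subseteq> sat Q (foldl adjoin A (y # ys))"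
    using reg unfolding regular_at_def length_Suc_conv by force
  define D where "D = {a \<otimes> b |a b. a \<in> Q \<and> b \<in> Q}"
  have DQ: "D \<subseteq> Q" using Qc ideal_mult_mem[OF Qi] by (auto simp: D_def)
  then have K: "ideal (Idl D) R" and DK: "D \<subseteq> Idl D" and KQ: "Idl D \<subseteq> Q"
    using genideal_ideal genideal_self genideal_minimal[OF Qi] Qc by auto
  have "\<not> Idl D \<subseteq> q" if "q \<in> F" for q
  proof
    assume Kq: "Idl D \<subseteq> q"
    obtain a where a: "a \<in> Q" "a \<notin> q" using F[OF \<open>q \<in> F\<close>] by blast
    then have "a \<otimes> a \<in> q" using DK Kq by (auto simp: D_def)
    then show False using primeideal_mem_cases[of q R a a] F[OF \<open>q \<in> F\<close>] a Qc by auto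
  qed
  then obtain k where k: "k \<in> Idl D" "\<And>q. q \<in> F \<Longrightarrow> y \<oplus> k \<notin> q"
    using coset_prime_avoidance[OF \<open>finite F\<close> _ K, of y] F ys(2) Qc by blast
  define x where "x = y \<oplus> k"
  have x: "x \<in> Q" using ideal_add_mem[OF Qi ys(2)] k(1) KQ by (auto simp: x_def)
  have c: "x \<in> carrier R" "y \<in> carrier R" "set ys \<subseteq> carrier R" using x ys Qc by auto
  define B where "B = foldl adjoin (adjoin A x) ys"
  note Ax = ideal_adjoin[OF A c(1)]
  have B: "ideal B R" "adjoin A x \<union> set ys \<subseteq> B"
    unfolding B_def using ideal_foldl_adjoin[OF Ax c(3)] foldl_adjoin_superset[OF Ax c(3)] by auto
  have "Q \<subseteq> sat Q B"
  proof (rule nakayama[OF Q B(1) Qc])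
    fix N assume N: "ideal N R" "sat Q N = N" "B \<subseteq> N" and QQ: "\<And>q m. \<lbrakk>q \<in> Q; m \<in> Q\<rbrakk> \<Longrightarrow> q \<otimes> m \<in> N"
    have "D \<subseteq> N" using QQ by (auto simp: D_def)
    then have kN: "k \<in> N" using genideal_minimal[OF N(1)] k(1) by blast
    have "A \<union> {x} \<union> set ys \<subseteq> N"
      using N(3) B(2) adjoin_superset[OF A c(1)] adjoin_self[OF A c(1)] by blast
    then have "A \<subseteq> N" "set (y # ys) \<subseteq> N"
      using ideal_add_cancel[OF N(1) c(2) kN] by (auto simp: x_def)
    then have "foldl adjoin A (y # ys) \<subseteq> N" by (rule foldl_adjoin_minimal[OF N(1)])
    then show "Q \<subseteq> N" using sat_minimal[OF Q N(1,2)] ys(4) by blast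
  qed
  moreover have "height_ge (adjoin A x) n Q"
    using height_ge_adjoin[OF A Q _ x] reg by (simp add: regular_at_def)
  ultimately have "regular_at (adjoin A x) n Q" unfolding regular_at_def B_def using ys by blast
  then show ?thesis using x k(2) by (auto simp: x_def)
qed

text \<open>A regular local ring is a domain, and its dimension is the length of a regular sequence.
  By induction A + Rx is prime locally, for x outside the relevant minimal primes over A. A minimal
  prime p0 below it turns out to be the saturation of A, which is therefore prime and does not
  contain x.\<close>

lemma regular_at_imp_prime_reg_seq:
  assumes Q: "primeideal Q R"
  shows "\<lbrakk>ideal A R; regular_at A n Q\<rbrakk> \<Longrightarrow> primeideal (sat Q A) R \<and> (\<exists>xs. length xs = n \<and> reg_seq_at Q A xs)"
proof (induction n arbitrary: A)
  case 0
  then have "A \<subseteq> Q" "Q \<subseteq> sat Q A" by (auto simp: regular_at_def)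
  then have "sat Q A = Q" using sat_subset_prime[OF Q Q] by auto
  then show ?case using Q by simp
next
  case (Suc n)
  obtain F where F: "finite F" "\<And>p. p \<in> F \<Longrightarrow> primeideal p R \<and> A \<subseteq> p"
    "\<And>p. \<lbrakk>primeideal p R; A \<subseteq> p\<rbrakk> \<Longrightarrow> \<exists>q\<in>F. q \<subseteq> p"
    using finite_primes_below[OF Suc.prems(1)] by metis
  have "\<exists>x\<in>Q. (\<forall>q\<in>{q \<in> F. \<not> Q \<subseteq> q}. x \<notin> q) \<and> regular_at (adjoin A x) n Q"
    by (rule regular_at_adjoin[OF Q Suc.prems]) (use F(1,2) in simp_all)
  then obtain x where x: "x \<in> Q" "\<And>q. \<lbrakk>q \<in> F; \<not> Q \<subseteq> q\<rbrakk> \<Longrightarrow> x \<notin> q" "regular_at (adjoin A x) n Q"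
    by blast
  have xc: "x \<in> carrier R" using x(1) primeideal_subset_carrier[OF Q] by blast
  note Ax = ideal_adjoin[OF Suc.prems(1) xc]
  define p where "p = sat Q (adjoin A x)"
  obtain xs where p: "primeideal p R" and xs: "length xs = n" "reg_seq_at Q (adjoin A x) xs"
    using Suc.IH[OF Ax x(3)] by (auto simp: p_def)
  obtain P where P: "primeideal P R" "P \<subset> Q" "A \<subseteq> P"
    using Suc.prems(2) height_ge_subset unfolding regular_at_def by (metis height_ge.simps(2))
  have AQ: "A \<subseteq> Q" using P by blast
  have pQ: "p \<subseteq> Q"
    unfolding p_def using adjoin_minimal[OF primeideal.axioms(1)[OF Q] AQ x(1)]
    by (rule sat_subset_prime[OF Q Q subset_refl])
  have Ap: "A \<subseteq> p" using adjoin_superset[OF Suc.prems(1) xc] sat_superset[OF Q Ax] by (auto simp: p_def)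
  \<comment> \<open>The element x avoids only those members of F that do not contain Q. If p = Q, a
    suitable p0 is found below the prime P strictly inside Q, which exists because the height is
    positive.\<close>
  obtain p0 where p0: "p0 \<in> F" "p0 \<subseteq> p" "\<not> Q \<subseteq> p0"
  proof (cases "p = Q")
    case True
    then show ?thesis using F(3)[OF P(1,3)] P(2) that by blast
  next
    case False
    then show ?thesis using F(3)[OF p Ap] pQ that by blast
  qed
  have p0p: "primeideal p0 R" "A \<subseteq> p0" using F(2)[OF p0(1)] by auto
  have xp0: "x \<notin> p0" using x(2) p0 by blast
  \<comment> \<open>An element of p0 is rx modulo A up to a denominator. Since x is outside p0, the
    coefficient r is in p0, so p0 is generated locally by A and x p0 with x \<in> Q.\<close>
  have "p0 \<subseteq> sat Q A"
  proof (rule nakayama[OF Q Suc.prems(1) primeideal_subset_carrier[OF p0p(1)]])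
    fix N assume N: "ideal N R" "sat Q N = N" "A \<subseteq> N" and QN: "\<And>q m. \<lbrakk>q \<in> Q; m \<in> p0\<rbrakk> \<Longrightarrow> q \<otimes> m \<in> N"
    show "p0 \<subseteq> N"
    proof
      fix z assume z: "z \<in> p0"
      then have zc: "z \<in> carrier R" using primeideal_subset_carrier[OF p0p(1)] by blast
      have "z \<in> sat Q (adjoin A x)" using z p0(2) by (auto simp: p_def)
      then obtain s r where s: "s \<in> carrier R" "s \<notin> Q" "r \<in> carrier R" "s \<otimes> z \<ominus> r \<otimes> x \<in> A"
        by (rule mem_sat_adjoinE)
      have eq: "x \<otimes> r = s \<otimes> z \<ominus> (s \<otimes> z \<ominus> r \<otimes> x)" "s \<otimes> z = (s \<otimes> z \<ominus> r \<otimes> x) \<oplus> x \<otimes> r"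
        using s(1,3) zc xc by algebra+
      have p0i: "ideal p0 R" using p0p(1) primeideal.axioms(1) by blast
      have "x \<otimes> r \<in> p0"
        unfolding eq(1) using ideal_minus_mem[OF p0i ideal_mult_mem[OF p0i z s(1)]] s(4) p0p(2) by blast
      then have "r \<in> p0" using primeideal_mem_cases[OF p0p(1) xc s(3)] xp0 by blast
      then have "x \<otimes> r \<in> N" using QN x(1) by blast
      then have "s \<otimes> z \<in> N" using eq(2) ideal_add_mem[OF N(1)] s(4) N(3) by (metis subsetD)
      then show "z \<in> N" using sat_cancel[OF N(2) zc s(1,2)] by blast
    qed
  qed
  moreover have "sat Q A \<subseteq> p0" using sat_subset_prime[OF Q p0p(1) _ p0p(2)] p0(2) pQ by blast
  ultimately have eq: "sat Q A = p0" by blast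
  have "nonzerodivisor_at Q A x"
    unfolding nonzerodivisor_at_def eq using primeideal_mem_cases[OF p0p(1) xc] xp0 by blast
  then have "reg_seq_at Q A (x # xs)" using x(1) xs(2) by simp
  then show ?case using eq p0p(1) xs(1) by (metis length_Cons)
qed

text \<open>The induction couples a global and a local condition: xs is regular on R, and the
  quotient at P remains regular, with its dimension reduced by the length of xs.
  \<open>regular_at_adjoin\<close> maintains the local one while x avoids finitely many primes not
  containing P; avoiding all of \<open>ass A\<close> gives the global one.\<close>

lemma reg_seq_generating_prime_locally:
  assumes reg: "\<And>Q. primeideal Q R \<Longrightarrow> \<exists>n. regular_at {\<zero>} n Q" and P: "primeideal P R"
  shows "\<exists>xs. set xs \<subseteq> P \<and> reg_seq {\<zero>} xs \<and> P \<subseteq> sat P (foldl adjoin {\<zero>} xs)"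
proof -
  have Pc: "P \<subseteq> carrier R" using primeideal_subset_carrier[OF P] .
  obtain g where g: "regular_at {\<zero>} g P" using reg[OF P] by blast
  have "k \<le> g \<Longrightarrow> \<exists>xs. length xs = k \<and> set xs \<subseteq> P \<and> reg_seq {\<zero>} xs \<and>
    regular_at (foldl adjoin {\<zero>} xs) (g - k) P" for k
  proof (induction k)
    case 0
    show ?case using g by simp
  next
    case (Suc k)
    then obtain xs where xs: "length xs = k" "set xs \<subseteq> P" "reg_seq {\<zero>} xs"
      "regular_at (foldl adjoin {\<zero>} xs) (Suc (g - Suc k)) P" by (auto simp: Suc_diff_Suc)
    define A where "A = foldl adjoin {\<zero>} xs"
    have A: "ideal A R" unfolding A_def using ideal_foldl_adjoin[OF zeroideal] xs(2) Pc by blast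
    have F: "primeideal p R \<and> \<not> P \<subseteq> p" if "p \<in> ass A" for p
    proof -
      obtain u where u: "primeideal p R" "u \<in> carrier R" "p = colon A u" using \<open>p \<in> ass A\<close> by (auto simp: ass_def)
      have "\<not> P \<subseteq> p"
      proof
        assume Pp: "P \<subseteq> p"
        obtain d where d: "regular_at {\<zero>} d p" using reg[OF u(1)] by blast
        obtain ys where ys: "length ys = d" "reg_seq_at p {\<zero>} ys"
          using regular_at_imp_prime_reg_seq[OF u(1) zeroideal d] by blast
        have "height_ge {\<zero>} g p" using g height_ge_mono[OF _ Pp] by (simp add: regular_at_def)
        then have "g \<le> d" using d height_le_generators[OF u(1) zeroideal] by (auto simp: regular_at_def)
        then have kd: "k < length ys" using Suc.prems ys(1) by simp
        \<comment> \<open>At p the class of u is a socle element, so xs is a maximal regular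
          sequence there. By the exchange property the first k entries of ys would also be maximal,
          although the longer ys continues with one more regular element.\<close>
        have "u \<notin> sat p A" using u(3) by (auto simp: colon_mem_iff elim!: satE)
        moreover have "q \<otimes> u \<in> sat p A" if "q \<in> p" for q
          using that u(3) sat_superset[OF u(1) A] by (auto simp: colon_mem_iff)
        ultimately have "depth_zero_at p A" using u(2) by (auto simp: depth_zero_at_def)
        then have "depth_zero_at p (foldl adjoin {\<zero>} (take k ys))"
          using depth_zero_at_exchange[OF u(1) zeroideal, of xs "take k ys" k]
            reg_seq_imp_reg_seq_at[OF u(1) zeroideal xs(3)] reg_seq_at_nth(1)[OF ys(2) kd] xs(1,2) Pp kd
          by (simp add: A_def)
        then show False
          using nonzerodivisor_imp_not_depth_zero reg_seq_at_nth(2,3)[OF ys(2) kd] by blast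
      qed
      then show ?thesis using u(1) by blast
    qed
    obtain x where x: "x \<in> P" "\<And>p. p \<in> ass A \<Longrightarrow> x \<notin> p" "regular_at (adjoin A x) (g - Suc k) P"
      using regular_at_adjoin[OF P A xs(4)[folded A_def] finite_ass[OF A] F] by blast
    have xc: "x \<in> carrier R" using x(1) Pc by blast
    have "u \<in> A" if "u \<in> carrier R" "x \<otimes> u \<in> A" for u
      using zero_divisor_in_ass[OF A xc that(1) _ that(2)] x(2) by blast
    then have "reg_seq {\<zero>} (xs @ [x])" using xs(3) xc by (simp add: reg_seq_append A_def)
    then show ?case using x xs by (intro exI[of _ "xs @ [x]"]) (simp add: A_def)
  qed
  from this[of g] obtain xs where xs: "set xs \<subseteq> P" "reg_seq {\<zero>} xs" "regular_at (foldl adjoin {\<zero>} xs) 0 P"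
    by auto
  from xs(3) have "P \<subseteq> sat P (foldl adjoin {\<zero>} xs)" by (simp add: regular_at_def)
  then show ?thesis using xs by blast
qed

text \<open>Choosing s outside P with A : s maximal replaces a product of denominators over
  generators of P. If tp \<in> A with t outside P, then A : ts contains A : s, so the two agree; the
  first contains p, hence so does the second.\<close>

lemma sat_uniform:
  assumes P: "primeideal P R" and A: "ideal A R" and "P \<subseteq> sat P A"
  obtains s where "s \<in> carrier R" "s \<notin> P" "\<And>p. p \<in> P \<Longrightarrow> s \<otimes> p \<in> A"
proof -
  define \<Phi> where "\<Phi> J \<longleftrightarrow> (\<exists>s\<in>carrier R - P. J = colon A s)" for J
  have "\<Phi> (colon A \<one>)" using primeideal_one_notin[OF P] by (auto simp: \<Phi>_def)
  then obtain N where "ideal N R" "colon A \<one> \<subseteq> N" and N: "\<Phi> N"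
    and max: "\<And>J. \<lbrakk>ideal J R; N \<subset> J\<rbrakk> \<Longrightarrow> \<not> \<Phi> J"
    using ideal_maximal_exists[OF ideal_colon[OF A one_closed], of \<Phi>] by blast
  obtain s where s: "s \<in> carrier R" "s \<notin> P" "N = colon A s" using N by (auto simp: \<Phi>_def)
  have "s \<otimes> p \<in> A" if "p \<in> P" for p
  proof -
    obtain t where t: "p \<in> carrier R" "t \<in> carrier R" "t \<notin> P" "t \<otimes> p \<in> A"
      using \<open>p \<in> P\<close> assms(3) by (auto elim: satE)
    have "\<Phi> (colon A (t \<otimes> s))" using prime_mult_notin[OF P t(2,3) s(1,2)] s(1) t(2) by (auto simp: \<Phi>_def)
    then have "colon A (t \<otimes> s) = N"
      using max[OF ideal_colon[OF A]] colon_mult_superset[OF A s(1) t(2)] s t(2) by blast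
    moreover have "p \<otimes> (t \<otimes> s) = s \<otimes> (t \<otimes> p)" using s(1) t(1,2) by algebra
    then have "p \<in> colon A (t \<otimes> s)" using ideal_mult_mem[OF A t(4) s(1)] t(1) by (simp add: colon_mem_iff)
    ultimately show ?thesis using s t(1) by (simp add: colon_mem_iff m_comm)
  qed
  then show ?thesis using that s by blast
qed

end

section \<open>Localization at a prime\<close>

context primeideal
begin

abbreviation loc :: "('a \<times> 'a) set ring" where
  "loc \<equiv> localization R (carrier R - I)"

definition frac :: "'a \<Rightarrow> 'a \<Rightarrow> ('a \<times> 'a) set" where
  "frac a s = frac_rel R (carrier R - I) `` {(a, s)}"

definition extension :: "'a set \<Rightarrow> ('a \<times> 'a) set set" where
  "extension T = {frac a s |a s. a \<in> T \<and> s \<in> carrier R - I}"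

definition contraction :: "('a \<times> 'a) set set \<Rightarrow> 'a set" where
  "contraction J = {a \<in> carrier R. frac a \<one> \<in> J}"

lemma prime: "primeideal I R"
  by (rule primeideal_axioms)

lemma frac_rel_iff:
  "((a, s), (b, t)) \<in> frac_rel R (carrier R - I) \<longleftrightarrow>
    a \<in> carrier R \<and> s \<in> carrier R - I \<and> b \<in> carrier R \<and> t \<in> carrier R - I \<and>
    (\<exists>u\<in>carrier R - I. u \<otimes> (a \<otimes> t \<ominus> b \<otimes> s) = \<zero>)"
  by (simp add: frac_rel_def)

lemma denom_mult: "\<lbrakk>s \<in> carrier R - I; t \<in> carrier R - I\<rbrakk> \<Longrightarrow> s \<otimes> t \<in> carrier R - I"
  using prime_mult_notin[OF prime] by auto

lemma one_denom: "\<one> \<in> carrier R - I"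
  using primeideal_one_notin[OF prime] by simp

lemma equiv_frac_rel: "equiv (carrier R \<times> (carrier R - I)) (frac_rel R (carrier R - I))"
proof (rule equivI)
  show "frac_rel R (carrier R - I) \<subseteq> (carrier R \<times> (carrier R - I)) \<times> carrier R \<times> (carrier R - I)"
    by (auto simp: frac_rel_def)
  show "refl_on (carrier R \<times> (carrier R - I)) (frac_rel R (carrier R - I))"
  proof (rule refl_onI)
    fix x assume "x \<in> carrier R \<times> (carrier R - I)"
    then obtain a s where x: "x = (a, s)" "a \<in> carrier R" "s \<in> carrier R - I" by auto
    then have "\<one> \<otimes> (a \<otimes> s \<ominus> a \<otimes> s) = \<zero>" by (simp add: a_minus_def r_neg)
    then show "(x, x) \<in> frac_rel R (carrier R - I)"
      using x one_denom unfolding x(1) frac_rel_iff by (intro conjI bexI[of _ \<one>]) simp_all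
  qed
  show "sym (frac_rel R (carrier R - I))"
  proof (rule symI, clarify)
    fix a s b t assume "((a, s), (b, t)) \<in> frac_rel R (carrier R - I)"
    then obtain u where u: "a \<in> carrier R" "s \<in> carrier R" "b \<in> carrier R" "t \<in> carrier R" "u \<in> carrier R"
      "s \<notin> I" "t \<notin> I" "u \<notin> I" "u \<otimes> (a \<otimes> t \<ominus> b \<otimes> s) = \<zero>" by (auto simp: frac_rel_iff)
    have "u \<otimes> (b \<otimes> s \<ominus> a \<otimes> t) = \<ominus> (u \<otimes> (a \<otimes> t \<ominus> b \<otimes> s))" using u(1-5) by algebra
    then show "((b, t), (a, s)) \<in> frac_rel R (carrier R - I)" using u by (auto simp: frac_rel_iff)
  qed
  show "trans (frac_rel R (carrier R - I))"
  proof (rule transI, clarify)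
    fix a s b t c w
    assume "((a, s), (b, t)) \<in> frac_rel R (carrier R - I)" "((b, t), (c, w)) \<in> frac_rel R (carrier R - I)"
    then obtain u v where u: "a \<in> carrier R" "s \<in> carrier R" "b \<in> carrier R" "t \<in> carrier R"
      "c \<in> carrier R" "w \<in> carrier R" "u \<in> carrier R" "v \<in> carrier R"
      "s \<notin> I" "t \<notin> I" "w \<notin> I" "u \<notin> I" "v \<notin> I"
      "u \<otimes> (a \<otimes> t \<ominus> b \<otimes> s) = \<zero>" "v \<otimes> (b \<otimes> w \<ominus> c \<otimes> t) = \<zero>" by (auto simp: frac_rel_iff)
    \<comment> \<open>The middle denominator t has to join the multiplier, as it may be a zero
      divisor and cannot be cancelled.\<close>
    have "(u \<otimes> v \<otimes> t) \<otimes> (a \<otimes> w \<ominus> c \<otimes> s)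
        = v \<otimes> w \<otimes> (u \<otimes> (a \<otimes> t \<ominus> b \<otimes> s)) \<oplus> u \<otimes> s \<otimes> (v \<otimes> (b \<otimes> w \<ominus> c \<otimes> t))"
      using u(1-8) by algebra
    also have "\<dots> = \<zero>" using u by simp
    finally have "(u \<otimes> v \<otimes> t) \<otimes> (a \<otimes> w \<ominus> c \<otimes> s) = \<zero>" .
    moreover have "u \<otimes> v \<otimes> t \<in> carrier R - I" using denom_mult u by auto
    ultimately show "((a, s), (c, w)) \<in> frac_rel R (carrier R - I)" using u by (auto simp: frac_rel_iff)
  qed
qed

lemma frac_eq_iff:
  assumes "a \<in> carrier R" "s \<in> carrier R - I" "b \<in> carrier R" "t \<in> carrier R - I"
  shows "frac a s = frac b t \<longleftrightarrow> (\<exists>u\<in>carrier R - I. u \<otimes> (a \<otimes> t \<ominus> b \<otimes> s) = \<zero>)"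
  using eq_equiv_class_iff[OF equiv_frac_rel, of "(a, s)" "(b, t)"] assms
  by (simp add: frac_def frac_rel_iff)

lemma carrier_loc: "carrier loc = {frac a s |a s. a \<in> carrier R \<and> s \<in> carrier R - I}"
  by (auto simp: localization_def quotient_def frac_def)

lemma frac_closed: "\<lbrakk>a \<in> carrier R; s \<in> carrier R - I\<rbrakk> \<Longrightarrow> frac a s \<in> carrier loc"
  by (auto simp: carrier_loc)

lemma one_loc: "\<one>\<^bsub>loc\<^esub> = frac \<one> \<one>" and zero_loc: "\<zero>\<^bsub>loc\<^esub> = frac \<zero> \<one>"
  by (simp_all add: localization_def frac_def)

text \<open>The product in \<open>localization\<close> is a union over all pairs of representatives;
  compatibility with the equivalence collapses it to a single class. \<open>add_loc\<close> follows
  the same pattern.\<close>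

lemma mult_loc:
  assumes "a \<in> carrier R" "s \<in> carrier R - I" "b \<in> carrier R" "t \<in> carrier R - I"
  shows "frac a s \<otimes>\<^bsub>loc\<^esub> frac b t = frac (a \<otimes> b) (s \<otimes> t)"
proof -
  let ?r = "frac_rel R (carrier R - I)"
  have "congruent2 ?r ?r (\<lambda>(a, s) (b, t). frac (a \<otimes> b) (s \<otimes> t))"
  proof (rule congruent2I', clarify)
    fix a s a' s' b t b' t'
    assume "((a, s), (a', s')) \<in> ?r" "((b, t), (b', t')) \<in> ?r"
    then obtain u v where u: "a \<in> carrier R" "s \<in> carrier R" "b \<in> carrier R" "t \<in> carrier R"
      "a' \<in> carrier R" "s' \<in> carrier R" "b' \<in> carrier R" "t' \<in> carrier R" "u \<in> carrier R" "v \<in> carrier R"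
      "s \<notin> I" "t \<notin> I" "s' \<notin> I" "t' \<notin> I" "u \<notin> I" "v \<notin> I"
      "u \<otimes> (a \<otimes> s' \<ominus> a' \<otimes> s) = \<zero>" "v \<otimes> (b \<otimes> t' \<ominus> b' \<otimes> t) = \<zero>" by (auto simp: frac_rel_iff)
    have "(u \<otimes> v) \<otimes> ((a \<otimes> b) \<otimes> (s' \<otimes> t') \<ominus> (a' \<otimes> b') \<otimes> (s \<otimes> t))
        = v \<otimes> b \<otimes> t' \<otimes> (u \<otimes> (a \<otimes> s' \<ominus> a' \<otimes> s)) \<oplus> u \<otimes> a' \<otimes> s \<otimes> (v \<otimes> (b \<otimes> t' \<ominus> b' \<otimes> t))"
      using u(1-10) by algebra
    also have "\<dots> = \<zero>" using u by simp
    finally show "frac (a \<otimes> b) (s \<otimes> t) = frac (a' \<otimes> b') (s' \<otimes> t')"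
      using u denom_mult by (subst frac_eq_iff) auto
  qed
  then have "(\<Union>x\<in>?r `` {(a, s)}. \<Union>y\<in>?r `` {(b, t)}. (\<lambda>(a, s) (b, t). frac (a \<otimes> b) (s \<otimes> t)) x y)
      = (\<lambda>(a, s) (b, t). frac (a \<otimes> b) (s \<otimes> t)) (a, s) (b, t)"
    using assms by (intro UN_equiv_class2[OF equiv_frac_rel equiv_frac_rel]) auto
  then show ?thesis unfolding localization_def frac_def by (simp add: case_prod_unfold)
qed

lemma add_loc:
  assumes "a \<in> carrier R" "s \<in> carrier R - I" "b \<in> carrier R" "t \<in> carrier R - I"
  shows "frac a s \<oplus>\<^bsub>loc\<^esub> frac b t = frac (a \<otimes> t \<oplus> b \<otimes> s) (s \<otimes> t)"
proof -
  let ?r = "frac_rel R (carrier R - I)"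
  have "congruent2 ?r ?r (\<lambda>(a, s) (b, t). frac (a \<otimes> t \<oplus> b \<otimes> s) (s \<otimes> t))"
  proof (rule congruent2I', clarify)
    fix a s a' s' b t b' t'
    assume "((a, s), (a', s')) \<in> ?r" "((b, t), (b', t')) \<in> ?r"
    then obtain u v where u: "a \<in> carrier R" "s \<in> carrier R" "b \<in> carrier R" "t \<in> carrier R"
      "a' \<in> carrier R" "s' \<in> carrier R" "b' \<in> carrier R" "t' \<in> carrier R" "u \<in> carrier R" "v \<in> carrier R"
      "s \<notin> I" "t \<notin> I" "s' \<notin> I" "t' \<notin> I" "u \<notin> I" "v \<notin> I"
      "u \<otimes> (a \<otimes> s' \<ominus> a' \<otimes> s) = \<zero>" "v \<otimes> (b \<otimes> t' \<ominus> b' \<otimes> t) = \<zero>" by (auto simp: frac_rel_iff)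
    have "(u \<otimes> v) \<otimes> ((a \<otimes> t \<oplus> b \<otimes> s) \<otimes> (s' \<otimes> t') \<ominus> (a' \<otimes> t' \<oplus> b' \<otimes> s') \<otimes> (s \<otimes> t))
        = v \<otimes> t \<otimes> t' \<otimes> (u \<otimes> (a \<otimes> s' \<ominus> a' \<otimes> s)) \<oplus> u \<otimes> s \<otimes> s' \<otimes> (v \<otimes> (b \<otimes> t' \<ominus> b' \<otimes> t))"
      using u(1-10) by algebra
    also have "\<dots> = \<zero>" using u by simp
    finally show "frac (a \<otimes> t \<oplus> b \<otimes> s) (s \<otimes> t) = frac (a' \<otimes> t' \<oplus> b' \<otimes> s') (s' \<otimes> t')"
      using u denom_mult by (subst frac_eq_iff) auto
  qed
  then have "(\<Union>x\<in>?r `` {(a, s)}. \<Union>y\<in>?r `` {(b, t)}. (\<lambda>(a, s) (b, t). frac (a \<otimes> t \<oplus> b \<otimes> s) (s \<otimes> t)) x y)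
      = (\<lambda>(a, s) (b, t). frac (a \<otimes> t \<oplus> b \<otimes> s) (s \<otimes> t)) (a, s) (b, t)"
    using assms by (intro UN_equiv_class2[OF equiv_frac_rel equiv_frac_rel]) auto
  then show ?thesis unfolding localization_def frac_def by (simp add: case_prod_unfold)
qed

lemma frac_cancel:
  assumes "a \<in> carrier R" "s \<in> carrier R - I" "t \<in> carrier R - I"
  shows "frac (t \<otimes> a) (t \<otimes> s) = frac a s"
proof -
  have "s \<in> carrier R" "t \<in> carrier R" using assms by auto
  then have "\<one> \<otimes> ((t \<otimes> a) \<otimes> s \<ominus> a \<otimes> (t \<otimes> s)) = \<zero>" using assms(1) by algebra
  then have "\<exists>u\<in>carrier R - I. u \<otimes> ((t \<otimes> a) \<otimes> s \<ominus> a \<otimes> (t \<otimes> s)) = \<zero>"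
    using one_denom by blast
  then show ?thesis using assms denom_mult[OF assms(3,2)] by (subst frac_eq_iff) simp_all
qed

lemma frac_numerator: "\<lbrakk>a \<in> carrier R; s \<in> carrier R - I\<rbrakk> \<Longrightarrow> frac s \<one> \<otimes>\<^bsub>loc\<^esub> frac a s = frac a \<one>"
  using frac_cancel[of a \<one> s] one_denom by (subst mult_loc) auto

lemma frac_denominator: "\<lbrakk>a \<in> carrier R; s \<in> carrier R - I\<rbrakk> \<Longrightarrow> frac \<one> s \<otimes>\<^bsub>loc\<^esub> frac a \<one> = frac a s"
  using one_denom by (subst mult_loc) auto

text \<open>Denominators are units, so an ideal of the localization is determined by the numerators
  it contains. The ring axioms enter as the assumption \<open>cring loc\<close>, which
  \<open>regular_local_ring\<close> supplies later, so they are not derived from the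
  construction.\<close>

lemma frac_mem_iff:
  assumes L: "cring loc" and J: "ideal J loc" and "a \<in> carrier R" "s \<in> carrier R - I"
  shows "frac a s \<in> J \<longleftrightarrow> a \<in> contraction J"
proof -
  interpret L: cring loc by (rule L)
  show ?thesis
    using assms one_denom L.ideal_mult_mem[OF J _ frac_closed] frac_numerator[of a s] frac_denominator[of a s]
    unfolding contraction_def by (metis (mono_tags, lifting) DiffD1 mem_Collect_eq one_closed)
qed

lemma extension_ideal:
  assumes L: "cring loc" and T: "ideal T R" shows "ideal (extension T) loc"
proof -
  interpret L: cring loc by (rule L)
  have Tc: "T \<subseteq> carrier R" by (rule ideal_subset_carrier[OF T])
  show ?thesis
  proof (rule L.ideal_introI)
    show "extension T \<subseteq> carrier loc" using Tc by (auto simp: extension_def carrier_loc)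
    show "\<zero>\<^bsub>loc\<^esub> \<in> extension T" using ideal_zero_mem[OF T] one_denom by (auto simp: extension_def zero_loc)
    fix x y assume "y \<in> extension T"
    then obtain b t where y: "y = frac b t" "b \<in> T" "t \<in> carrier R - I" by (auto simp: extension_def)
    have b: "b \<in> carrier R" using y Tc by blast
    {
      assume "x \<in> extension T"
      then obtain a s where x: "x = frac a s" "a \<in> T" "s \<in> carrier R - I" by (auto simp: extension_def)
      have a: "a \<in> carrier R" using x Tc by blast
      have "a \<otimes> t \<oplus> b \<otimes> s \<in> T"
        using ideal_add_mem[OF T ideal.I_r_closed[OF T x(2)] ideal.I_r_closed[OF T y(2)]] x(3) y(3) by simp
      then show "x \<oplus>\<^bsub>loc\<^esub> y \<in> extension T"
        using add_loc[OF a x(3) b y(3)] denom_mult[OF x(3) y(3)] x(1) y(1) by (auto simp: extension_def)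
    }
    {
      assume "x \<in> carrier loc"
      then obtain a s where x: "x = frac a s" "a \<in> carrier R" "s \<in> carrier R - I" by (auto simp: carrier_loc)
      have "a \<otimes> b \<in> T" using ideal_mult_mem[OF T] x y by simp
      then show "x \<otimes>\<^bsub>loc\<^esub> y \<in> extension T"
        using mult_loc[OF x(2,3) b y(3)] denom_mult[OF x(3) y(3)] x(1) y(1) by (auto simp: extension_def)
    }
  qed
qed

text \<open>Clearing denominators in p/1 = a/s. This ties \<open>sat\<close> to the actual
  localization.\<close>

lemma frac_one_mem_extension:
  assumes T: "ideal T R" and p: "p \<in> carrier R" "frac p \<one> \<in> extension T" shows "p \<in> sat I T"
proof -
  obtain a s where a: "frac p \<one> = frac a s" "a \<in> T" "s \<in> carrier R - I" using p by (auto simp: extension_def)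
  have ac: "a \<in> carrier R" using a(2) ideal_subset_carrier[OF T] by blast
  obtain u where u: "u \<in> carrier R - I" "u \<otimes> (p \<otimes> s \<ominus> a \<otimes> \<one>) = \<zero>"
    using a(1) frac_eq_iff[OF p(1) one_denom ac a(3)] by auto
  have "u \<in> carrier R" "s \<in> carrier R" using u(1) a(3) by auto
  then have "(u \<otimes> s) \<otimes> p = u \<otimes> (p \<otimes> s \<ominus> a \<otimes> \<one>) \<oplus> u \<otimes> a" using ac p(1) by algebra
  then have "(u \<otimes> s) \<otimes> p \<in> T" using u ac ideal_mult_mem[OF T a(2), of u] by simp
  then show ?thesis using satI[OF p(1)] denom_mult[OF u(1) a(3)] by auto
qed

lemma contraction_prime:
  assumes L: "cring loc" and J: "primeideal J loc"
  shows "primeideal (contraction J) R" "contraction J \<subseteq> I"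
proof -
  interpret L: cring loc by (rule L)
  have Ji: "ideal J loc" using J primeideal.axioms(1) by blast
  have mult1: "frac (a \<otimes> b) \<one> = frac a \<one> \<otimes>\<^bsub>loc\<^esub> frac b \<one>" if "a \<in> carrier R" "b \<in> carrier R" for a b
    using that one_denom by (simp add: mult_loc)
  have add1: "frac (a \<oplus> b) \<one> = frac a \<one> \<oplus>\<^bsub>loc\<^esub> frac b \<one>" if "a \<in> carrier R" "b \<in> carrier R" for a b
    using that one_denom by (simp add: add_loc)
  have "ideal (contraction J) R"
  proof (rule ideal_introI)
    show "\<zero> \<in> contraction J" using L.ideal_zero_mem[OF Ji] by (simp add: contraction_def zero_loc)
    show "a \<oplus> b \<in> contraction J" if "a \<in> contraction J" "b \<in> contraction J" for a b
      using that add1 L.ideal_add_mem[OF Ji] by (auto simp: contraction_def)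
    show "r \<otimes> a \<in> contraction J" if "r \<in> carrier R" "a \<in> contraction J" for r a
      using that mult1 L.ideal_mult_mem[OF Ji] frac_closed one_denom by (auto simp: contraction_def)
  qed (auto simp: contraction_def)
  then show "primeideal (contraction J) R"
  proof (rule primeidealI)
    show "cring R" by (rule cring_axioms)
    show "carrier R \<noteq> contraction J"
      using primeideal_one_notin[OF J] by (auto simp: contraction_def one_loc)
    show "a \<in> contraction J \<or> b \<in> contraction J" if "a \<in> carrier R" "b \<in> carrier R" "a \<otimes> b \<in> contraction J" for a b
      using that primeideal_mem_cases[OF J] frac_closed one_denom mult1 by (auto simp: contraction_def)
  qed
  show "contraction J \<subseteq> I"
  proof (rule ccontr)
    assume "\<not> contraction J \<subseteq> I"
    then obtain a where a: "a \<in> contraction J" "a \<in> carrier R - I" by (auto simp: contraction_def)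
    have "frac \<one> a \<otimes>\<^bsub>loc\<^esub> frac a \<one> = frac \<one> \<one>"
      using a(2) one_denom frac_denominator[of a a] frac_cancel[of \<one> \<one> a] by auto
    then have "frac \<one> \<one> \<in> J"
      using a L.ideal_mult_mem[OF Ji, of "frac a \<one>" "frac \<one> a"] frac_closed by (auto simp: contraction_def)
    then show False using primeideal_one_notin[OF J] by (simp add: one_loc)
  qed
qed

lemma contraction_strict:
  assumes L: "cring loc" and J: "ideal J loc" and K: "ideal K loc" and "J \<subset> K"
  shows "contraction J \<subset> contraction K"
proof -
  obtain x where x: "x \<in> K" "x \<notin> J" using \<open>J \<subset> K\<close> by blast
  have "x \<in> carrier loc" using x(1) ring.ideal_subset_carrier[OF cring.axioms(1)[OF L] K] by blast
  then obtain a s where "x = frac a s" "a \<in> carrier R" "s \<in> carrier R - I" by (auto simp: carrier_loc)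
  then have "a \<in> contraction K" "a \<notin> contraction J" using frac_mem_iff[OF L J] frac_mem_iff[OF L K] x by auto
  moreover have "contraction J \<subseteq> contraction K" using \<open>J \<subset> K\<close> by (auto simp: contraction_def)
  ultimately show ?thesis by blast
qed

text \<open>Numerators of a least generating set of the maximal ideal generate I up to denominators;
  they lie in I because primes contract into I. A longest chain of primes contracts to a strict
  chain of primes below I. Regularity says that both have the same n.\<close>

lemma regular_local_imp_regular_at:
  assumes reg: "regular_local_ring loc"
  shows "\<exists>n. regular_at {\<zero>} n I"
proof -
  have L: "cring loc" and N: "noetherian_ring loc" and ex1: "\<exists>!m. maximalideal m loc"
    using reg by (auto simp: regular_local_ring_def)
  interpret L: cring loc by (rule L)
  interpret L: noetherian_cring loc by (intro noetherian_cring.intro L N)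
  obtain m where m: "maximalideal m loc" and uniq: "\<And>m'. maximalideal m' loc \<Longrightarrow> m' = m"
    using ex1 by blast
  have mi: "ideal m loc" using m maximalideal.axioms(1) by blast
  define n where "n = min_generators loc m"
  have kd: "krull_dim loc = enat n" using reg m by (auto simp: regular_local_ring_def n_def)
  have Ii: "ideal I R" using prime primeideal.axioms(1) by blast
  \<comment> \<open>The maximal ideal is known only through existence and uniqueness. The extension
    of I is proper, so it lies in some maximal ideal, which must be m.\<close>
  have Im: "extension I \<subseteq> m"
  proof -
    have eI: "ideal (extension I) loc" by (rule extension_ideal[OF L Ii])
    have "\<one> \<notin> sat I I" using sat_prime[OF prime prime] primeideal_one_notin[OF prime] by simp
    then have "frac \<one> \<one> \<notin> extension I" using frac_one_mem_extension[OF Ii one_closed] by blast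
    then have "extension I \<noteq> carrier loc" using L.one_closed by (auto simp: one_loc)
    then obtain M where M: "ideal M loc" "extension I \<subseteq> M" "M \<noteq> carrier loc"
      and max: "\<And>J. \<lbrakk>ideal J loc; M \<subset> J\<rbrakk> \<Longrightarrow> \<not> J \<noteq> carrier loc"
      using L.ideal_maximal_exists[OF eI, of "\<lambda>J. J \<noteq> carrier loc"] by metis
    have "maximalideal M loc"
      using M max by (intro maximalidealI) blast+
    then show ?thesis using uniq M(2) by blast
  qed
  have "\<exists>n X. X \<subseteq> carrier loc \<and> finite X \<and> card X = n \<and> m = Idl\<^bsub>loc\<^esub> X"
    using L.finetely_gen[OF mi] by blast
  then have "\<exists>X\<subseteq>carrier loc. finite X \<and> card X = n \<and> m = Idl\<^bsub>loc\<^esub> X"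
    unfolding n_def min_generators_def by (rule LeastI_ex[OF ex_forward]) blast
  then obtain X where X: "X \<subseteq> carrier loc" "finite X" "card X = n" "m = Idl\<^bsub>loc\<^esub> X" by blast
  have "\<exists>a s. x = frac a s \<and> a \<in> I \<and> s \<in> carrier R - I" if "x \<in> X" for x
  proof -
    obtain a s where a: "x = frac a s" "a \<in> carrier R" "s \<in> carrier R - I" using X(1) \<open>x \<in> X\<close> by (auto simp: carrier_loc)
    have "x \<in> m" using X(4) L.genideal_self[OF X(1)] \<open>x \<in> X\<close> by blast
    then have "a \<in> contraction m" using frac_mem_iff[OF L mi a(2,3)] a(1) by simp
    then have "a \<in> I" using contraction_prime(2)[OF L L.maximalideal_prime[OF m]] by blast
    then show ?thesis using a by blast
  qed
  then obtain num den where nd: "\<And>x. x \<in> X \<Longrightarrow> x = frac (num x) (den x) \<and> num x \<in> I \<and> den x \<in> carrier R - I"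
    by metis
  obtain l where l: "set l = X" "length l = n" using X(2,3) finite_distinct_list distinct_card by metis
  define ys where "ys = map num l"
  have ys: "set ys \<subseteq> I" "length ys = n" using nd l by (auto simp: ys_def)
  have ysc: "set ys \<subseteq> carrier R" using ys ideal_subset_carrier[OF Ii] by blast
  define T where "T = foldl adjoin {\<zero>} ys"
  have T: "ideal T R" "set ys \<subseteq> T"
    unfolding T_def using ideal_foldl_adjoin[OF zeroideal ysc] foldl_adjoin_superset[OF zeroideal ysc] by auto
  have "X \<subseteq> extension T"
  proof
    fix x assume x: "x \<in> X"
    then have "num x \<in> T" using T(2) l(1) by (auto simp: ys_def)
    then show "x \<in> extension T" using nd[OF x] by (auto simp: extension_def)
  qed
  then have mT: "m \<subseteq> extension T" using L.genideal_minimal[OF extension_ideal[OF L T(1)]] X(4) by simp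
  have "I \<subseteq> sat I T"
  proof
    fix p assume p: "p \<in> I"
    then have "frac p \<one> \<in> extension I" using one_denom by (auto simp: extension_def)
    then show "p \<in> sat I T"
      using frac_one_mem_extension[OF T(1)] Im mT p ideal_subset_carrier[OF Ii] by blast
  qed
  moreover have "height_ge {\<zero>} n I"
  \<comment> \<open>In \<open>enat\<close> the supremum of the empty set is 0, so n = 0 would not
    yield a chain and is treated directly. A positive finite supremum is attained.\<close>
  proof (cases "n = 0")
    case True
    then show ?thesis using ideal_zero_mem[OF Ii] by simp
  next
    case False
    define D where "D = {n. \<exists>P :: nat \<Rightarrow> ('a \<times> 'a) set set.
        (\<forall>i\<le>n. primeideal (P i) loc) \<and> (\<forall>i<n. P i \<subset> P (Suc i))}"
    have S: "Sup (enat ` D) = enat n" using kd by (simp add: krull_dim_def D_def)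
    have ne: "enat ` D \<noteq> {}"
    proof
      assume "enat ` D = {}"
      then show False using S False by (simp add: bot_enat_def zero_enat_def)
    qed
    moreover have "finite (enat ` D)" using S ne by (auto simp: Sup_enat_def split: if_splits)
    ultimately have "enat n \<in> enat ` D" using S Max_in[of "enat ` D"] by (simp add: Sup_enat_def)
    then obtain C where C: "\<And>i. i \<le> n \<Longrightarrow> primeideal (C i) loc" "\<And>i. i < n \<Longrightarrow> C i \<subset> C (Suc i)"
      by (auto simp: D_def)
    have "i \<le> n \<Longrightarrow> height_ge {\<zero>} i (contraction (C i))" for i
    proof (induction i)
      case 0
      then show ?case
        using ideal_zero_mem[OF primeideal.axioms(1)[OF contraction_prime(1)[OF L C(1)]]] by simp
    next
      case (Suc i)
      have "contraction (C i) \<subset> contraction (C (Suc i))"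
        using contraction_strict[OF L primeideal.axioms(1)[OF C(1)] primeideal.axioms(1)[OF C(1)] C(2)] Suc.prems by simp
      then show ?case using Suc contraction_prime(1)[OF L C(1)[of i]] by (simp only: height_ge.simps) (metis Suc_leD)
    qed
    then show ?thesis using height_ge_mono contraction_prime(2)[OF L C(1)[of n]] by blast
  qed
  ultimately show ?thesis unfolding regular_at_def T_def using ys by blast
qed

end

lemma regular_ring_imp_regular_at:
  assumes "regular_ring R" "primeideal P R"
  shows "\<exists>n. cring.regular_at R {\<zero>\<^bsub>R\<^esub>} n P"
  using primeideal.regular_local_imp_regular_at[OF assms(2)] assms by (simp add: regular_ring_def)

section \<open>Baer's criterion\<close>

context module
begin

text \<open>Values outside I are unconstrained, in contrast to the extensional
  \<open>module_hom\<close>, so a map on P serves unchanged as a map on J \<subseteq> P.\<close>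

definition ideal_hom :: "'a set \<Rightarrow> ('a \<Rightarrow> 'c) \<Rightarrow> bool" where
  "ideal_hom I f \<longleftrightarrow> f \<in> I \<rightarrow> carrier M \<and> (\<forall>x\<in>I. \<forall>y\<in>I. f (x \<oplus> y) = f x \<oplus>\<^bsub>M\<^esub> f y) \<and>
    (\<forall>r\<in>carrier R. \<forall>x\<in>I. f (r \<otimes> x) = r \<odot>\<^bsub>M\<^esub> f x)"

text \<open>A homomorphism from R to M is multiplication by the image e of 1, so an extension to R
  is recorded by e.\<close>

definition extends_to_ring :: "'a set \<Rightarrow> bool" where
  "extends_to_ring I \<longleftrightarrow> (\<forall>f. ideal_hom I f \<longrightarrow> (\<exists>e\<in>carrier M. \<forall>x\<in>I. f x = x \<odot>\<^bsub>M\<^esub> e))"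

lemma ideal_homI:
  assumes "\<And>x. x \<in> I \<Longrightarrow> f x \<in> carrier M"
    and "\<And>x y. \<lbrakk>x \<in> I; y \<in> I\<rbrakk> \<Longrightarrow> f (x \<oplus> y) = f x \<oplus>\<^bsub>M\<^esub> f y"
    and "\<And>r x. \<lbrakk>r \<in> carrier R; x \<in> I\<rbrakk> \<Longrightarrow> f (r \<otimes> x) = r \<odot>\<^bsub>M\<^esub> f x"
  shows "ideal_hom I f"
  using assms by (auto simp: ideal_hom_def)

lemma ideal_homD:
  assumes "ideal_hom I f"
  shows "x \<in> I \<Longrightarrow> f x \<in> carrier M"
    and "\<lbrakk>x \<in> I; y \<in> I\<rbrakk> \<Longrightarrow> f (x \<oplus> y) = f x \<oplus>\<^bsub>M\<^esub> f y"
    and "\<lbrakk>r \<in> carrier R; x \<in> I\<rbrakk> \<Longrightarrow> f (r \<otimes> x) = r \<odot>\<^bsub>M\<^esub> f x"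
  using assms by (auto simp: ideal_hom_def)

lemma extends_to_ring_carrier: "extends_to_ring (carrier R)"
  unfolding extends_to_ring_def
proof (intro allI impI bexI ballI)
  fix f x assume f: "ideal_hom (carrier R) f" and x: "x \<in> carrier R"
  show "f x = x \<odot>\<^bsub>M\<^esub> f \<one>" using ideal_homD(3)[OF f x R.one_closed] x by simp
next
  fix f assume "ideal_hom (carrier R) f"
  then show "f \<one> \<in> carrier M" using ideal_homD(1) by blast
qed

text \<open>The condition on I : a says that sending a to e is consistent with f wherever a multiple
  of a falls into I. It makes the value at u independent of the coefficient r that
  \<open>SOME\<close> selects.\<close>

lemma ideal_hom_glue:
  assumes I: "ideal I R" and f: "ideal_hom I f" and a: "a \<in> carrier R" and e: "e \<in> carrier M"
    and fe: "\<And>r. r \<in> R.colon I a \<Longrightarrow> f (r \<otimes> a) = r \<odot>\<^bsub>M\<^esub> e"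
  shows "\<exists>h. ideal_hom (R.adjoin I a) h \<and> (\<forall>x\<in>I. h x = f x)"
proof -
  define h where "h u = (let r = SOME r. r \<in> carrier R \<and> u \<ominus> r \<otimes> a \<in> I in f (u \<ominus> r \<otimes> a) \<oplus>\<^bsub>M\<^esub> r \<odot>\<^bsub>M\<^esub> e)" for u
  have h: "h u = f (u \<ominus> r \<otimes> a) \<oplus>\<^bsub>M\<^esub> r \<odot>\<^bsub>M\<^esub> e"
    if u: "u \<in> carrier R" and r: "r \<in> carrier R" "u \<ominus> r \<otimes> a \<in> I" for u r
  proof -
    define t where "t = (SOME r. r \<in> carrier R \<and> u \<ominus> r \<otimes> a \<in> I)"
    have t: "t \<in> carrier R" "u \<ominus> t \<otimes> a \<in> I"
      using someI_ex[of "\<lambda>r. r \<in> carrier R \<and> u \<ominus> r \<otimes> a \<in> I"] r unfolding t_def by auto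
    have eq: "u \<ominus> t \<otimes> a = (u \<ominus> r \<otimes> a) \<oplus> (r \<ominus> t) \<otimes> a" "(r \<ominus> t) \<otimes> a = (u \<ominus> t \<otimes> a) \<ominus> (u \<ominus> r \<otimes> a)"
      using u r(1) t(1) a by algebra+
    have m: "(r \<ominus> t) \<otimes> a \<in> I" unfolding eq(2) by (rule R.ideal_minus_mem[OF I t(2) r(2)])
    have "h u = f (u \<ominus> t \<otimes> a) \<oplus>\<^bsub>M\<^esub> t \<odot>\<^bsub>M\<^esub> e" by (simp add: h_def t_def Let_def)
    also have "f (u \<ominus> t \<otimes> a) = f (u \<ominus> r \<otimes> a) \<oplus>\<^bsub>M\<^esub> f ((r \<ominus> t) \<otimes> a)"
      using ideal_homD(2)[OF f r(2) m] eq(1) by simp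
    also have "f ((r \<ominus> t) \<otimes> a) = (r \<ominus> t) \<odot>\<^bsub>M\<^esub> e"
      using fe[of "r \<ominus> t"] m r(1) t(1) by (simp add: R.colon_mem_iff)
    also have "f (u \<ominus> r \<otimes> a) \<oplus>\<^bsub>M\<^esub> (r \<ominus> t) \<odot>\<^bsub>M\<^esub> e \<oplus>\<^bsub>M\<^esub> t \<odot>\<^bsub>M\<^esub> e
        = f (u \<ominus> r \<otimes> a) \<oplus>\<^bsub>M\<^esub> ((r \<ominus> t) \<oplus> t) \<odot>\<^bsub>M\<^esub> e"
      using ideal_homD(1)[OF f r(2)] r(1) t(1) e by (simp add: M.a_assoc smult_l_distr)
    also have "(r \<ominus> t) \<oplus> t = r" using r(1) t(1) by algebra
    finally show ?thesis .
  qed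
  have "ideal_hom (R.adjoin I a) h"
  proof (rule ideal_homI)
    fix u assume "u \<in> R.adjoin I a"
    then obtain r where u: "u \<in> carrier R" "r \<in> carrier R" "u \<ominus> r \<otimes> a \<in> I" by (rule R.adjoinE)
    show "h u \<in> carrier M" using h[OF u] ideal_homD(1)[OF f u(3)] u(2) e by simp
    {
      fix v assume "v \<in> R.adjoin I a"
      then obtain t where v: "v \<in> carrier R" "t \<in> carrier R" "v \<ominus> t \<otimes> a \<in> I" by (rule R.adjoinE)
      have eq: "(u \<oplus> v) \<ominus> (r \<oplus> t) \<otimes> a = (u \<ominus> r \<otimes> a) \<oplus> (v \<ominus> t \<otimes> a)" using u(1,2) v(1,2) a by algebra
      have "h (u \<oplus> v) = f ((u \<oplus> v) \<ominus> (r \<oplus> t) \<otimes> a) \<oplus>\<^bsub>M\<^esub> (r \<oplus> t) \<odot>\<^bsub>M\<^esub> e"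
        using h[of "u \<oplus> v" "r \<oplus> t"] R.ideal_add_mem[OF I u(3) v(3)] u v eq by simp
      then show "h (u \<oplus> v) = h u \<oplus>\<^bsub>M\<^esub> h v"
        using h[OF u] h[OF v] ideal_homD(1,2)[OF f] u v e eq by (simp add: smult_l_distr M.a_ac)
    }
    {
      fix c assume c: "c \<in> carrier R"
      have eq: "c \<otimes> u \<ominus> (c \<otimes> r) \<otimes> a = c \<otimes> (u \<ominus> r \<otimes> a)" using u(1,2) c a by algebra
      have "h (c \<otimes> u) = f (c \<otimes> u \<ominus> (c \<otimes> r) \<otimes> a) \<oplus>\<^bsub>M\<^esub> (c \<otimes> r) \<odot>\<^bsub>M\<^esub> e"
        using h[of "c \<otimes> u" "c \<otimes> r"] R.ideal_mult_mem[OF I u(3) c] u c eq by simp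
      then show "h (c \<otimes> u) = c \<odot>\<^bsub>M\<^esub> h u"
        using h[OF u] ideal_homD(1,3)[OF f] u c e eq by (simp add: smult_r_distr smult_assoc1)
    }
  qed
  moreover have "h x = f x" if x: "x \<in> I" for x
  proof -
    have xc: "x \<in> carrier R" using x R.ideal_subset_carrier[OF I] by blast
    have "x \<ominus> \<zero> \<otimes> a = x" using xc a by algebra
    then show ?thesis using h[OF xc R.zero_closed] x e ideal_homD(1)[OF f x] by simp
  qed
  ultimately show ?thesis by blast
qed

text \<open>The elementary form of the exact sequence of Ext: the map r \<mapsto> f(ra) on I : a is
  multiplication by some e, so sending a to e extends f to I + Ra, and from there it extends to
  R.\<close>

lemma extends_to_ring_colon:
  assumes I: "ideal I R" and a: "a \<in> carrier R"
    and "extends_to_ring (R.colon I a)" "extends_to_ring (R.adjoin I a)"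
  shows "extends_to_ring I"
  unfolding extends_to_ring_def
proof (intro allI impI)
  fix f assume f: "ideal_hom I f"
  have "ideal_hom (R.colon I a) (\<lambda>r. f (r \<otimes> a))"
    using ideal_homD[OF f] a by (intro ideal_homI) (auto simp: R.colon_mem_iff R.l_distr R.m_assoc)
  then obtain e where e: "e \<in> carrier M" "\<And>r. r \<in> R.colon I a \<Longrightarrow> f (r \<otimes> a) = r \<odot>\<^bsub>M\<^esub> e"
    using assms(3) by (auto simp: extends_to_ring_def)
  obtain h where h: "ideal_hom (R.adjoin I a) h" "\<And>x. x \<in> I \<Longrightarrow> h x = f x"
    using ideal_hom_glue[OF I f a e] by blast
  then obtain e' where "e' \<in> carrier M" "\<And>x. x \<in> R.adjoin I a \<Longrightarrow> h x = x \<odot>\<^bsub>M\<^esub> e'"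
    using assms(4) by (auto simp: extends_to_ring_def)
  then show "\<exists>e\<in>carrier M. \<forall>x\<in>I. f x = x \<odot>\<^bsub>M\<^esub> e"
    using R.adjoin_superset[OF I a] h(2) by (metis subsetD)
qed

lemma extends_to_ring_prime:
  assumes P: "primeideal P R" and J: "J \<subseteq> P" "extends_to_ring J"
    and s: "s \<in> carrier R" "s \<notin> P" "\<And>p. p \<in> P \<Longrightarrow> s \<otimes> p \<in> J"
    and adj: "extends_to_ring (R.adjoin P s)"
  shows "extends_to_ring P"
  unfolding extends_to_ring_def
proof (intro allI impI)
  fix f assume f: "ideal_hom P f"
  have Pi: "ideal P R" using P primeideal.axioms(1) by blast
  have Pc: "p \<in> carrier R" if "p \<in> P" for p using that R.ideal_subset_carrier[OF Pi] by blast
  have "ideal_hom J f" using ideal_homD[OF f] subsetD[OF J(1)] by (intro ideal_homI) simp_all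
  then obtain e where e: "e \<in> carrier M" "\<And>x. x \<in> J \<Longrightarrow> f x = x \<odot>\<^bsub>M\<^esub> e"
    using J(2) by (auto simp: extends_to_ring_def)
  define g where "g x = f x \<oplus>\<^bsub>M\<^esub> x \<odot>\<^bsub>M\<^esub> (\<ominus>\<^bsub>M\<^esub> e)" for x
  have g: "ideal_hom P g"
  proof (rule ideal_homI)
    fix x assume x: "x \<in> P"
    show "g x \<in> carrier M" using ideal_homD(1)[OF f x] Pc[OF x] e(1) by (simp add: g_def)
    show "g (x \<oplus> y) = g x \<oplus>\<^bsub>M\<^esub> g y" if y: "y \<in> P" for y
      using ideal_homD(1,2)[OF f] Pc[OF x] Pc[OF y] x y e(1) by (simp add: g_def smult_l_distr M.a_ac)
    show "g (r \<otimes> x) = r \<odot>\<^bsub>M\<^esub> g x" if r: "r \<in> carrier R" for r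
      using ideal_homD(1,3)[OF f] Pc[OF x] x r e(1) by (simp add: g_def smult_r_distr smult_assoc1)
  qed
  have "g x = \<zero>\<^bsub>M\<^esub>" if "x \<in> J" for x
    using e Pc J(1) that by (auto simp: g_def smult_r_minus M.r_neg)
  then have sg: "s \<odot>\<^bsub>M\<^esub> g p = \<zero>\<^bsub>M\<^esub>" if "p \<in> P" for p
    using ideal_homD(3)[OF g s(1) that] s(3)[OF that] by simp
  \<comment> \<open>As s is outside the prime P, the ideal P : s is P itself, and s annihilates the
    values of g there. So g extends to P + Rs with s sent to 0.\<close>
  have "g (r \<otimes> s) = r \<odot>\<^bsub>M\<^esub> \<zero>\<^bsub>M\<^esub>" if "r \<in> R.colon P s" for r
  proof -
    have r: "r \<in> carrier R" "r \<in> P"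
      using that primeideal_mem_cases[OF P _ s(1), of r] s(2) by (auto simp: R.colon_mem_iff)
    then show ?thesis using sg[OF r(2)] ideal_homD(3)[OF g s(1) r(2)] s(1) by (simp add: R.m_comm)
  qed
  then obtain h where h: "ideal_hom (R.adjoin P s) h" "\<And>x. x \<in> P \<Longrightarrow> h x = g x"
    using ideal_hom_glue[OF Pi g s(1) M.zero_closed] by blast
  then obtain d where d: "d \<in> carrier M" "\<And>x. x \<in> R.adjoin P s \<Longrightarrow> h x = x \<odot>\<^bsub>M\<^esub> d"
    using adj by (auto simp: extends_to_ring_def)
  have "f x = x \<odot>\<^bsub>M\<^esub> (d \<oplus>\<^bsub>M\<^esub> e)" if x: "x \<in> P" for x
  proof -
    have fx: "f x \<in> carrier M" using ideal_homD(1)[OF f x] .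
    have "x \<odot>\<^bsub>M\<^esub> d = f x \<oplus>\<^bsub>M\<^esub> \<ominus>\<^bsub>M\<^esub> (x \<odot>\<^bsub>M\<^esub> e)"
      using h(2)[OF x] d(2)[of x] R.adjoin_superset[OF Pi s(1)] x Pc[OF x] e(1)
      by (auto simp: g_def smult_r_minus)
    then show ?thesis using fx Pc[OF x] e(1) d(1) by (simp add: smult_r_distr M.a_assoc M.l_neg)
  qed
  then show "\<exists>e\<in>carrier M. \<forall>x\<in>P. f x = x \<odot>\<^bsub>M\<^esub> e" using d(1) e(1) by blast
qed

lemma extends_to_ring_all:
  assumes noeth: "noetherian_ring R"
    and prime: "\<And>P. primeideal P R \<Longrightarrow> \<exists>J s. J \<subseteq> P \<and> extends_to_ring J \<and> s \<in> carrier R \<and> s \<notin> P \<and> (\<forall>p\<in>P. s \<otimes> p \<in> J)"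
    and I: "ideal I R"
  shows "extends_to_ring I"
proof -
  interpret N: noetherian_cring R by (intro noetherian_cring.intro R.cring_axioms noeth)
  show ?thesis
    using I
  proof (induction rule: N.ideal_prime_induct)
    case carrier
    show ?case by (rule extends_to_ring_carrier)
  next
    case (prime P)
    then obtain J s where Js: "J \<subseteq> P" "extends_to_ring J" "s \<in> carrier R" "s \<notin> P" "\<And>p. p \<in> P \<Longrightarrow> s \<otimes> p \<in> J"
      using assms(2)[OF prime(1)] by blast
    have Pi: "ideal P R" using prime(1) primeideal.axioms(1) by blast
    have "P \<subset> R.adjoin P s"
      using R.adjoin_superset[OF Pi Js(3)] R.adjoin_self[OF Pi Js(3)] Js(4) by blast
    then have "extends_to_ring (R.adjoin P s)" using prime(2) R.ideal_adjoin[OF Pi Js(3)] by blast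
    then show ?case using extends_to_ring_prime[OF prime(1) Js(1-4)] Js(5) by blast
  next
    case (colon I a)
    then show ?case using extends_to_ring_colon by blast
  qed
qed

end

section \<open>Module homomorphisms and their graphs\<close>

lemma module_minus_one:
  assumes "module R M" "x \<in> carrier M" shows "(\<ominus>\<^bsub>R\<^esub> \<one>\<^bsub>R\<^esub>) \<odot>\<^bsub>M\<^esub> x = \<ominus>\<^bsub>M\<^esub> x"
proof -
  interpret module R M by (rule assms)
  show ?thesis using assms(2) smult_l_minus[of "\<one>\<^bsub>R\<^esub>" x] by simp
qed

lemma module_homD:
  assumes "f \<in> module_hom R M N"
  shows "x \<in> carrier M \<Longrightarrow> f x \<in> carrier N"
    and "\<lbrakk>x \<in> carrier M; y \<in> carrier M\<rbrakk> \<Longrightarrow> f (x \<oplus>\<^bsub>M\<^esub> y) = f x \<oplus>\<^bsub>N\<^esub> f y"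
    and "\<lbrakk>r \<in> carrier R; x \<in> carrier M\<rbrakk> \<Longrightarrow> f (r \<odot>\<^bsub>M\<^esub> x) = r \<odot>\<^bsub>N\<^esub> f x"
    and "x \<notin> carrier M \<Longrightarrow> f x = undefined"
  using assms by (auto simp: module_hom_def)

lemma module_homI:
  assumes "\<And>x. x \<in> carrier M \<Longrightarrow> f x \<in> carrier N"
    and "\<And>x y. \<lbrakk>x \<in> carrier M; y \<in> carrier M\<rbrakk> \<Longrightarrow> f (x \<oplus>\<^bsub>M\<^esub> y) = f x \<oplus>\<^bsub>N\<^esub> f y"
    and "\<And>r x. \<lbrakk>r \<in> carrier R; x \<in> carrier M\<rbrakk> \<Longrightarrow> f (r \<odot>\<^bsub>M\<^esub> x) = r \<odot>\<^bsub>N\<^esub> f x"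
    and "\<And>x. x \<notin> carrier M \<Longrightarrow> f x = undefined"
  shows "f \<in> module_hom R M N"
  using assms by (auto simp: module_hom_def)

lemma module_hom_zero:
  assumes "module R M" "module R N" "f \<in> module_hom R M N"
  shows "f \<zero>\<^bsub>M\<^esub> = \<zero>\<^bsub>N\<^esub>"
proof -
  interpret M: module R M by (rule assms)
  interpret N: module R N by (rule assms)
  have "f (\<zero>\<^bsub>R\<^esub> \<odot>\<^bsub>M\<^esub> \<zero>\<^bsub>M\<^esub>) = \<zero>\<^bsub>R\<^esub> \<odot>\<^bsub>N\<^esub> f \<zero>\<^bsub>M\<^esub>" by (intro module_homD(3)[OF assms(3)]) simp_all
  then show ?thesis using module_homD(1)[OF assms(3), of "\<zero>\<^bsub>M\<^esub>"] by simp
qed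

text \<open>Homomorphisms from submodules of B to E, encoded as submodules of B \<times> E, so that
  extension is inclusion and the upper bound of a chain is its union. For a submodule, being
  single-valued at zero already means being single-valued.\<close>

definition hom_graph ::
  "('a, 'r) ring_scheme \<Rightarrow> ('a, 'b, 'm) module_scheme \<Rightarrow> ('a, 'c, 'n) module_scheme \<Rightarrow> ('b \<times> 'c) set \<Rightarrow> bool"
  where
  "hom_graph R B E G \<longleftrightarrow> G \<subseteq> carrier B \<times> carrier E \<and>
    (\<forall>b e b' e'. (b, e) \<in> G \<longrightarrow> (b', e') \<in> G \<longrightarrow> (b \<oplus>\<^bsub>B\<^esub> b', e \<oplus>\<^bsub>E\<^esub> e') \<in> G) \<and>
    (\<forall>r\<in>carrier R. \<forall>b e. (b, e) \<in> G \<longrightarrow> (r \<odot>\<^bsub>B\<^esub> b, r \<odot>\<^bsub>E\<^esub> e) \<in> G) \<and>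
    (\<forall>e. (\<zero>\<^bsub>B\<^esub>, e) \<in> G \<longrightarrow> e = \<zero>\<^bsub>E\<^esub>)"

lemma hom_graphD:
  assumes "hom_graph R B E G"
  shows "(b, e) \<in> G \<Longrightarrow> b \<in> carrier B" "(b, e) \<in> G \<Longrightarrow> e \<in> carrier E"
    and "\<lbrakk>(b, e) \<in> G; (b', e') \<in> G\<rbrakk> \<Longrightarrow> (b \<oplus>\<^bsub>B\<^esub> b', e \<oplus>\<^bsub>E\<^esub> e') \<in> G"
    and "\<lbrakk>r \<in> carrier R; (b, e) \<in> G\<rbrakk> \<Longrightarrow> (r \<odot>\<^bsub>B\<^esub> b, r \<odot>\<^bsub>E\<^esub> e) \<in> G"
    and "(\<zero>\<^bsub>B\<^esub>, e) \<in> G \<Longrightarrow> e = \<zero>\<^bsub>E\<^esub>"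
  using assms by (auto simp: hom_graph_def)

lemma hom_graph_unique:
  assumes B: "module R B" and E: "module R E" and G: "hom_graph R B E G" and "(b, e) \<in> G" "(b, e') \<in> G"
  shows "e = e'"
proof -
  interpret B: module R B by (rule B)
  interpret E: module R E by (rule E)
  note mem = hom_graphD[OF G]
  have c: "b \<in> carrier B" "e \<in> carrier E" "e' \<in> carrier E" using mem(1,2) assms(4,5) by auto
  have "(b \<oplus>\<^bsub>B\<^esub> \<ominus>\<^bsub>B\<^esub> b, e \<oplus>\<^bsub>E\<^esub> \<ominus>\<^bsub>E\<^esub> e') \<in> G"
    using mem(3)[OF assms(4) mem(4)[OF _ assms(5), of "\<ominus>\<^bsub>R\<^esub> \<one>\<^bsub>R\<^esub>"]] c
    by (simp add: module_minus_one[OF B] module_minus_one[OF E])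
  then have "e \<oplus>\<^bsub>E\<^esub> \<ominus>\<^bsub>E\<^esub> e' = \<zero>\<^bsub>E\<^esub>" using mem(5) c by (simp add: B.M.r_neg)
  then show ?thesis using c by (metis E.M.minus_equality E.M.minus_minus E.M.a_inv_closed E.M.a_comm)
qed

text \<open>Zorn's lemma is applied to the graphs that extend f along i. Injectivity of i makes the
  initial relation \<open>G0\<close> single-valued, and the extension property for ideals makes a
  maximal graph total.\<close>

lemma baer_criterion:
  assumes E: "module R E" and ext: "\<And>I. ideal I R \<Longrightarrow> module.extends_to_ring R E I"
  shows "injective_module TYPE('b) TYPE('c) R E"
  unfolding injective_module_def
proof (intro conjI allI impI)
  show "module R E" by (rule E)
  fix A :: "('a, 'b) module" and B :: "('a, 'c) module" and i f
  assume asm: "module R A \<and> module R B \<and> i \<in> module_hom R A B \<and> inj_on i (carrier A) \<and> f \<in> module_hom R A E"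
  then have A: "module R A" and B: "module R B" and i: "i \<in> module_hom R A B"
    and inj: "inj_on i (carrier A)" and f: "f \<in> module_hom R A E" by auto
  interpret A: module R A by (rule A)
  interpret B: module R B by (rule B)
  interpret E: module R E by (rule E)
  define G0 where "G0 = {(i x, f x) |x. x \<in> carrier A}"
  define \<G> where "\<G> = {G. hom_graph R B E G \<and> G0 \<subseteq> G}"
  have "hom_graph R B E G0"
    unfolding hom_graph_def
  proof (intro conjI allI impI ballI)
    show "G0 \<subseteq> carrier B \<times> carrier E" using module_homD(1)[OF i] module_homD(1)[OF f] by (auto simp: G0_def)
    show "(b \<oplus>\<^bsub>B\<^esub> b', e \<oplus>\<^bsub>E\<^esub> e') \<in> G0" if be: "(b, e) \<in> G0" "(b', e') \<in> G0" for b e b' e'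
    proof -
      obtain x y where xy: "x \<in> carrier A" "y \<in> carrier A" "b = i x" "e = f x" "b' = i y" "e' = f y"
        using be by (auto simp: G0_def)
      then show ?thesis
        using module_homD(2)[OF i xy(1,2)] module_homD(2)[OF f xy(1,2)] by (auto simp: G0_def intro!: exI[of _ "x \<oplus>\<^bsub>A\<^esub> y"])
    qed
    show "(r \<odot>\<^bsub>B\<^esub> b, r \<odot>\<^bsub>E\<^esub> e) \<in> G0" if r: "r \<in> carrier R" and be: "(b, e) \<in> G0" for r b e
    proof -
      obtain x where x: "x \<in> carrier A" "b = i x" "e = f x" using be by (auto simp: G0_def)
      then show ?thesis
        using module_homD(3)[OF i r x(1)] module_homD(3)[OF f r x(1)] r by (auto simp: G0_def intro!: exI[of _ "r \<odot>\<^bsub>A\<^esub> x"])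
    qed
    show "e = \<zero>\<^bsub>E\<^esub>" if be: "(\<zero>\<^bsub>B\<^esub>, e) \<in> G0" for e
    proof -
      obtain x where x: "x \<in> carrier A" "\<zero>\<^bsub>B\<^esub> = i x" "e = f x" using be by (auto simp: G0_def)
      then have "x = \<zero>\<^bsub>A\<^esub>" using inj_onD[OF inj, of x "\<zero>\<^bsub>A\<^esub>"] module_hom_zero[OF A B i] by simp
      then show ?thesis using x module_hom_zero[OF A E f] by simp
    qed
  qed
  then have "\<G> \<noteq> {}" by (auto simp: \<G>_def)
  moreover have "\<Union>C \<in> \<G>" if C: "C \<noteq> {}" "subset.chain \<G> C" for C
  proof -
    have CG: "hom_graph R B E G" "G0 \<subseteq> G" if "G \<in> C" for G
      using that C(2) by (auto simp: \<G>_def subset_chain_def)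
    have lin: "\<exists>G\<in>C. x \<in> G \<and> y \<in> G" if "x \<in> \<Union>C" "y \<in> \<Union>C" for x y
    proof -
      obtain G H where GH: "G \<in> C" "x \<in> G" "H \<in> C" "y \<in> H" using \<open>x \<in> \<Union>C\<close> \<open>y \<in> \<Union>C\<close> by blast
      then have "G \<subseteq> H \<or> H \<subseteq> G" using C(2) unfolding subset_chain_def by simp
      then show ?thesis using GH by auto
    qed
    have "hom_graph R B E (\<Union>C)"
      unfolding hom_graph_def
    proof (intro conjI allI impI ballI)
      show "\<Union>C \<subseteq> carrier B \<times> carrier E" using CG(1) by (force simp: hom_graph_def)
      show "(b \<oplus>\<^bsub>B\<^esub> b', e \<oplus>\<^bsub>E\<^esub> e') \<in> \<Union>C" if "(b, e) \<in> \<Union>C" "(b', e') \<in> \<Union>C" for b e b' e'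
        using lin[OF that] hom_graphD(3)[OF CG(1)] by (meson UnionI)
      show "(r \<odot>\<^bsub>B\<^esub> b, r \<odot>\<^bsub>E\<^esub> e) \<in> \<Union>C" if "r \<in> carrier R" "(b, e) \<in> \<Union>C" for r b e
        using that hom_graphD(4)[OF CG(1)] by (meson UnionI UnionE)
      show "e = \<zero>\<^bsub>E\<^esub>" if "(\<zero>\<^bsub>B\<^esub>, e) \<in> \<Union>C" for e
        using that hom_graphD(5)[OF CG(1)] by (meson UnionE)
    qed
    moreover have "G0 \<subseteq> \<Union>C" using C(1) CG(2) by blast
    ultimately show ?thesis by (simp add: \<G>_def)
  qed
  ultimately obtain G where "G \<in> \<G>" and max: "\<And>X. \<lbrakk>X \<in> \<G>; G \<subseteq> X\<rbrakk> \<Longrightarrow> X = G"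
    using subset_Zorn_nonempty[of \<G>] by metis
  then have G: "hom_graph R B E G" and G0: "G0 \<subseteq> G" by (auto simp: \<G>_def)
  note mem = hom_graphD[OF G]
  note unique = hom_graph_unique[OF B E G]
  have zero: "(\<zero>\<^bsub>B\<^esub>, \<zero>\<^bsub>E\<^esub>) \<in> G"
    using G0 module_hom_zero[OF A B i] module_hom_zero[OF A E f] A.M.zero_closed unfolding G0_def by force
  have total: "\<exists>e. (b, e) \<in> G" if b: "b \<in> carrier B" for b
  proof -
    \<comment> \<open>The obstruction to adding b is the ideal of all r for which rb already has a
      value, and \<phi> is the value at rb. An extension of \<phi> to R, given by e0, provides a
      consistent image for b.\<close>
    define I where "I = {r \<in> carrier R. \<exists>e. (r \<odot>\<^bsub>B\<^esub> b, e) \<in> G}"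
    define \<phi> where "\<phi> r = (THE e. (r \<odot>\<^bsub>B\<^esub> b, e) \<in> G)" for r
    have \<phi>_eq: "\<phi> r = e" if "(r \<odot>\<^bsub>B\<^esub> b, e) \<in> G" for r e
      unfolding \<phi>_def using that unique[OF _ that] by (rule the_equality)
    have \<phi>: "(r \<odot>\<^bsub>B\<^esub> b, \<phi> r) \<in> G" if "r \<in> I" for r
      using that \<phi>_eq by (auto simp: I_def)
    have add: "((r \<oplus>\<^bsub>R\<^esub> s) \<odot>\<^bsub>B\<^esub> b, \<phi> r \<oplus>\<^bsub>E\<^esub> \<phi> s) \<in> G" if "r \<in> I" "s \<in> I" for r s
      using mem(3)[OF \<phi>[OF that(1)] \<phi>[OF that(2)]] that b by (simp add: I_def B.smult_l_distr)
    have mult: "((r \<otimes>\<^bsub>R\<^esub> s) \<odot>\<^bsub>B\<^esub> b, r \<odot>\<^bsub>E\<^esub> \<phi> s) \<in> G" if "r \<in> carrier R" "s \<in> I" for r s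
      using mem(4)[OF that(1) \<phi>[OF that(2)]] that b by (simp add: I_def B.smult_assoc1)
    have "ideal I R"
    proof (rule A.R.ideal_introI)
      show "\<zero>\<^bsub>R\<^esub> \<in> I" using zero b by (auto simp: I_def)
      show "r \<oplus>\<^bsub>R\<^esub> s \<in> I" if "r \<in> I" "s \<in> I" for r s using add[OF that] that by (auto simp: I_def)
      show "r \<otimes>\<^bsub>R\<^esub> s \<in> I" if "r \<in> carrier R" "s \<in> I" for r s using mult[OF that] that by (auto simp: I_def)
    qed (auto simp: I_def)
    moreover have "E.ideal_hom I \<phi>"
    proof (rule E.ideal_homI)
      show "\<phi> r \<in> carrier E" if "r \<in> I" for r using mem(2) \<phi>[OF that] by blast
      show "\<phi> (r \<oplus>\<^bsub>R\<^esub> s) = \<phi> r \<oplus>\<^bsub>E\<^esub> \<phi> s" if "r \<in> I" "s \<in> I" for r s using \<phi>_eq add[OF that] by blast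
      show "\<phi> (r \<otimes>\<^bsub>R\<^esub> s) = r \<odot>\<^bsub>E\<^esub> \<phi> s" if "r \<in> carrier R" "s \<in> I" for r s using \<phi>_eq mult[OF that] by blast
    qed
    ultimately obtain e0 where e0: "e0 \<in> carrier E" "\<And>r. r \<in> I \<Longrightarrow> \<phi> r = r \<odot>\<^bsub>E\<^esub> e0"
      using ext unfolding E.extends_to_ring_def by blast
    define G' where "G' = {(d \<oplus>\<^bsub>B\<^esub> r \<odot>\<^bsub>B\<^esub> b, e \<oplus>\<^bsub>E\<^esub> r \<odot>\<^bsub>E\<^esub> e0) |d e r. (d, e) \<in> G \<and> r \<in> carrier R}"
    have G'I: "(x, y) \<in> G'"
      if "(d, e) \<in> G" "r \<in> carrier R" "x = d \<oplus>\<^bsub>B\<^esub> r \<odot>\<^bsub>B\<^esub> b" "y = e \<oplus>\<^bsub>E\<^esub> r \<odot>\<^bsub>E\<^esub> e0" for x y d e r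
      using that by (auto simp: G'_def)
    have "hom_graph R B E G'"
      unfolding hom_graph_def
    proof (intro conjI allI impI ballI)
      show "G' \<subseteq> carrier B \<times> carrier E" using mem(1,2) b e0(1) by (auto simp: G'_def)
      show "(x \<oplus>\<^bsub>B\<^esub> x', y \<oplus>\<^bsub>E\<^esub> y') \<in> G'" if xy: "(x, y) \<in> G'" "(x', y') \<in> G'" for x y x' y'
      proof -
        obtain d e r where d: "(d, e) \<in> G" "r \<in> carrier R" "x = d \<oplus>\<^bsub>B\<^esub> r \<odot>\<^bsub>B\<^esub> b" "y = e \<oplus>\<^bsub>E\<^esub> r \<odot>\<^bsub>E\<^esub> e0"
          using xy(1) by (auto simp: G'_def)
        obtain d' e' r' where d': "(d', e') \<in> G" "r' \<in> carrier R" "x' = d' \<oplus>\<^bsub>B\<^esub> r' \<odot>\<^bsub>B\<^esub> b" "y' = e' \<oplus>\<^bsub>E\<^esub> r' \<odot>\<^bsub>E\<^esub> e0"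
          using xy(2) by (auto simp: G'_def)
        have c: "d \<in> carrier B" "e \<in> carrier E" "d' \<in> carrier B" "e' \<in> carrier E" using mem(1,2) d(1) d'(1) by auto
        show ?thesis
          by (rule G'I[OF mem(3)[OF d(1) d'(1)], of "r \<oplus>\<^bsub>R\<^esub> r'"])
            (use c d d' b e0(1) in \<open>simp_all add: B.smult_l_distr E.smult_l_distr B.M.a_ac E.M.a_ac\<close>)
      qed
      show "(s \<odot>\<^bsub>B\<^esub> x, s \<odot>\<^bsub>E\<^esub> y) \<in> G'" if s: "s \<in> carrier R" and xy: "(x, y) \<in> G'" for s x y
      proof -
        obtain d e r where d: "(d, e) \<in> G" "r \<in> carrier R" "x = d \<oplus>\<^bsub>B\<^esub> r \<odot>\<^bsub>B\<^esub> b" "y = e \<oplus>\<^bsub>E\<^esub> r \<odot>\<^bsub>E\<^esub> e0"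
          using xy by (auto simp: G'_def)
        have c: "d \<in> carrier B" "e \<in> carrier E" using mem(1,2) d(1) by auto
        show ?thesis
          by (rule G'I[OF mem(4)[OF s d(1)], of "s \<otimes>\<^bsub>R\<^esub> r"])
            (use c d s b e0(1) in \<open>simp_all add: B.smult_r_distr E.smult_r_distr B.smult_assoc1 E.smult_assoc1\<close>)
      qed
      \<comment> \<open>If d + rb = 0, then rb = -d already has the value -e, so r lies in I and r
        e0 = -e, which cancels e.\<close>
      show "y = \<zero>\<^bsub>E\<^esub>" if xy: "(\<zero>\<^bsub>B\<^esub>, y) \<in> G'" for y
      proof -
        obtain d e r where d: "(d, e) \<in> G" "r \<in> carrier R" "\<zero>\<^bsub>B\<^esub> = d \<oplus>\<^bsub>B\<^esub> r \<odot>\<^bsub>B\<^esub> b" "y = e \<oplus>\<^bsub>E\<^esub> r \<odot>\<^bsub>E\<^esub> e0"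
          using xy by (auto simp: G'_def)
        have c: "d \<in> carrier B" "e \<in> carrier E" using mem(1,2) d(1) by auto
        have "r \<odot>\<^bsub>B\<^esub> b = \<ominus>\<^bsub>B\<^esub> d"
          using c d(2,3) b B.M.minus_equality[of "r \<odot>\<^bsub>B\<^esub> b" d] by (simp add: B.M.a_comm)
        then have "(r \<odot>\<^bsub>B\<^esub> b, \<ominus>\<^bsub>E\<^esub> e) \<in> G"
          using mem(4)[OF _ d(1), of "\<ominus>\<^bsub>R\<^esub> \<one>\<^bsub>R\<^esub>"] c by (simp add: module_minus_one[OF B] module_minus_one[OF E])
        then have "r \<in> I" "\<phi> r = \<ominus>\<^bsub>E\<^esub> e" using \<phi>_eq d(2) by (auto simp: I_def)
        then show ?thesis using e0(2) d(4) c by (metis E.M.r_neg)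
      qed
    qed
    moreover have GG': "G \<subseteq> G'"
    proof clarify
      fix d e assume "(d, e) \<in> G"
      then show "(d, e) \<in> G'" using mem(1,2) b e0(1) by (intro G'I[of d e "\<zero>\<^bsub>R\<^esub>"]) auto
    qed
    ultimately have "G' = G" using max G0 unfolding \<G>_def by blast
    moreover have "(b, e0) \<in> G'" using zero b e0(1) by (intro G'I[of "\<zero>\<^bsub>B\<^esub>" "\<zero>\<^bsub>E\<^esub>" "\<one>\<^bsub>R\<^esub>"]) auto
    ultimately show ?thesis by blast
  qed
  define g where "g = (\<lambda>b\<in>carrier B. THE e. (b, e) \<in> G)"
  have g_eq: "g b = e" if "(b, e) \<in> G" for b e
  proof -
    have "(THE e. (b, e) \<in> G) = e" using that unique[OF _ that] by (rule the_equality)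
    then show ?thesis using mem(1)[OF that] by (simp add: g_def)
  qed
  have g: "(b, g b) \<in> G" if "b \<in> carrier B" for b
    using total[OF that] g_eq by auto
  have "g \<in> module_hom R B E"
  proof (rule module_homI)
    show "g x \<in> carrier E" if "x \<in> carrier B" for x using mem(2) g[OF that] by blast
    show "g (x \<oplus>\<^bsub>B\<^esub> y) = g x \<oplus>\<^bsub>E\<^esub> g y" if "x \<in> carrier B" "y \<in> carrier B" for x y
      using g_eq mem(3) g[OF that(1)] g[OF that(2)] by blast
    show "g (r \<odot>\<^bsub>B\<^esub> x) = r \<odot>\<^bsub>E\<^esub> g x" if "r \<in> carrier R" "x \<in> carrier B" for r x
      using g_eq mem(4)[OF that(1)] g[OF that(2)] by blast
  qed (simp add: g_def)
  moreover have "g (i x) = f x" if "x \<in> carrier A" for x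
    using g_eq G0 that by (auto simp: G0_def)
  ultimately show "\<exists>g\<in>module_hom R B E. \<forall>x\<in>carrier A. g (i x) = f x" by blast
qed

section \<open>Free covers and the first Ext module\<close>

text \<open>\<open>cover_map\<close> is the case in which g is the identity on the carrier. General
  values on the basis are needed to lift the cover of R/J to R.\<close>

definition free_lift ::
  "('a, 'r) ring_scheme \<Rightarrow> 'b set \<Rightarrow> ('a, 'c, 'm) module_scheme \<Rightarrow> ('b \<Rightarrow> 'c) \<Rightarrow> ('b \<Rightarrow> 'a) \<Rightarrow> 'c"
  where
  "free_lift R A M g =
    (\<lambda>f\<in>carrier (free_module R A). \<Oplus>\<^bsub>M\<^esub>x\<in>{x. f x \<noteq> \<zero>\<^bsub>R\<^esub>}. f x \<odot>\<^bsub>M\<^esub> g x)"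

definition free_basis :: "('a, 'r) ring_scheme \<Rightarrow> 'b \<Rightarrow> 'b \<Rightarrow> 'a" where
  "free_basis R x = (\<lambda>y. if y = x then \<one>\<^bsub>R\<^esub> else \<zero>\<^bsub>R\<^esub>)"

lemma cover_map_eq_free_lift: "cover_map R M = free_lift R (carrier M) M (\<lambda>x. x)"
  by (simp add: cover_map_def free_lift_def free_cover_def)

lemma free_module_simps:
  "carrier (free_module R A) =
    {f. f \<in> A \<rightarrow> carrier R \<and> (\<forall>x. x \<notin> A \<longrightarrow> f x = \<zero>\<^bsub>R\<^esub>) \<and> finite {x. f x \<noteq> \<zero>\<^bsub>R\<^esub>}}"
  "\<zero>\<^bsub>free_module R A\<^esub> = (\<lambda>_. \<zero>\<^bsub>R\<^esub>)"
  "f \<oplus>\<^bsub>free_module R A\<^esub> g = (\<lambda>x. f x \<oplus>\<^bsub>R\<^esub> g x)"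
  "r \<odot>\<^bsub>free_module R A\<^esub> f = (\<lambda>x. r \<otimes>\<^bsub>R\<^esub> f x)"
  by (simp_all add: free_module_def)

section \<open>Free modules\<close>

context cring
begin

lemma free_module_value_closed: "f \<in> carrier (free_module R A) \<Longrightarrow> f x \<in> carrier R"
  by (cases "x \<in> A") (auto simp: free_module_simps)

lemma free_module_support:
  "f \<in> carrier (free_module R A) \<Longrightarrow> finite {x. f x \<noteq> \<zero>} \<and> {x. f x \<noteq> \<zero>} \<subseteq> A"
  by (auto simp: free_module_simps)

lemma free_module_add_closed:
  assumes "f \<in> carrier (free_module R A)" "g \<in> carrier (free_module R A)"
  shows "(\<lambda>x. f x \<oplus> g x) \<in> carrier (free_module R A)"
proof -
  have "{x. f x \<oplus> g x \<noteq> \<zero>} \<subseteq> {x. f x \<noteq> \<zero>} \<union> {x. g x \<noteq> \<zero>}" by auto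
  then have "finite {x. f x \<oplus> g x \<noteq> \<zero>}"
    by (rule finite_subset) (use assms in \<open>simp add: free_module_simps\<close>)
  then show ?thesis using assms by (auto simp: free_module_simps)
qed

lemma free_module_smult_closed:
  assumes "r \<in> carrier R" "f \<in> carrier (free_module R A)"
  shows "(\<lambda>x. r \<otimes> f x) \<in> carrier (free_module R A)"
proof -
  have "{x. r \<otimes> f x \<noteq> \<zero>} \<subseteq> {x. f x \<noteq> \<zero>}" using assms by auto
  then have "finite {x. r \<otimes> f x \<noteq> \<zero>}"
    by (rule finite_subset) (use assms in \<open>simp add: free_module_simps\<close>)
  then show ?thesis using assms by (auto simp: free_module_simps)
qed

lemma module_free_module: "module R (free_module R A)"
proof (rule moduleI)
  note val = free_module_value_closed
  show "cring R" by (rule cring_axioms)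
  show "abelian_group (free_module R A)"
  proof (rule abelian_groupI)
    fix f assume f: "f \<in> carrier (free_module R A)"
    show "\<exists>g\<in>carrier (free_module R A). g \<oplus>\<^bsub>free_module R A\<^esub> f = \<zero>\<^bsub>free_module R A\<^esub>"
    proof (rule bexI)
      show "(\<lambda>x. (\<ominus> \<one>) \<otimes> f x) \<oplus>\<^bsub>free_module R A\<^esub> f = \<zero>\<^bsub>free_module R A\<^esub>"
        using val[OF f] by (simp add: free_module_simps l_minus l_neg)
      show "(\<lambda>x. (\<ominus> \<one>) \<otimes> f x) \<in> carrier (free_module R A)"
        using free_module_smult_closed[OF _ f] by simp
    qed
    show "\<zero>\<^bsub>free_module R A\<^esub> \<oplus>\<^bsub>free_module R A\<^esub> f = f" using val[OF f] by (simp add: free_module_simps)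
    fix g assume g: "g \<in> carrier (free_module R A)"
    show "f \<oplus>\<^bsub>free_module R A\<^esub> g \<in> carrier (free_module R A)"
      using free_module_add_closed[OF f g] by (simp add: free_module_simps(3))
    show "f \<oplus>\<^bsub>free_module R A\<^esub> g = g \<oplus>\<^bsub>free_module R A\<^esub> f"
      using val[OF f] val[OF g] by (simp add: free_module_simps(3) a_comm)
    fix h assume h: "h \<in> carrier (free_module R A)"
    show "f \<oplus>\<^bsub>free_module R A\<^esub> g \<oplus>\<^bsub>free_module R A\<^esub> h = f \<oplus>\<^bsub>free_module R A\<^esub> (g \<oplus>\<^bsub>free_module R A\<^esub> h)"
      using val[OF f] val[OF g] val[OF h] by (simp add: free_module_simps(3) a_assoc)
  qed (simp add: free_module_simps)
  fix f r assume r: "r \<in> carrier R" and f: "f \<in> carrier (free_module R A)"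
  show "r \<odot>\<^bsub>free_module R A\<^esub> f \<in> carrier (free_module R A)"
    using free_module_smult_closed[OF r f] by (simp add: free_module_simps(4))
  show "(r \<oplus> s) \<odot>\<^bsub>free_module R A\<^esub> f = r \<odot>\<^bsub>free_module R A\<^esub> f \<oplus>\<^bsub>free_module R A\<^esub> s \<odot>\<^bsub>free_module R A\<^esub> f"
    if "s \<in> carrier R" for s
    using r that val[OF f] by (simp add: free_module_simps l_distr)
  show "(r \<otimes> s) \<odot>\<^bsub>free_module R A\<^esub> f = r \<odot>\<^bsub>free_module R A\<^esub> (s \<odot>\<^bsub>free_module R A\<^esub> f)"
    if "s \<in> carrier R" for s
    using r that val[OF f] by (simp add: free_module_simps m_assoc)
  show "r \<odot>\<^bsub>free_module R A\<^esub> (f \<oplus>\<^bsub>free_module R A\<^esub> g)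
      = r \<odot>\<^bsub>free_module R A\<^esub> f \<oplus>\<^bsub>free_module R A\<^esub> r \<odot>\<^bsub>free_module R A\<^esub> g"
    if "g \<in> carrier (free_module R A)" for g
    using r val[OF f] val[OF that] by (simp add: free_module_simps r_distr)
next
  fix f assume f: "f \<in> carrier (free_module R A)"
  show "\<one> \<odot>\<^bsub>free_module R A\<^esub> f = f" using free_module_value_closed[OF f] by (simp add: free_module_simps)
qed

lemma free_basis_closed: "x \<in> A \<Longrightarrow> free_basis R x \<in> carrier (free_module R A)"
  by (auto simp: free_module_simps free_basis_def)

end

section \<open>Maps out of free modules, and syzygies\<close>

context module
begin

text \<open>Summing over any finite superset of the support puts the values at f, h and f + h over
  one index set.\<close>

lemma free_lift_eq:
  assumes "f \<in> carrier (free_module R A)" and S: "finite S" "{x. f x \<noteq> \<zero>} \<subseteq> S" "S \<subseteq> A"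
    and g: "g \<in> A \<rightarrow> carrier M"
  shows "free_lift R A M g f = (\<Oplus>\<^bsub>M\<^esub>x\<in>S. f x \<odot>\<^bsub>M\<^esub> g x)"
proof -
  have "(\<Oplus>\<^bsub>M\<^esub>x\<in>{x. f x \<noteq> \<zero>}. f x \<odot>\<^bsub>M\<^esub> g x) = (\<Oplus>\<^bsub>M\<^esub>x\<in>S. f x \<odot>\<^bsub>M\<^esub> g x)"
    using S g R.free_module_value_closed[OF assms(1)]
    by (intro M.add.finprod_mono_neutral_cong_left) (auto simp: Pi_def subset_iff)
  then show ?thesis using assms(1) by (simp add: free_lift_def)
qed

lemma free_lift_hom:
  assumes g: "g \<in> A \<rightarrow> carrier M"
  shows "free_lift R A M g \<in> module_hom R (free_module R A) M"
proof (rule module_homI)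
  note val = R.free_module_value_closed and supp = R.free_module_support
  interpret F: module R "free_module R A" by (rule R.module_free_module)
  fix f assume f: "f \<in> carrier (free_module R A)"
  have term_closed: "(\<lambda>x. f x \<odot>\<^bsub>M\<^esub> g x) \<in> S \<rightarrow> carrier M" if "S \<subseteq> A" "f \<in> carrier (free_module R A)" for f S
    using that val[OF that(2)] g by auto
  let ?S = "{x. f x \<noteq> \<zero>}"
  show "free_lift R A M g f \<in> carrier M"
    using supp[OF f] free_lift_eq[OF f _ _ _ g, of ?S] term_closed[OF _ f, of ?S] by (simp add: M.finsum_closed)
  show "free_lift R A M g (f \<oplus>\<^bsub>free_module R A\<^esub> h) = free_lift R A M g f \<oplus>\<^bsub>M\<^esub> free_lift R A M g h"
    if h: "h \<in> carrier (free_module R A)" for h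
  proof -
    define S where "S = ?S \<union> {x. h x \<noteq> \<zero>}"
    have S: "finite S" "S \<subseteq> A" "?S \<subseteq> S" "{x. h x \<noteq> \<zero>} \<subseteq> S" "{x. (f \<oplus>\<^bsub>free_module R A\<^esub> h) x \<noteq> \<zero>} \<subseteq> S"
      using supp[OF f] supp[OF h] by (auto simp: S_def free_module_simps(3))
    have fh: "f \<oplus>\<^bsub>free_module R A\<^esub> h \<in> carrier (free_module R A)" using f h by simp
    have "free_lift R A M g (f \<oplus>\<^bsub>free_module R A\<^esub> h) = (\<Oplus>\<^bsub>M\<^esub>x\<in>S. (f x \<oplus> h x) \<odot>\<^bsub>M\<^esub> g x)"
      using free_lift_eq[OF fh S(1,5,2) g] by (simp add: free_module_simps(3))
    also have "\<dots> = (\<Oplus>\<^bsub>M\<^esub>x\<in>S. f x \<odot>\<^bsub>M\<^esub> g x \<oplus>\<^bsub>M\<^esub> h x \<odot>\<^bsub>M\<^esub> g x)"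
      using val[OF f] val[OF h] g S(2) by (intro M.finsum_cong') (auto simp: smult_l_distr Pi_def subset_iff)
    also have "\<dots> = (\<Oplus>\<^bsub>M\<^esub>x\<in>S. f x \<odot>\<^bsub>M\<^esub> g x) \<oplus>\<^bsub>M\<^esub> (\<Oplus>\<^bsub>M\<^esub>x\<in>S. h x \<odot>\<^bsub>M\<^esub> g x)"
      by (rule M.finsum_addf[OF term_closed[OF S(2) f] term_closed[OF S(2) h]])
    finally show ?thesis using free_lift_eq[OF f S(1,3,2) g] free_lift_eq[OF h S(1,4,2) g] by simp
  qed
  show "free_lift R A M g (r \<odot>\<^bsub>free_module R A\<^esub> f) = r \<odot>\<^bsub>M\<^esub> free_lift R A M g f" if r: "r \<in> carrier R" for r
  proof -
    have S: "finite ?S" "?S \<subseteq> A" "{x. (r \<odot>\<^bsub>free_module R A\<^esub> f) x \<noteq> \<zero>} \<subseteq> ?S"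
      using supp[OF f] r by (auto simp: free_module_simps(4))
    have rf: "r \<odot>\<^bsub>free_module R A\<^esub> f \<in> carrier (free_module R A)" using r f by simp
    have "free_lift R A M g (r \<odot>\<^bsub>free_module R A\<^esub> f) = (\<Oplus>\<^bsub>M\<^esub>x\<in>?S. (r \<otimes> f x) \<odot>\<^bsub>M\<^esub> g x)"
      using free_lift_eq[OF rf S(1,3,2) g] by (simp add: free_module_simps(4))
    also have "\<dots> = (\<Oplus>\<^bsub>M\<^esub>x\<in>?S. r \<odot>\<^bsub>M\<^esub> (f x \<odot>\<^bsub>M\<^esub> g x))"
      using val[OF f] r g S(2) by (intro M.finsum_cong') (auto simp: smult_assoc1 Pi_def subset_iff)
    also have "\<dots> = r \<odot>\<^bsub>M\<^esub> (\<Oplus>\<^bsub>M\<^esub>x\<in>?S. f x \<odot>\<^bsub>M\<^esub> g x)"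
      using finsum_smult_ldistr[OF S(1) r term_closed[OF S(2) f]] by simp
    finally show ?thesis using free_lift_eq[OF f S(1) _ S(2) g] by simp
  qed
qed (simp add: free_lift_def)

lemma free_lift_basis:
  assumes g: "g \<in> A \<rightarrow> carrier M" and x: "x \<in> A"
  shows "free_lift R A M g (free_basis R x) = g x"
proof -
  have "free_lift R A M g (free_basis R x) = (\<Oplus>\<^bsub>M\<^esub>y\<in>{x}. free_basis R x y \<odot>\<^bsub>M\<^esub> g y)"
    using R.free_basis_closed[OF x] x g by (intro free_lift_eq) (auto simp: free_basis_def)
  then show ?thesis using g x by (auto simp: free_basis_def Pi_def)
qed

lemma hom_finsum:
  assumes N: "module R N" and k: "k \<in> module_hom R M N" and "finite S" "p \<in> S \<rightarrow> carrier M"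
  shows "k (\<Oplus>\<^bsub>M\<^esub>x\<in>S. p x) = (\<Oplus>\<^bsub>N\<^esub>x\<in>S. k (p x))"
proof -
  interpret N: module R N by (rule N)
  show ?thesis
    using assms(3,4)
  proof (induction S rule: finite_induct)
    case empty
    then show ?case using module_hom_zero[OF module_axioms N k] by simp
  next
    case (insert x S)
    then have p: "p x \<in> carrier M" "p \<in> S \<rightarrow> carrier M" by auto
    then have "(\<lambda>x. k (p x)) \<in> S \<rightarrow> carrier N" "k (p x) \<in> carrier N" using module_homD(1)[OF k] by auto
    then show ?case
      using insert p module_homD(2)[OF k p(1) M.finsum_closed[OF p(2)]]
      by (simp add: M.finsum_insert N.M.finsum_insert)
  qed
qed

lemma hom_free_lift:
  assumes N: "module R N" and k: "k \<in> module_hom R M N" and g: "g \<in> A \<rightarrow> carrier M"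
    and f: "f \<in> carrier (free_module R A)"
  shows "k (free_lift R A M g f) = free_lift R A N (\<lambda>x. k (g x)) f"
proof -
  interpret N: module R N by (rule N)
  let ?S = "{x. f x \<noteq> \<zero>}"
  have S: "finite ?S" "?S \<subseteq> A" using R.free_module_support[OF f] by auto
  note val = R.free_module_value_closed[OF f]
  have kg: "(\<lambda>x. k (g x)) \<in> A \<rightarrow> carrier N" using module_homD(1)[OF k] g by auto
  have "k (free_lift R A M g f) = k (\<Oplus>\<^bsub>M\<^esub>x\<in>?S. f x \<odot>\<^bsub>M\<^esub> g x)" using f by (simp add: free_lift_def)
  also have "\<dots> = (\<Oplus>\<^bsub>N\<^esub>x\<in>?S. k (f x \<odot>\<^bsub>M\<^esub> g x))"
    using val g S by (intro hom_finsum[OF N k]) auto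
  also have "\<dots> = (\<Oplus>\<^bsub>N\<^esub>x\<in>?S. f x \<odot>\<^bsub>N\<^esub> k (g x))"
    using val g S kg module_homD(3)[OF k] by (intro N.M.finsum_cong') (auto simp: Pi_def subset_iff)
  also have "\<dots> = free_lift R A N (\<lambda>x. k (g x)) f" using f by (simp add: free_lift_def)
  finally show ?thesis .
qed

lemma cover_map_hom: "cover_map R M \<in> module_hom R (free_cover R M) M"
  unfolding cover_map_eq_free_lift free_cover_def by (rule free_lift_hom) simp

lemma cover_map_basis: "x \<in> carrier M \<Longrightarrow> cover_map R M (free_basis R x) = x"
  unfolding cover_map_eq_free_lift by (rule free_lift_basis) simp_all

lemma module_syzygy: "module R (syzygy R M)"
proof -
  interpret F: module R "free_cover R M" unfolding free_cover_def by (rule R.module_free_module)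
  note d = module_homD[OF cover_map_hom]
  have "submodule (a_kernel (free_cover R M) M (cover_map R M)) R (free_cover R M)"
    unfolding a_kernel_def'
  proof (rule F.submoduleI)
    fix v assume v: "v \<in> {v \<in> carrier (free_cover R M). cover_map R M v = \<zero>\<^bsub>M\<^esub>}"
    have "cover_map R M (\<ominus>\<^bsub>free_cover R M\<^esub> v) = (\<ominus> \<one>) \<odot>\<^bsub>M\<^esub> cover_map R M v"
      using d(3)[of "\<ominus> \<one>" v] v module_minus_one[OF F.module_axioms, of v] by auto
    then show "\<ominus>\<^bsub>free_cover R M\<^esub> v \<in> {v \<in> carrier (free_cover R M). cover_map R M v = \<zero>\<^bsub>M\<^esub>}"
      using v by simp
  qed (use d module_hom_zero[OF F.module_axioms module_axioms cover_map_hom] in auto)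
  then show ?thesis unfolding syzygy_def by (rule submodule.submodule_is_module[OF _ F.module_axioms])
qed

lemma syzygy_simps:
  "carrier (syzygy R M) = {v \<in> carrier (free_cover R M). cover_map R M v = \<zero>\<^bsub>M\<^esub>}"
  "add (syzygy R M) = add (free_cover R M)" "smult (syzygy R M) = smult (free_cover R M)"
  "zero (syzygy R M) = zero (free_cover R M)"
  by (simp_all add: syzygy_def a_kernel_def')

text \<open>
  \<open>0 \<rightarrow> K \<rightarrow> F\<^sub>0 \<rightarrow> M \<rightarrow> 0\<close> identifies \<open>Ext\<^sup>1(M, E)\<close> with the homomorphisms \<open>K \<rightarrow> E\<close> modulo those
  that extend to \<open>F\<^sub>0\<close>: the cocycle of \<open>h\<close> is \<open>h \<circ> d\<^sub>1\<close>.
\<close>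

lemma hom_syzygy_extends:
  assumes E: "module R E" and Ext: "carrier (Ext1 R M E) = {\<zero>\<^bsub>Ext1 R M E\<^esub>}"
    and h: "h \<in> module_hom R (syzygy R M) E"
  shows "\<exists>\<psi>\<in>module_hom R (free_cover R M) E. \<forall>v\<in>carrier (syzygy R M). \<psi> v = h v"
proof -
  define K where "K = syzygy R M"
  interpret E: module R E by (rule E)
  interpret K: module R K unfolding K_def by (rule module_syzygy)
  interpret L: module R "syzygy R K" by (rule K.module_syzygy)
  interpret F1: module R "free_cover R K" unfolding free_cover_def by (rule R.module_free_module)
  note d1 = module_homD[OF K.cover_map_hom] and d2 = module_homD[OF L.cover_map_hom]
  define \<phi> where "\<phi> = compose (carrier (free_cover R K)) h (cover_map R K)"
  have hK: "h \<in> module_hom R K E" using h by (simp add: K_def)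
  note hD = module_homD[OF hK]
  have \<phi>: "\<phi> v = h (cover_map R K v)" if "v \<in> carrier (free_cover R K)" for v
    using that by (simp add: \<phi>_def compose_def)
  have \<phi>_hom: "\<phi> \<in> module_hom R (free_cover R K) E"
    by (rule module_homI) (use \<phi> hD d1 in \<open>auto simp: \<phi>_def compose_def\<close>)
  have "compose (carrier (free_cover R (syzygy R K))) \<phi> (cover_map R (syzygy R K)) v
      = \<zero>\<^bsub>hom_module R (free_cover R (syzygy R K)) E\<^esub> v" for v
  proof (cases "v \<in> carrier (free_cover R (syzygy R K))")
    case True
    have "cover_map R (syzygy R K) v \<in> carrier (syzygy R K)" using d2(1)[OF True] .
    then have "cover_map R (syzygy R K) v \<in> carrier (free_cover R K)"
      "cover_map R K (cover_map R (syzygy R K) v) = \<zero>\<^bsub>K\<^esub>" by (auto simp: K.syzygy_simps)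
    then show ?thesis
      using True \<phi> module_hom_zero[OF K.module_axioms E hK] by (simp add: compose_def hom_module_def)
  qed (simp add: compose_def hom_module_def)
  then have cocycle: "\<phi> \<in> Ext1_cocycles R M E"
    using \<phi>_hom by (auto simp: Ext1_cocycles_def Let_def K_def)
  define C where "C = (hom_module R (free_cover R K) E)\<lparr>carrier := Ext1_cocycles R M E\<rparr>"
  define N where "N = Ext1_coboundaries R M E"
  have Ext_eq: "Ext1 R M E = quotient_module C N" by (simp add: Ext1_def C_def N_def K_def)
  have "N +>\<^bsub>C\<^esub> \<phi> \<in> carrier (Ext1 R M E)"
    using cocycle by (auto simp: Ext_eq quotient_module_def A_RCOSETS_def' C_def)
  then have NN: "N +>\<^bsub>C\<^esub> \<phi> = N" using Ext by (simp add: Ext_eq quotient_module_def)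
  \<comment> \<open>The zero cochain is a coboundary, so \<phi> belongs to its own coset, which is N
    because Ext vanishes.\<close>
  have "\<phi> \<in> N"
  proof -
    define z where "z = (\<lambda>v\<in>carrier (free_cover R K). \<zero>\<^bsub>E\<^esub>)"
    have "(\<lambda>v\<in>carrier (free_cover R M). \<zero>\<^bsub>E\<^esub>) \<in> module_hom R (free_cover R M) E"
    proof -
      interpret F0: module R "free_cover R M" unfolding free_cover_def by (rule R.module_free_module)
      show ?thesis by (rule module_homI) auto
    qed
    moreover have "compose (carrier (free_cover R K)) (\<lambda>v\<in>carrier (free_cover R M). \<zero>\<^bsub>E\<^esub>) (cover_map R K) = z"
      using d1(1) by (auto simp: compose_def z_def fun_eq_iff syzygy_simps K_def)
    ultimately have "z \<in> N" unfolding N_def Ext1_coboundaries_def Let_def K_def[symmetric] by (metis imageI)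
    moreover have "z \<oplus>\<^bsub>C\<^esub> \<phi> = \<phi>"
      using module_homD(1,4)[OF \<phi>_hom] by (auto simp: C_def hom_module_def z_def fun_eq_iff)
    ultimately have "\<phi> \<in> N +>\<^bsub>C\<^esub> \<phi>" unfolding a_r_coset_def' by force
    then show ?thesis using NN by simp
  qed
  then obtain \<psi> where \<psi>: "\<psi> \<in> module_hom R (free_cover R M) E"
    "\<phi> = compose (carrier (free_cover R K)) \<psi> (cover_map R K)"
    by (auto simp: N_def Ext1_coboundaries_def Let_def K_def)
  \<comment> \<open>The differential sends the basis vector of v to v, so the equality of cochains
    on basis vectors is equality of \<psi> and h on the syzygy.\<close>
  have "\<psi> v = h v" if v: "v \<in> carrier K" for v
  proof -
    have b: "free_basis R v \<in> carrier (free_cover R K)"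
      unfolding free_cover_def by (rule R.free_basis_closed[OF v])
    then have "\<phi> (free_basis R v) = \<psi> v" using K.cover_map_basis[OF v] by (simp add: \<psi>(2) compose_def)
    then show ?thesis using \<phi>[OF b] K.cover_map_basis[OF v] by simp
  qed
  then show ?thesis using \<psi>(1) by (auto simp: K_def)
qed

end

section \<open>Cyclic modules\<close>

context ideal
begin

abbreviation quot :: "('a, 'a set) module" where
  "quot \<equiv> quotient_module (ring_as_module R) I"

lemma coset_eq_iff:
  assumes "x \<in> carrier R" "y \<in> carrier R"
  shows "I +> x = I +> y \<longleftrightarrow> x \<ominus> y \<in> I"
  using quotient_eq_iff_same_a_r_cos[OF is_ideal assms] by simp

lemma coset_eq_self_iff: "x \<in> carrier R \<Longrightarrow> I +> x = I \<longleftrightarrow> x \<in> I"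
  using a_rcos_zero[OF is_ideal] rcos_const_imp_mem by blast

lemma quot_carrier: "carrier quot = {I +> x |x. x \<in> carrier R}"
  by (auto simp: quotient_module_def A_RCOSETS_def' ring_as_module_def a_r_coset_def')

lemma quotE:
  assumes "X \<in> carrier quot" obtains x where "x \<in> carrier R" "X = I +> x"
  using assms by (auto simp: quot_carrier)

lemma quot_zero: "\<zero>\<^bsub>quot\<^esub> = I"
  by (simp add: quotient_module_def)

lemma quot_add:
  assumes "x \<in> carrier R" "y \<in> carrier R"
  shows "(I +> x) \<oplus>\<^bsub>quot\<^esub> (I +> y) = I +> (x \<oplus> y)"
proof -
  have "(I +> x) \<oplus>\<^bsub>quot\<^esub> (I +> y) = (I +> x) <+> (I +> y)"
    by (simp add: quotient_module_def set_add_def' ring_as_module_def)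
  then show ?thesis using a_rcos_sum[OF assms] by simp
qed

lemma quot_smult:
  assumes r: "r \<in> carrier R" and x: "x \<in> carrier R"
  shows "r \<odot>\<^bsub>quot\<^esub> (I +> x) = I +> (r \<otimes> x)"
proof -
  have "I +> (r \<otimes> y) = I +> (r \<otimes> x)" if y: "y \<in> I +> x" for y
  proof -
    obtain j where j: "j \<in> I" "y = j \<oplus> x" using y by (auto simp: a_r_coset_def')
    have jc: "j \<in> carrier R" using j(1) Icarr by blast
    have "r \<otimes> y \<ominus> r \<otimes> x = r \<otimes> j" unfolding j(2) using r x jc by algebra
    then show ?thesis using coset_eq_iff[of "r \<otimes> y" "r \<otimes> x"] I_l_closed[OF j(1) r] r x jc j(2) by simp
  qed
  moreover have "x \<in> I +> x" using a_rcos_self[OF x] .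
  ultimately have "(\<Union>y\<in>I +> x. I +> (r \<otimes> y)) = I +> (r \<otimes> x)" by blast
  then show ?thesis
    by (simp add: quotient_module_def ring_as_module_def a_r_coset_def')
qed

end

context cring
begin

lemma module_ring_as_module: "module R (ring_as_module R)"
proof (rule moduleI)
  show "abelian_group (ring_as_module R)"
  proof (rule abelian_groupI)
    show "\<exists>y\<in>carrier (ring_as_module R). y \<oplus>\<^bsub>ring_as_module R\<^esub> x = \<zero>\<^bsub>ring_as_module R\<^esub>"
      if "x \<in> carrier (ring_as_module R)" for x
      using that by (intro bexI[of _ "\<ominus> x"]) (simp_all add: ring_as_module_def l_neg)
  qed (simp_all add: ring_as_module_def a_ac)
qed (auto simp: ring_as_module_def cring_axioms l_distr r_distr m_assoc)

lemma module_quotient: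
  assumes J: "ideal J R" shows "module R (quotient_module (ring_as_module R) J)"
proof -
  interpret J: ideal J R by (rule J)
  note simps = J.quot_add J.quot_smult
  have zero: "\<zero>\<^bsub>J.quot\<^esub> = J +> \<zero>"
    using J.coset_eq_self_iff[OF zero_closed] ideal_zero_mem[OF J] by (simp add: J.quot_zero)
  show ?thesis
  proof (rule moduleI)
    show "cring R" by (rule cring_axioms)
    show "abelian_group J.quot"
    proof (rule abelian_groupI)
      show "\<exists>y\<in>carrier J.quot. y \<oplus>\<^bsub>J.quot\<^esub> x = \<zero>\<^bsub>J.quot\<^esub>" if "x \<in> carrier J.quot" for x
      proof -
        obtain a where a: "a \<in> carrier R" "x = J +> a" using \<open>x \<in> carrier J.quot\<close> by (rule J.quotE)
        then have "(J +> (\<ominus> a)) \<oplus>\<^bsub>J.quot\<^esub> x = \<zero>\<^bsub>J.quot\<^esub>" by (simp add: simps zero l_neg)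
        moreover have "J +> (\<ominus> a) \<in> carrier J.quot" using a(1) a_inv_closed unfolding J.quot_carrier by blast
        ultimately show ?thesis by blast
      qed
      show "\<zero>\<^bsub>J.quot\<^esub> \<in> carrier J.quot" unfolding zero by (auto simp: J.quot_carrier)
      show "\<zero>\<^bsub>J.quot\<^esub> \<oplus>\<^bsub>J.quot\<^esub> x = x" if "x \<in> carrier J.quot" for x
        using that unfolding zero by (auto simp: J.quot_carrier simps)
      show "x \<oplus>\<^bsub>J.quot\<^esub> y \<in> carrier J.quot" if "x \<in> carrier J.quot" "y \<in> carrier J.quot" for x y
        using that by (auto simp: J.quot_carrier simps)
      show "x \<oplus>\<^bsub>J.quot\<^esub> y = y \<oplus>\<^bsub>J.quot\<^esub> x" if "x \<in> carrier J.quot" "y \<in> carrier J.quot" for x y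
        using that by (auto simp: J.quot_carrier simps a_comm)
      show "x \<oplus>\<^bsub>J.quot\<^esub> y \<oplus>\<^bsub>J.quot\<^esub> z = x \<oplus>\<^bsub>J.quot\<^esub> (y \<oplus>\<^bsub>J.quot\<^esub> z)"
        if "x \<in> carrier J.quot" "y \<in> carrier J.quot" "z \<in> carrier J.quot" for x y z
        using that by (auto simp: J.quot_carrier simps a_assoc)
    qed
    fix r x assume r: "r \<in> carrier R" and x: "x \<in> carrier J.quot"
    obtain a where a: "a \<in> carrier R" "x = J +> a" using x by (rule J.quotE)
    show "r \<odot>\<^bsub>J.quot\<^esub> x \<in> carrier J.quot" using a r by (auto simp: J.quot_carrier simps)
    show "(r \<oplus> s) \<odot>\<^bsub>J.quot\<^esub> x = r \<odot>\<^bsub>J.quot\<^esub> x \<oplus>\<^bsub>J.quot\<^esub> s \<odot>\<^bsub>J.quot\<^esub> x" if "s \<in> carrier R" for s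
      using a r that by (simp add: simps l_distr)
    show "(r \<otimes> s) \<odot>\<^bsub>J.quot\<^esub> x = r \<odot>\<^bsub>J.quot\<^esub> (s \<odot>\<^bsub>J.quot\<^esub> x)" if "s \<in> carrier R" for s
      using a r that by (simp add: simps m_assoc)
    show "r \<odot>\<^bsub>J.quot\<^esub> (x \<oplus>\<^bsub>J.quot\<^esub> y) = r \<odot>\<^bsub>J.quot\<^esub> x \<oplus>\<^bsub>J.quot\<^esub> r \<odot>\<^bsub>J.quot\<^esub> y" if "y \<in> carrier J.quot" for y
    proof -
      obtain b where "b \<in> carrier R" "y = J +> b" using \<open>y \<in> carrier J.quot\<close> by (rule J.quotE)
      then show ?thesis using a r by (simp add: simps r_distr)
    qed
  next
    fix x assume "x \<in> carrier J.quot"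
    then show "\<one> \<odot>\<^bsub>J.quot\<^esub> x = x" by (auto simp: J.quot_carrier simps)
  qed
qed

lemma quotient_map_hom:
  assumes J: "ideal J R"
  shows "(\<lambda>x\<in>carrier R. J +> x) \<in> module_hom R (ring_as_module R) (quotient_module (ring_as_module R) J)"
proof -
  interpret J: ideal J R by (rule J)
  show ?thesis
    by (rule module_homI) (auto simp: ring_as_module_def[of R] J.quot_carrier[unfolded ring_as_module_def]
        J.quot_add[unfolded ring_as_module_def] J.quot_smult[unfolded ring_as_module_def])
qed

end

text \<open>The canonical cover of R/J has a basis vector for every coset, so it is compared with R
  by the map \<theta> that sends each basis vector to a chosen representative. Then f after \<theta>
  is a homomorphism on the syzygy, it extends to the cover because Ext vanishes, and the value of
  the extension \<psi> at the basis vector \<delta> of 1 + J yields e.\<close>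

lemma (in module) Ext1_quotient_trivial_imp_extends:
  assumes J: "ideal J R"
    and Ext: "carrier (Ext1 R (quotient_module (ring_as_module R) J) M) =
        {\<zero>\<^bsub>Ext1 R (quotient_module (ring_as_module R) J) M\<^esub>}"
  shows "extends_to_ring J"
  unfolding extends_to_ring_def
proof (intro allI impI)
  fix f assume f: "ideal_hom J f"
  interpret J: ideal J R by (rule J)
  define Q where "Q = J.quot"
  have Q0: "\<zero>\<^bsub>Q\<^esub> = J" by (simp add: Q_def J.quot_zero)
  interpret Q: module R Q unfolding Q_def by (rule R.module_quotient[OF J])
  interpret S: module R "ring_as_module R" by (rule R.module_ring_as_module)
  define \<pi> where "\<pi> = (\<lambda>x\<in>carrier R. J +>\<^bsub>R\<^esub> x)"
  have \<pi>: "\<pi> \<in> module_hom R (ring_as_module R) Q" unfolding \<pi>_def Q_def by (rule R.quotient_map_hom[OF J])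
  have "\<exists>x\<in>carrier R. \<pi> x = X" if "X \<in> carrier Q" for X
    using that by (auto simp: Q_def J.quot_carrier \<pi>_def)
  then obtain rep where rep: "\<And>X. X \<in> carrier Q \<Longrightarrow> rep X \<in> carrier R \<and> \<pi> (rep X) = X" by metis
  define \<theta> where "\<theta> = free_lift R (carrier Q) (ring_as_module R) rep"
  have rep': "rep \<in> carrier Q \<rightarrow> carrier (ring_as_module R)" using rep by (auto simp: ring_as_module_def)
  have \<theta>: "\<theta> \<in> module_hom R (free_cover R Q) (ring_as_module R)"
    unfolding \<theta>_def free_cover_def by (rule S.free_lift_hom[OF rep'])
  note \<theta>D = module_homD(1-3)[OF \<theta>, unfolded ring_as_module_def, simplified]
  have \<theta>_cover: "\<pi> (\<theta> v) = cover_map R Q v" if v: "v \<in> carrier (free_cover R Q)" for v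
  proof -
    have v': "v \<in> carrier (free_module R (carrier Q))" using v by (simp add: free_cover_def)
    have "\<pi> (\<theta> v) = free_lift R (carrier Q) Q (\<lambda>X. \<pi> (rep X)) v"
      unfolding \<theta>_def by (rule S.hom_free_lift[OF Q.module_axioms \<pi> rep' v'])
    also have "\<dots> = (\<Oplus>\<^bsub>Q\<^esub>X\<in>{X. v X \<noteq> \<zero>}. v X \<odot>\<^bsub>Q\<^esub> \<pi> (rep X))" using v' by (simp add: free_lift_def)
    also have "\<dots> = (\<Oplus>\<^bsub>Q\<^esub>X\<in>{X. v X \<noteq> \<zero>}. v X \<odot>\<^bsub>Q\<^esub> X)"
    proof (rule Q.M.finsum_cong')
      fix X assume "X \<in> {X. v X \<noteq> \<zero>}"
      then have "X \<in> carrier Q" using R.free_module_support[OF v'] by blast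
      then show "v X \<odot>\<^bsub>Q\<^esub> \<pi> (rep X) = v X \<odot>\<^bsub>Q\<^esub> X" using rep by simp
    qed (use R.free_module_support[OF v'] R.free_module_value_closed[OF v'] in auto)
    also have "\<dots> = cover_map R Q v" using v' by (simp add: cover_map_eq_free_lift free_lift_def)
    finally show ?thesis .
  qed
  \<comment> \<open>\<theta> followed by the projection is the cover map, which vanishes on the
    syzygy.\<close>
  have \<theta>J: "\<theta> v \<in> J" if "v \<in> carrier (syzygy R Q)" for v
  proof -
    have v: "v \<in> carrier (free_cover R Q)" "cover_map R Q v = J"
      using that by (auto simp: Q.syzygy_simps Q0)
    then have "J +>\<^bsub>R\<^esub> \<theta> v = J" using \<theta>_cover[OF v(1)] \<theta>D(1)[OF v(1)] by (simp add: \<pi>_def)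
    then show ?thesis using J.coset_eq_self_iff \<theta>D(1)[OF v(1)] by blast
  qed
  define h where "h = (\<lambda>v\<in>carrier (syzygy R Q). f (\<theta> v))"
  interpret K: module R "syzygy R Q" by (rule Q.module_syzygy)
  have Kc: "v \<in> carrier (free_cover R Q)" if "v \<in> carrier (syzygy R Q)" for v
    using that by (simp add: Q.syzygy_simps)
  have "h \<in> module_hom R (syzygy R Q) M"
  proof (rule module_homI)
    fix v assume v: "v \<in> carrier (syzygy R Q)"
    show "h v \<in> carrier M" using v \<theta>J[OF v] ideal_homD(1)[OF f] by (simp add: h_def)
    show "h (v \<oplus>\<^bsub>syzygy R Q\<^esub> w) = h v \<oplus>\<^bsub>M\<^esub> h w" if w: "w \<in> carrier (syzygy R Q)" for w
      using v w K.M.a_closed[OF v w] \<theta>D(2)[OF Kc[OF v] Kc[OF w]] ideal_homD(2)[OF f \<theta>J[OF v] \<theta>J[OF w]]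
      by (simp add: h_def Q.syzygy_simps(2))
    show "h (r \<odot>\<^bsub>syzygy R Q\<^esub> v) = r \<odot>\<^bsub>M\<^esub> h v" if r: "r \<in> carrier R" for r
      using v r K.smult_closed[OF r v] \<theta>D(3)[OF r Kc[OF v]] ideal_homD(3)[OF f r \<theta>J[OF v]]
      by (simp add: h_def Q.syzygy_simps(3))
  qed (simp add: h_def)
  then obtain \<psi> where \<psi>: "\<psi> \<in> module_hom R (free_cover R Q) M"
    "\<And>v. v \<in> carrier (syzygy R Q) \<Longrightarrow> \<psi> v = h v"
    using Q.hom_syzygy_extends[OF module_axioms Ext[folded Q_def]] by blast
  define X where "X = J +>\<^bsub>R\<^esub> \<one>"
  have X: "X \<in> carrier Q" by (auto simp: X_def Q_def J.quot_carrier)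
  define \<delta> where "\<delta> = free_basis R X"
  have \<delta>: "\<delta> \<in> carrier (free_cover R Q)" unfolding \<delta>_def free_cover_def by (rule R.free_basis_closed[OF X])
  \<comment> \<open>The representative chosen for 1 + J is 1 + j0 and need not be 1. For j \<in> J
    the vector j\<delta> is in the syzygy, and j\<psi>(\<delta>) = f(j + j j0) = f(j) + j f(j0);
    hence the correction by f(j0) in e.\<close>
  define j0 where "j0 = rep X \<ominus> \<one>"
  have rX: "rep X \<in> carrier R" using rep[OF X] by blast
  then have j0: "j0 \<in> J" using rep[OF X] J.coset_eq_iff[OF rX R.one_closed] by (simp add: j0_def \<pi>_def X_def)
  have \<theta>\<delta>: "\<theta> \<delta> = rep X" unfolding \<theta>_def \<delta>_def by (rule S.free_lift_basis[OF rep' X])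
  define e where "e = \<psi> \<delta> \<oplus>\<^bsub>M\<^esub> \<ominus>\<^bsub>M\<^esub> f j0"
  have c: "\<psi> \<delta> \<in> carrier M" "f j0 \<in> carrier M" using module_homD(1)[OF \<psi>(1) \<delta>] ideal_homD(1)[OF f j0] by auto
  have "f j = j \<odot>\<^bsub>M\<^esub> e" if j: "j \<in> J" for j
  proof -
    have jc: "j \<in> carrier R" and j0c: "j0 \<in> carrier R" using j j0 J.Icarr by auto
    have "cover_map R Q (j \<odot>\<^bsub>free_cover R Q\<^esub> \<delta>) = j \<odot>\<^bsub>Q\<^esub> X"
      using module_homD(3)[OF Q.cover_map_hom jc \<delta>] Q.cover_map_basis[OF X] by (simp add: \<delta>_def)
    also have "\<dots> = J" using J.quot_smult[OF jc R.one_closed] J.coset_eq_self_iff[OF jc] j jc by (simp add: Q_def X_def)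
    finally have "j \<odot>\<^bsub>free_cover R Q\<^esub> \<delta> \<in> carrier (syzygy R Q)"
      using R.module_free_module[of "carrier Q"] \<delta> jc
      by (simp add: Q.syzygy_simps Q0 free_cover_def module.smult_closed)
    then have "j \<odot>\<^bsub>M\<^esub> \<psi> \<delta> = f (j \<otimes> rep X)"
      using \<psi>(2) module_homD(3)[OF \<psi>(1) jc \<delta>] \<theta>D(3)[OF jc \<delta>] \<theta>\<delta> by (simp add: h_def)
    also have "j \<otimes> rep X = j \<oplus> j \<otimes> j0" unfolding j0_def using jc rX by algebra
    also have "f \<dots> = f j \<oplus>\<^bsub>M\<^esub> j \<odot>\<^bsub>M\<^esub> f j0"
      using ideal_homD(2)[OF f j R.ideal_mult_mem[OF J j0 jc]] ideal_homD(3)[OF f jc j0] by simp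
    finally show ?thesis
      using c jc ideal_homD(1)[OF f j] by (simp add: e_def smult_r_distr smult_r_minus M.a_assoc M.r_neg)
  qed
  then show "\<exists>e\<in>carrier M. \<forall>x\<in>J. f x = x \<odot>\<^bsub>M\<^esub> e" using c by (auto simp: e_def)
qed

context cring
begin

text \<open>\<open>reg_seq\<close> does not record that the generated ideal is proper; containment
  in a prime supplies this. The nonzerodivisor conditions are transferred from congruences modulo an
  ideal to cosets.\<close>

lemma reg_seq_imp_regular_sequence:
  assumes P: "primeideal P R" and xs: "set xs \<subseteq> P" "reg_seq {\<zero>} xs"
  shows "regular_sequence R xs"
  unfolding regular_sequence_def
proof (intro conjI allI impI)
  show xsc: "set xs \<subseteq> carrier R" using xs(1) primeideal_subset_carrier[OF P] by blast
  have "Idl (set xs) \<subseteq> P" by (rule genideal_minimal[OF primeideal.axioms(1)[OF P] xs(1)])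
  then show "Idl (set xs) \<noteq> carrier R" using primeideal_one_notin[OF P] by blast
  fix i assume i: "i < length xs"
  have tc: "set (take i xs) \<subseteq> carrier R" using xsc set_take_subset by fast
  define J where "J = Idl (set (take i xs))"
  have J: "ideal J R" unfolding J_def by (rule genideal_ideal[OF tc])
  interpret J: ideal J R by (rule J)
  have "reg_seq {\<zero>} (take i xs @ xs ! i # drop (Suc i) xs)" using xs(2) i by (simp add: id_take_nth_drop[symmetric])
  then have x: "xs ! i \<in> carrier R" "\<And>u. \<lbrakk>u \<in> carrier R; xs ! i \<otimes> u \<in> J\<rbrakk> \<Longrightarrow> u \<in> J"
    unfolding J_def foldl_adjoin_eq_genideal[OF tc, symmetric] reg_seq_append by auto
  have "Y = J" if "Y \<in> carrier J.quot" "xs ! i \<odot>\<^bsub>J.quot\<^esub> Y = J" for Y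
  proof -
    obtain u where u: "u \<in> carrier R" "Y = J +> u" using \<open>Y \<in> carrier J.quot\<close> by (rule J.quotE)
    then have "xs ! i \<otimes> u \<in> J"
      using that(2) J.quot_smult[OF x(1) u(1)] J.coset_eq_self_iff[of "xs ! i \<otimes> u"] x(1) by simp
    then show ?thesis using x(2)[OF u(1)] J.coset_eq_self_iff[OF u(1)] u(2) by simp
  qed
  then show "nonzerodivisor_on R (quotient_module (ring_as_module R) (Idl (set (take i xs)))) (xs ! i)"
    unfolding J_def[symmetric] nonzerodivisor_on_def using x(1) by (simp add: J.quot_zero)
qed

end

theorem lemma2:
  fixes R :: "('a, 'r) ring_scheme" and E :: "('a, 'e, 'm) module_scheme"
  assumes "regular_ring R"
    and "module R E"
    and "\<And>J xs. \<lbrakk>ideal J R; regular_sequence R xs; J = Idl\<^bsub>R\<^esub> (set xs)\<rbrakk> \<Longrightarrow>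
      carrier (Ext1 R (quotient_module (ring_as_module R) J) E) =
        {\<zero>\<^bsub>Ext1 R (quotient_module (ring_as_module R) J) E\<^esub>}"
  shows "injective_module TYPE('b) TYPE('c) R E"
proof (rule baer_criterion[OF assms(2)])
  have noeth: "noetherian_ring R" using assms(1) by (simp add: regular_ring_def)
  interpret N: noetherian_cring R by (intro noetherian_cring.intro module.axioms(1)[OF assms(2)] noeth)
  interpret E: module R E by (rule assms(2))
  fix I assume I: "ideal I R"
  show "E.extends_to_ring I"
  proof (rule E.extends_to_ring_all[OF noeth _ I])
    fix P assume P: "primeideal P R"
    obtain xs where xs: "set xs \<subseteq> P" "N.reg_seq {\<zero>\<^bsub>R\<^esub>} xs" "P \<subseteq> N.sat P (foldl N.adjoin {\<zero>\<^bsub>R\<^esub>} xs)"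
      using N.reg_seq_generating_prime_locally[OF regular_ring_imp_regular_at[OF assms(1)] P] by blast
    have xsc: "set xs \<subseteq> carrier R" using xs(1) N.primeideal_subset_carrier[OF P] by blast
    define J where "J = Idl\<^bsub>R\<^esub> (set xs)"
    have J: "ideal J R" unfolding J_def by (rule N.genideal_ideal[OF xsc])
    have "J \<subseteq> P" unfolding J_def by (rule N.genideal_minimal[OF primeideal.axioms(1)[OF P] xs(1)])
    moreover have "E.extends_to_ring J"
      using E.Ext1_quotient_trivial_imp_extends[OF J]
        assms(3)[OF J N.reg_seq_imp_regular_sequence[OF P xs(1,2)] J_def] by blast
    \<comment> \<open>Local generation of P by xs becomes a single denominator s with sP \<subseteq>
      J.\<close>
    moreover obtain s where "s \<in> carrier R" "s \<notin> P" "\<And>p. p \<in> P \<Longrightarrow> s \<otimes>\<^bsub>R\<^esub> p \<in> J"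
      using N.sat_uniform[OF P J] xs(3) unfolding J_def N.foldl_adjoin_eq_genideal[OF xsc] by blast
    ultimately show "\<exists>J s. J \<subseteq> P \<and> E.extends_to_ring J \<and> s \<in> carrier R \<and> s \<notin> P \<and> (\<forall>p\<in>P. s \<otimes>\<^bsub>R\<^esub> p \<in> J)"
      by blast
  qed
qed

end
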